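(* No non-trivial finite group has an omniversal Cayley table. The finite groups whose Cayley tables are near-omniversal are exactly $\mathbb{Z}_2$, $\mathbb{Z}_3$, $\mathbb{Z}_5$, $\mathbb{Z}_6$, $D_6$, $D_8$ and the non-abelian groups of order $16$.
   Context: The Cayley table of a finite group $G$ of order $n$ is the Latin square of order $n$ with rows and columns indexed by $G$ whose cell $(g,h)$ contains the symbol $gh$; it is viewed as the set of triples $(g,h,gh)$. A partial transversal of a Latin square is a set of its triples containing at most one triple in each row, at most one in each column, and at most one with each symbol; its length is its number of triples. It is maximal if it is not contained in a partial transversal of greater length. A Latin square of order $n$ is omniversal if it has a maximal partial transversal of every length $\ell$ with $\lceil n/2\rceil\le\ell\le n$, and near-omniversal if there is exactly one such $\ell$ for which it has no maximal partial transversal of length $\ell$. $\mathbb{Z}_k$ denotes the cyclic group of order $k$ and $D_k$ the dihedral group of order $k$. *)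

theory Defs
  imports "HOL-Algebra.Algebra"
begin

section \<open>Latin squares and partial transversals\<close>

text \<open>A Latin square is a set of triples (row, column, symbol); its index sets are the
  three coordinate projections.\<close>

definition latin_square :: "nat \<Rightarrow> ('r \<times> 'c \<times> 's) set \<Rightarrow> bool" where
  "latin_square n L \<longleftrightarrow>
     (\<exists>R C S. finite R \<and> finite C \<and> finite S \<and> card R = n \<and> card C = n \<and> card S = n \<and>
        L \<subseteq> R \<times> C \<times> S \<and>
        (\<forall>r\<in>R. \<forall>c\<in>C. \<exists>!s. (r, c, s) \<in> L) \<and>
        (\<forall>r\<in>R. \<forall>s\<in>S. \<exists>!c. (r, c, s) \<in> L) \<and>
        (\<forall>c\<in>C. \<forall>s\<in>S. \<exists>!r. (r, c, s) \<in> L))"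

definition partial_transversal :: "('r \<times> 'c \<times> 's) set \<Rightarrow> ('r \<times> 'c \<times> 's) set \<Rightarrow> bool" where
  "partial_transversal L T \<longleftrightarrow>
     T \<subseteq> L \<and> inj_on (\<lambda>(r, c, s). r) T \<and> inj_on (\<lambda>(r, c, s). c) T \<and> inj_on (\<lambda>(r, c, s). s) T"

text \<open>The length of \<open>T\<close> is \<open>card T\<close>.\<close>

definition maximal_partial_transversal ::
    "('r \<times> 'c \<times> 's) set \<Rightarrow> ('r \<times> 'c \<times> 's) set \<Rightarrow> bool" where
  "maximal_partial_transversal L T \<longleftrightarrow>
     partial_transversal L T \<and>
     \<not> (\<exists>T'. partial_transversal L T' \<and> T \<subseteq> T' \<and> card T < card T')"

definition has_maximal_of_length :: "('r \<times> 'c \<times> 's) set \<Rightarrow> nat \<Rightarrow> bool" where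
  "has_maximal_of_length L l \<longleftrightarrow> (\<exists>T. maximal_partial_transversal L T \<and> card T = l)"

text \<open>In the next two definitions, \<open>n\<close> is meant to be the order of the Latin square \<open>L\<close>.\<close>

definition omniversal :: "nat \<Rightarrow> ('r \<times> 'c \<times> 's) set \<Rightarrow> bool" where
  "omniversal n L \<longleftrightarrow> (\<forall>l. nat \<lceil>real n / 2\<rceil> \<le> l \<and> l \<le> n \<longrightarrow> has_maximal_of_length L l)"

definition near_omniversal :: "nat \<Rightarrow> ('r \<times> 'c \<times> 's) set \<Rightarrow> bool" where
  "near_omniversal n L \<longleftrightarrow>
     (\<exists>!l. nat \<lceil>real n / 2\<rceil> \<le> l \<and> l \<le> n \<and> \<not> has_maximal_of_length L l)"

section \<open>Cayley tables\<close>

definition cayley_table :: "('a, 'b) monoid_scheme \<Rightarrow> ('a \<times> 'a \<times> 'a) set" where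
  "cayley_table G = {(g, h, g \<otimes>\<^bsub>G\<^esub> h) | g h. g \<in> carrier G \<and> h \<in> carrier G}"

lemma latin_square_cayley_table:
  fixes G (structure)
  assumes "group G" and "finite (carrier G)"
  shows "latin_square (order G) (cayley_table G)"
proof -
  interpret group G by fact
  have 1: "\<exists>!s. (r, c, s) \<in> cayley_table G" if "r \<in> carrier G" "c \<in> carrier G" for r c
    using that by (auto simp: cayley_table_def)
  have 2: "\<exists>!c. (r, c, s) \<in> cayley_table G" if "r \<in> carrier G" "s \<in> carrier G" for r s
  proof (rule ex1I)
    show "(r, inv r \<otimes> s, s) \<in> cayley_table G"
      using that by (auto simp: cayley_table_def m_assoc[symmetric])
  qed (use that in \<open>auto simp: cayley_table_def m_assoc[symmetric]\<close>)
  have 3: "\<exists>!r. (r, c, s) \<in> cayley_table G" if "c \<in> carrier G" "s \<in> carrier G" for c s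
  proof (rule ex1I)
    show "(s \<otimes> inv c, c, s) \<in> cayley_table G"
      using that by (auto simp: cayley_table_def m_assoc)
  qed (use that in \<open>auto simp: cayley_table_def m_assoc\<close>)
  have "cayley_table G \<subseteq> carrier G \<times> carrier G \<times> carrier G"
    by (auto simp: cayley_table_def)
  then show ?thesis
    unfolding latin_square_def
    using 1 2 3 assms(2)
    by (intro exI[of _ "carrier G"]) (simp add: order_def)
qed

section \<open>Dihedral groups\<close>

text \<open>The dihedral group of order \<open>k\<close>, for even \<open>k > 0\<close>: with \<open>m = k div 2\<close>, the pair \<open>(i, e)\<close>
  stands for the element \<open>r\<^sup>i s\<^sup>e\<close>, where \<open>r\<close> is a rotation of order \<open>m\<close> and \<open>s\<close> is a reflection
  that is present iff \<open>e\<close> holds; the product encodes \<open>s r\<^sup>i = r\<^sup>-\<^sup>i s\<close>.\<close>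

definition dihedral_group :: "nat \<Rightarrow> (int \<times> bool) monoid" where
  "dihedral_group k =
     \<lparr>carrier = {0..<int (k div 2)} \<times> UNIV,
      monoid.mult = (\<lambda>(i, d) (j, e). ((if d then i - j else i + j) mod int (k div 2), d \<noteq> e)),
      one = (0, False)\<rparr>"

lemma group_dihedral_group:
  assumes "even k" and "k > 0"
  shows "group (dihedral_group k)"
proof -
  have m: "int (k div 2) > 0"
    using assms by (auto elim: evenE)
  show ?thesis
  proof (rule groupI)
    fix x y z
    show "x \<otimes>\<^bsub>dihedral_group k\<^esub> y \<otimes>\<^bsub>dihedral_group k\<^esub> z =
          x \<otimes>\<^bsub>dihedral_group k\<^esub> (y \<otimes>\<^bsub>dihedral_group k\<^esub> z)"
      by (auto simp: dihedral_group_def mod_simps algebra_simps split: prod.splits)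
  next
    fix x
    assume x: "x \<in> carrier (dihedral_group k)"
    obtain i d where [simp]: "x = (i, d)"
      by (cases x)
    show "\<exists>y\<in>carrier (dihedral_group k). y \<otimes>\<^bsub>dihedral_group k\<^esub> x = \<one>\<^bsub>dihedral_group k\<^esub>"
      using m x
      by (intro bexI[of _ "(if d then i else (- i) mod int (k div 2), d)"])
        (auto simp: dihedral_group_def mod_simps)
  qed (use m in \<open>auto simp: dihedral_group_def\<close>)
qed

lemma order_dihedral_group:
  assumes "even k"
  shows "order (dihedral_group k) = k"
  using assms by (auto simp: order_def dihedral_group_def card_cartesian_product)

end

theory Submission
  imports Defs
begin

text \<open>Let \<open>R\<close>, \<open>C\<close>, \<open>S\<close> be the rows, columns and symbols that a maximal partial transversal of length
  \<open>n - k\<close> leaves unused. Then \<open>R C \<inter> S = {}\<close>, and the isoperimetric method confines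
  \<open>R\<close>, \<open>C\<close>, \<open>S\<close> to cosets of a subgroup of index two as soon as \<open>5 k > 2 n\<close>. A parity count of the triples of the
  transversal over the four coset rectangles then excludes every \<open>k\<close> with \<open>n\<close> odd or \<open>n / 2 + k\<close> odd. Together with
  two classical obstructions at full length (the product of all elements of an abelian group, and the sign of
  translations when \<open>n \<equiv> 2\<close> modulo 4) and with a sign argument at length \<open>n / 2\<close> when \<open>n \<equiv> 4\<close> modulo 8, this gives
  two missing lengths for every group that is not in the list, except for some groups of order 8, 10 and 24. There,
  characters, involutions and subgroups of order 3 supply the second missing length. The groups of order 16 are treated
  through their power-commutator presentations, with explicit transversals.\<close>

section \<open>Isoperimetry in finite groups\<close>

text \<open>The isoperimetric bound settles every gap k above 2n/5, and for even n only gaps of one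
  parity are excluded there, so everything turns on how many of those fit between 2n/5 and n/2. For
  orders divisible by 8 the gaps are n/2 - 1 and n/2 - 3, and both lie above the threshold from
  order 32 on. Order 16 keeps only k = 7; its abelian groups also lose one of the lengths n and n -
  1, its non-abelian groups lose nothing more. Orders 8, 10 and 24 fall just short: the gaps wanted
  there are 3, 4 and 9, where 5k is at most 2n. For 10 and 24 the estimates leave no slack, and this
  forces invariance under subgroups of order 2 and 3; order 24 then descends to a quotient of order
  8, where a finite check is feasible. The minimiser supplied by the isoperimetric method may belong
  to the inverse of the given set, so these arguments come in a left and a right version. The
  treatment of orders 8 and 16 avoids isomorphisms between abstract groups: elements satisfying a
  listed presentation are exhibited inside the given group.\<close>

locale finite_group = group +
  assumes finite_carrier [simp]: "finite (carrier G)"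
begin

lemma finite_subset_carrier: "A \<subseteq> carrier G \<Longrightarrow> finite A"
  using finite_carrier finite_subset by blast

lemma mem_set_mult: "x \<in> A <#> B \<longleftrightarrow> (\<exists>a\<in>A. \<exists>b\<in>B. x = a \<otimes> b)"
  by (auto simp: set_mult_def)

lemma mem_l_coset: "x \<in> a <# B \<longleftrightarrow> (\<exists>b\<in>B. x = a \<otimes> b)"
  by (auto simp: l_coset_def)

lemma mem_r_coset: "x \<in> B #> a \<longleftrightarrow> (\<exists>b\<in>B. x = b \<otimes> a)"
  by (auto simp: r_coset_def)

lemma card_l_coset [simp]:
  assumes "A \<subseteq> carrier G" "x \<in> carrier G"
  shows "card (x <# A) = card A"
proof -
  have "x <# A = (\<lambda>a. x \<otimes> a) ` A"
    by (auto simp: l_coset_def)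
  moreover have "inj_on (\<lambda>a. x \<otimes> a) A"
    using assms by (intro inj_onI) (auto simp: subset_iff)
  ultimately show ?thesis
    by (simp add: card_image)
qed

lemma card_r_coset [simp]:
  assumes "A \<subseteq> carrier G" "x \<in> carrier G"
  shows "card (A #> x) = card A"
proof -
  have "A #> x = (\<lambda>a. a \<otimes> x) ` A"
    by (auto simp: r_coset_def)
  moreover have "inj_on (\<lambda>a. a \<otimes> x) A"
    using assms by (intro inj_onI) (auto simp: subset_iff)
  ultimately show ?thesis
    by (simp add: card_image)
qed

lemma mem_set_inv: "x \<in> set_inv A \<longleftrightarrow> (\<exists>a\<in>A. x = inv a)"
  by (auto simp: SET_INV_def)

lemma set_inv_subset [simp]: "A \<subseteq> carrier G \<Longrightarrow> set_inv A \<subseteq> carrier G"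
  by (auto simp: mem_set_inv subset_iff)

lemma set_inv_set_inv [simp]: "A \<subseteq> carrier G \<Longrightarrow> set_inv (set_inv A) = A"
  by (force simp: SET_INV_def)

lemma card_set_inv [simp]:
  assumes "A \<subseteq> carrier G"
  shows "card (set_inv A) = card A"
proof -
  have "set_inv A = (\<lambda>a. inv a) ` A"
    by (auto simp: SET_INV_def)
  moreover have "inj_on (\<lambda>a. inv a) A"
    using assms inv_inj by (meson inj_on_subset)
  ultimately show ?thesis
    by (simp add: card_image)
qed

text \<open>For \<one> \<in> \<open>B\<close> this is the size of the outer boundary of
  \<open>U\<close> in the Cayley digraph with connection set \<open>B\<close>; the natural
  subtraction is exact because then \<open>U\<close> lies in \<open>U <#> B\<close>.\<close>

definition growth :: "'a set \<Rightarrow> 'a set \<Rightarrow> nat" where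
  "growth B U = card (U <#> B) - card U"

text \<open>The competitors in the isoperimetric problem. Without the last condition the whole group
  would win with growth 0.\<close>

definition separable :: "'a set \<Rightarrow> 'a set \<Rightarrow> bool" where
  "separable B U \<longleftrightarrow> U \<subseteq> carrier G \<and> U \<noteq> {} \<and> U <#> B \<noteq> carrier G"

lemma card_set_mult_growth:
  assumes "B \<subseteq> carrier G" "\<one> \<in> B" "U \<subseteq> carrier G"
  shows "card (U <#> B) = card U + growth B U"
proof -
  have "U \<subseteq> U <#> B"
    using assms by (force simp: mem_set_mult)
  moreover have "finite (U <#> B)"
    using assms by (intro finite_subset_carrier set_mult_closed)
  ultimately show ?thesis
    unfolding growth_def by (simp add: card_mono)
qed

text \<open>Multiplication by \<open>B\<close> commutes with unions but only maps an intersection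
  into the intersection of the images; inclusion-exclusion on both sides does the rest.\<close>

lemma growth_submodular:
  assumes B: "B \<subseteq> carrier G" "\<one> \<in> B" and U: "U \<subseteq> carrier G" and Y: "Y \<subseteq> carrier G"
  shows "growth B (U \<inter> Y) + growth B (U \<union> Y) \<le> growth B U + growth B Y"
proof -
  have fin: "finite U" "finite Y" "finite (U <#> B)" "finite (Y <#> B)"
    using assms by (simp_all add: finite_subset_carrier set_mult_closed)
  have "card ((U \<inter> Y) <#> B) \<le> card ((U <#> B) \<inter> (Y <#> B))"
    by (rule card_mono) (simp_all add: fin mono_set_mult)
  moreover have "card ((U \<union> Y) <#> B) + card ((U <#> B) \<inter> (Y <#> B)) =
      card (U <#> B) + card (Y <#> B)"
  proof -
    have "(U \<union> Y) <#> B = (U <#> B) \<union> (Y <#> B)"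
      unfolding set_mult_def by blast
    then show ?thesis
      using fin by (metis card_Un_Int)
  qed
  moreover have "card (U \<union> Y) + card (U \<inter> Y) = card U + card Y"
    using fin by (metis card_Un_Int)
  moreover have "card ((U \<inter> Y) <#> B) = card (U \<inter> Y) + growth B (U \<inter> Y)"
    "card ((U \<union> Y) <#> B) = card (U \<union> Y) + growth B (U \<union> Y)"
    "card (U <#> B) = card U + growth B U" "card (Y <#> B) = card Y + growth B Y"
    using U Y by (auto intro!: card_set_mult_growth[OF B])
  ultimately show ?thesis
    by linarith
qed

lemma growth_translate:
  assumes "B \<subseteq> carrier G" "U \<subseteq> carrier G" "g \<in> carrier G"
  shows "growth B (g <# U) = growth B U"
proof -
  have "(g <# U) <#> B = g <# (U <#> B)"
    using assms by (simp add: setmult_lcos_assoc)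
  then show ?thesis
    unfolding growth_def using assms by (simp add: set_mult_closed)
qed

lemma separable_translate:
  assumes "B \<subseteq> carrier G" "separable B U" "g \<in> carrier G"
  shows "separable B (g <# U)"
proof -
  have U: "U \<subseteq> carrier G" "U \<noteq> {}" "U <#> B \<noteq> carrier G"
    using assms(2) by (auto simp: separable_def)
  have "(g <# U) <#> B = g <# (U <#> B)"
    using assms U by (simp add: setmult_lcos_assoc)
  moreover have "card (U <#> B) < card (carrier G)"
    using U assms(1) set_mult_closed[of U B] by (intro psubset_card_mono) auto
  moreover have "card (g <# (U <#> B)) = card (U <#> B)"
    using assms U by (simp add: set_mult_closed)
  ultimately have "(g <# U) <#> B \<noteq> carrier G"
    by auto
  moreover have "g <# U \<subseteq> carrier G" "g <# U \<noteq> {}"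
    using U l_coset_subset_G[OF U(1) assms(3)] by (auto simp: l_coset_def)
  ultimately show ?thesis
    by (simp add: separable_def)
qed

text \<open>If y lies outside U B, then y b^-1 is never in \<open>U\<close>. So the complement of U
  B competes for the inverse of \<open>B\<close> with no larger growth, and its size is determined
  by that of U B. This exchange of \<open>B\<close> and its inverse controls large sets in the atom
  argument.\<close>

lemma separable_dual:
  assumes B: "B \<subseteq> carrier G" "\<one> \<in> B" and U: "separable B U"
  defines "U' \<equiv> carrier G - (U <#> B)"
  shows "separable (set_inv B) U'" and "growth (set_inv B) U' \<le> growth B U"
    and "card U' + card (U <#> B) = order G"
proof -
  have U': "U \<subseteq> carrier G" "U \<noteq> {}" "U <#> B \<noteq> carrier G" "U <#> B \<subseteq> carrier G"
    using U B by (auto simp: separable_def set_mult_closed)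
  have disj: "(U' <#> set_inv B) \<inter> U = {}"
  proof (rule ccontr)
    assume "\<not> ?thesis"
    then obtain y b where yb: "y \<in> U'" "b \<in> B" "y \<otimes> inv b \<in> U"
      by (auto simp: mem_set_mult mem_set_inv)
    then have "y \<in> carrier G" "b \<in> carrier G"
      using B by (auto simp: U'_def)
    then have "y = (y \<otimes> inv b) \<otimes> b"
      by (simp add: m_assoc)
    then show False
      using yb by (auto simp: U'_def mem_set_mult)
  qed
  have sub: "U' <#> set_inv B \<subseteq> carrier G"
    using B by (intro set_mult_closed) (auto simp: U'_def)
  show sep: "separable (set_inv B) U'"
    using U' disj unfolding separable_def by (auto simp: U'_def)
  have "card (U' <#> set_inv B) + card U \<le> order G"
    using disj sub U' by (subst card_Un_disjoint[symmetric])
      (auto simp: order_def intro!: card_mono intro: finite_subset_carrier)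
  moreover show card: "card U' + card (U <#> B) = order G"
    using U' unfolding U'_def order_def
    by (subst card_Diff_subset) (auto intro: finite_subset_carrier simp: card_mono)
  moreover have "\<one> \<in> set_inv B"
    using B by (force simp: mem_set_inv)
  then have "card (U' <#> set_inv B) = card U' + growth (set_inv B) U'"
    using B by (intro card_set_mult_growth) (auto simp: U'_def)
  ultimately show "growth (set_inv B) U' \<le> growth B U"
    using card_set_mult_growth[OF B U'(1)] by linarith
qed

text \<open>Hamidoune's isoperimetric method: two smallest minimisers of \<open>growth\<close>, taken over \<open>B\<close> and
  \<open>B\<^sup>-\<^sup>1\<close> together, are disjoint or equal by submodularity, so the one through \<open>\<one>\<close> is a subgroup.\<close>

theorem isoperimetric_atom:
  assumes B: "B \<subseteq> carrier G" "\<one> \<in> B" and sep: "separable B U0"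
  obtains H B' where "subgroup H G" "B' = B \<or> B' = set_inv B" "separable B' H"
    "\<And>U. separable B U \<Longrightarrow> growth B' H \<le> growth B U"
    "\<And>U. separable (set_inv B) U \<Longrightarrow> growth B' H \<le> growth (set_inv B) U"
    "\<And>U. separable B' U \<Longrightarrow> growth B' U = growth B' H \<Longrightarrow> U <#> H = U"
proof -
  define F where "F B' U \<longleftrightarrow> (B' = B \<or> B' = set_inv B) \<and> separable B' U" for B' U
  have F_carrier: "B' \<subseteq> carrier G" "\<one> \<in> B'" "set_inv B' = B \<or> set_inv B' = set_inv B"
    if "F B' U" for B' U
    using that B by (force simp: F_def mem_set_inv)+
  obtain p where p: "F (fst p) (snd p)"
    and p_min: "\<And>q. F (fst q) (snd q) \<Longrightarrow> growth (fst p) (snd p) \<le> growth (fst q) (snd q)"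
    using ex_has_least_nat[of "\<lambda>p. F (fst p) (snd p)" "(B, U0)" "\<lambda>p. growth (fst p) (snd p)"] sep
    unfolding F_def fst_conv snd_conv by blast
  define \<kappa> where "\<kappa> = growth (fst p) (snd p)"
  \<comment> \<open>A lexicographic minimum: first the growth, then the cardinality, each over
    \<open>B\<close> and its inverse simultaneously.\<close>
  obtain q where q: "F (fst q) (snd q)" "growth (fst q) (snd q) = \<kappa>"
    and q_min: "\<And>r. F (fst r) (snd r) \<and> growth (fst r) (snd r) = \<kappa> \<Longrightarrow> card (snd q) \<le> card (snd r)"
    using ex_has_least_nat[of "\<lambda>p. F (fst p) (snd p) \<and> growth (fst p) (snd p) = \<kappa>" p "\<lambda>p. card (snd p)"] p
    unfolding \<kappa>_def by blast
  define B' where "B' = fst q"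
  have FY: "F B' (snd q)"
    using q by (simp add: B'_def)
  note B' = F_carrier(1,2)[OF FY]
  have sepF: "F B' U" if "separable B' U" for U
    using FY that by (simp add: F_def)
  have min: "\<kappa> \<le> growth B'' U" if "F B'' U" for B'' U
    using p_min[of "(B'', U)"] that by (simp add: \<kappa>_def)
  have small: "card (snd q) \<le> card U" if "F B'' U" "growth B'' U = \<kappa>" for B'' U
    using q_min[of "(B'', U)"] that by simp
  define atom where "atom Y \<longleftrightarrow> separable B' Y \<and> growth B' Y = \<kappa> \<and> card Y = card (snd q)" for Y
  have sub: "Y \<subseteq> U" if Y: "atom Y" and U: "separable B' U" "growth B' U = \<kappa>" and meet: "Y \<inter> U \<noteq> {}" for U Y
  proof (rule ccontr)
    assume n: "\<not> Y \<subseteq> U"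
    have YX: "Y \<subseteq> carrier G" "U \<subseteq> carrier G" "U <#> B' \<subseteq> carrier G"
      using U Y B' by (auto simp: atom_def separable_def set_mult_closed)
    have fin: "finite U" "finite Y"
      using YX by (auto intro: finite_subset_carrier)
    have lt: "card (Y \<inter> U) < card Y"
      using n fin by (intro psubset_card_mono) auto
    have "(Y \<inter> U) <#> B' \<subseteq> U <#> B'"
      by (simp add: mono_set_mult)
    then have "separable B' (Y \<inter> U)"
      using U YX meet unfolding separable_def by blast
    then have "\<kappa> \<le> growth B' (Y \<inter> U)" "growth B' (Y \<inter> U) \<noteq> \<kappa>"
      using min sepF small[of B' "Y \<inter> U"] lt Y by (force simp: atom_def)+
    moreover have "growth B' (Y \<inter> U) + growth B' (Y \<union> U) \<le> growth B' Y + growth B' U"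
      using growth_submodular[OF B'] YX by blast
    ultimately have "growth B' (Y \<union> U) < \<kappa>"
      using U Y by (auto simp: atom_def)
    then have "\<not> separable B' (Y \<union> U)"
      using min sepF by (meson not_le)
    then have "(Y \<union> U) <#> B' = carrier G"
      using YX meet by (auto simp: separable_def)
    then have "order G = card (Y \<union> U) + growth B' (Y \<union> U)"
      using card_set_mult_growth[OF B', of "Y \<union> U"] YX by (simp add: order_def)
    moreover have "card (Y \<union> U) + card (Y \<inter> U) = card Y + card U"
      using fin by (metis card_Un_Int)
    moreover have "card (U <#> B') = card U + \<kappa>"
      using card_set_mult_growth[OF B'] U YX by simp
    \<comment> \<open>The complement of U B' is again a minimiser, for the inverse set, so an atom
      cannot be larger than it. This contradicts the equation for \<open>order G\<close> obtained
      from (Y \<union> U) B' = G, where the growth is below \<kappa>.\<close>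
    moreover have "card Y \<le> card (carrier G - (U <#> B'))"
    proof -
      note d = separable_dual[OF B' U(1)]
      have "F (set_inv B') (carrier G - (U <#> B'))"
        using d(1) F_carrier(3)[OF FY] by (simp add: F_def)
      moreover have "growth (set_inv B') (carrier G - (U <#> B')) = \<kappa>"
        using d(2) U(2) min[OF calculation] by simp
      ultimately show ?thesis
        using small Y by (auto simp: atom_def)
    qed
    ultimately show False
      using separable_dual(3)[OF B' U(1)] \<open>growth B' (Y \<union> U) < \<kappa>\<close> lt meet by linarith
  qed
  have translate: "atom (g <# Y)" if "atom Y" "g \<in> carrier G" for g Y
    using that B' separable_translate[of B' Y g] growth_translate[of B' Y g]
    by (simp add: atom_def separable_def)
  have "atom (snd q)"
    using q FY by (auto simp: atom_def F_def B'_def)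
  moreover obtain y where y: "y \<in> snd q" "y \<in> carrier G"
    using FY by (auto simp: F_def separable_def)
  define H where "H = inv y <# snd q"
  have H: "atom H"
    unfolding H_def using translate calculation y by simp
  have H_carrier: "H \<subseteq> carrier G"
    using H by (auto simp: atom_def separable_def)
  have one: "\<one> \<in> H"
    unfolding H_def mem_l_coset using y by (auto intro!: bexI[of _ y])
  \<comment> \<open>Both sides are atoms through \<one>, so one contains the other and the equal
    sizes do the rest. Closure under inverses and products is read off from this equation.\<close>
  have inv_coset: "inv h <# H = H" if "h \<in> H" for h
  proof -
    have h: "h \<in> carrier G"
      using that H_carrier by blast
    have a: "atom (inv h <# H)"
      using translate[OF H] h by simp
    have "\<one> \<in> inv h <# H"
      unfolding mem_l_coset using that h by (auto intro!: bexI[of _ h])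
    then have "inv h <# H \<subseteq> H"
      using sub[OF a, of H] H one by (auto simp: atom_def)
    then show ?thesis
      using H_carrier h finite_subset_carrier by (intro card_subset_eq) auto
  qed
  have subgroup: "subgroup H G"
  proof (rule subgroupI)
    fix h
    assume h: "h \<in> H"
    then have "inv h = inv h \<otimes> \<one>"
      using H_carrier by auto
    then show inv: "inv h \<in> H"
      using inv_coset[OF h] one by (metis mem_l_coset)
    fix k
    assume "k \<in> H"
    then have "inv (inv h) \<otimes> k \<in> H"
      using inv_coset[OF inv] by (metis mem_l_coset)
    then show "h \<otimes> k \<in> H"
      using h H_carrier by auto
  qed (use H_carrier one in auto)
  have fixed: "U <#> H = U" if U: "separable B' U" "growth B' U = growth B' H" for U
  proof
    have UC: "U \<subseteq> carrier G"
      using U by (auto simp: separable_def)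
    show "U \<subseteq> U <#> H"
      using one UC by (force simp: mem_set_mult)
    have "x <# H \<subseteq> U" if "x \<in> U" for x
    proof (rule sub)
      show "atom (x <# H)"
        using translate[OF H] that UC by auto
      have "x \<in> x <# H"
        using that UC one by (force simp: mem_l_coset)
      then show "(x <# H) \<inter> U \<noteq> {}"
        using that by blast
      show "separable B' U"
        by fact
      show "growth B' U = \<kappa>"
        using U(2) H by (simp add: atom_def)
    qed
    then show "U <#> H \<subseteq> U"
      unfolding set_mult_def l_coset_def by blast
  qed
  show thesis
  proof (rule that)
    show "separable B' H"
      using H by (simp add: atom_def)
    show "B' = B \<or> B' = set_inv B"
      using FY by (simp add: F_def)
    show "growth B' H \<le> growth B U" if "separable B U" for U
      using min[of B U] that H by (simp add: atom_def F_def)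
    show "growth B' H \<le> growth (set_inv B) U" if "separable (set_inv B) U" for U
      using min[of "set_inv B" U] that H by (simp add: atom_def F_def)
  qed (fact subgroup fixed)+
qed

end

section \<open>Trios\<close>

context finite_group
begin

section \<open>Invariant sets and subgroups of index two\<close>

lemma card_dvd_left_invariant:
  assumes H: "subgroup H G" and U: "U \<subseteq> carrier G" "H <#> U = U"
  shows "card H dvd card U"
proof -
  interpret H: subgroup H G by fact
  have "(\<Union>u\<in>U. H #> u) = U"
    using U(2) unfolding set_mult_def r_coset_def by blast
  moreover have "card H * card ((\<lambda>u. H #> u) ` U) = card (\<Union>u\<in>U. H #> u)"
  proof (rule card_partition)
    show "finite ((\<lambda>u. H #> u) ` U)" "finite (\<Union>u\<in>U. H #> u)"
      using calculation finite_subset_carrier[OF U(1)] by simp_all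
    fix c d
    assume c: "c \<in> (\<lambda>u. H #> u) ` U"
    then show "card c = card H"
      using U(1) H.subset by auto
    assume "d \<in> (\<lambda>u. H #> u) ` U" "c \<noteq> d"
    then show "c \<inter> d = {}"
      using c U(1) rcos_disjoint[OF H] rcosetsI[OF H.subset] unfolding pairwise_def disjnt_def
      by blast
  qed
  ultimately show ?thesis
    by (metis dvd_triv_left)
qed

lemma set_inv_set_mult:
  assumes "A \<subseteq> carrier G" "B \<subseteq> carrier G"
  shows "set_inv (A <#> B) = set_inv B <#> set_inv A"
proof -
  have "inv (a \<otimes> b) = inv b \<otimes> inv a" if "a \<in> A" "b \<in> B" for a b
    using that assms by (auto simp: inv_mult_group subset_iff)
  then show ?thesis
    unfolding SET_INV_def set_mult_def by auto
qed

lemma set_inv_subgroup: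
  assumes "subgroup H G"
  shows "set_inv H = H"
proof -
  interpret H: subgroup H G by fact
  have sub: "set_inv H \<subseteq> H"
    by (auto simp: mem_set_inv)
  moreover have "card (set_inv H) = card H" "finite H"
    using H.subset by (auto intro: finite_subset_carrier)
  ultimately show ?thesis
    by (intro card_subset_eq)
qed

lemma card_dvd_right_invariant:
  assumes H: "subgroup H G" and U: "U \<subseteq> carrier G" "U <#> H = U"
  shows "card H dvd card U"
proof -
  have "H <#> set_inv U = set_inv U"
    using set_inv_set_mult[OF U(1), of H] U H by (simp add: set_inv_subgroup subgroup.subset)
  then show ?thesis
    using card_dvd_left_invariant[OF H, of "set_inv U"] U by simp
qed

lemma card_subgroup_dvd: "subgroup H G \<Longrightarrow> card H dvd order G"
  using lagrange by (metis dvd_triv_right)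

text \<open>Membership is the parity given by the quotient of order two. The one case that is not
  formal, two factors outside \<open>H\<close>, follows by counting: x H has the size of the
  complement of \<open>H\<close> and avoids \<open>H\<close>, so it is that complement.\<close>

lemma index_two_mult:
  assumes H: "subgroup H G" "2 * card H = order G" and xy: "x \<in> carrier G" "y \<in> carrier G"
  shows "x \<otimes> y \<in> H \<longleftrightarrow> (x \<in> H \<longleftrightarrow> y \<in> H)"
proof -
  interpret H: subgroup H G by fact
  have one: "x \<otimes> y \<notin> H" if "x \<in> H" "y \<notin> H" "x \<in> carrier G" "y \<in> carrier G" for x y
    using that by (metis H.m_closed H.m_inv_closed inv_solve_left m_closed)
  have two: "x \<otimes> y \<notin> H" if "x \<notin> H" "y \<in> H" "x \<in> carrier G" "y \<in> carrier G" for x y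
    using that by (metis H.m_closed H.m_inv_closed inv_solve_right m_closed)
  have "x \<otimes> y \<in> H" if "x \<notin> H" "y \<notin> H"
  proof -
    have sub: "x <# H \<subseteq> carrier G - H"
      using two that xy by (auto simp: mem_l_coset)
    moreover have "card (carrier G - H) = card H"
      using H(2) by (simp add: card_Diff_subset finite_subset_carrier H.subset order_def)
    ultimately have eq: "x <# H = carrier G - H"
      using xy H.subset by (intro card_subset_eq) auto
    show ?thesis
    proof (rule ccontr)
      assume "x \<otimes> y \<notin> H"
      then have "x \<otimes> y \<in> x <# H"
        using eq xy by auto
      then obtain h where "h \<in> H" "x \<otimes> y = x \<otimes> h"
        by (auto simp: mem_l_coset)
      then show False
        using xy that by (metis H.mem_carrier l_cancel)
    qed
  qed
  then show ?thesis
    using one two xy by (cases "x \<in> H"; cases "y \<in> H") auto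
qed

text \<open>The unused rows \<open>R\<close>, columns \<open>C\<close> and symbols \<open>S\<close> of a maximal partial transversal satisfy
  \<open>R C \<inter> S = {}\<close>. In terms of \<open>R\<close>, \<open>C\<close> and \<open>S\<^sup>-\<^sup>1\<close> this condition becomes invariant under rotation.\<close>

definition trio :: "nat \<Rightarrow> 'a set \<Rightarrow> 'a set \<Rightarrow> 'a set \<Rightarrow> bool" where
  "trio k A B D \<longleftrightarrow> A \<subseteq> carrier G \<and> B \<subseteq> carrier G \<and> D \<subseteq> carrier G \<and>
     card A = k \<and> card B = k \<and> card D = k \<and> (\<forall>a\<in>A. \<forall>b\<in>B. \<forall>d\<in>D. a \<otimes> b \<otimes> d \<noteq> \<one>)"

lemma trio_rotate:
  assumes "trio k A B D"
  shows "trio k B D A"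
proof -
  have "a \<otimes> b \<otimes> d = \<one>" if "b \<otimes> d \<otimes> a = \<one>" "a \<in> carrier G" "b \<in> carrier G" "d \<in> carrier G" for a b d
    using that by (metis inv_comm m_assoc m_closed)
  then have "b \<otimes> d \<otimes> a \<noteq> \<one>" if "a \<in> A" "b \<in> B" "d \<in> D" for a b d
    using that assms unfolding trio_def by (metis subsetD)
  then show ?thesis
    using assms unfolding trio_def by blast
qed

text \<open>Inverting a b d reverses the factors. This provides a competitor for the inverse of
  \<open>B\<close>, which is needed because the atom may belong to that set.\<close>

lemma trio_dual:
  assumes "trio k A B D"
  shows "trio k (set_inv D) (set_inv B) (set_inv A)"
proof -
  have "a \<otimes> b \<otimes> d = \<one>" if "inv d \<otimes> inv b \<otimes> inv a = \<one>" "a \<in> carrier G" "b \<in> carrier G" "d \<in> carrier G" for a b d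
  proof -
    have "inv (a \<otimes> b \<otimes> d) = \<one>"
      using that by (simp add: inv_mult_group m_assoc)
    then show ?thesis
      using that by (metis inv_eq_1_iff m_closed)
  qed
  then have "inv d \<otimes> inv b \<otimes> inv a \<noteq> \<one>" if "a \<in> A" "b \<in> B" "d \<in> D" for a b d
    using that assms unfolding trio_def by (metis subsetD)
  then show ?thesis
    using assms unfolding trio_def by (auto simp: mem_set_inv)
qed

text \<open>A factor c^-1 c is inserted between b and d. The purpose is to bring \<one> into the
  middle set, as the growth estimates require.\<close>

lemma trio_translate:
  assumes "trio k A B D" "c \<in> carrier G"
  shows "trio k A (B #> inv c) (c <# D)"
proof -
  have *: "a \<otimes> (b \<otimes> inv c) \<otimes> (c \<otimes> d) = a \<otimes> b \<otimes> d"
    if "a \<in> carrier G" "b \<in> carrier G" "d \<in> carrier G" for a b d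
  proof -
    have "inv c \<otimes> (c \<otimes> d) = d"
      using that assms(2) by (simp add: m_assoc[symmetric])
    then show ?thesis
      using that assms(2) by (simp add: m_assoc)
  qed
  have sub: "A \<subseteq> carrier G" "B \<subseteq> carrier G" "D \<subseteq> carrier G"
    using assms(1) by (auto simp: trio_def)
  have "a \<otimes> b \<otimes> d \<noteq> \<one>" if abd: "a \<in> A" "b \<in> B #> inv c" "d \<in> c <# D" for a b d
  proof -
    obtain b' d' where "b' \<in> B" "b = b' \<otimes> inv c" "d' \<in> D" "d = c \<otimes> d'"
      using abd unfolding mem_r_coset mem_l_coset by blast
    moreover have "a \<otimes> b' \<otimes> d' \<noteq> \<one>"
      using abd(1) assms(1) calculation unfolding trio_def by blast
    moreover have "a \<in> carrier G" "b' \<in> carrier G" "d' \<in> carrier G"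
      using abd(1) calculation sub by auto
    ultimately show ?thesis
      using * by simp
  qed
  then show ?thesis
    using assms sub r_coset_subset_G[of B "inv c"] l_coset_subset_G[of D c] by (simp add: trio_def)
qed

lemma trio_card_set_mult:
  assumes "trio k A B D"
  shows "card (A <#> B) + k \<le> order G"
proof -
  have sub: "A \<subseteq> carrier G" "B \<subseteq> carrier G" "D \<subseteq> carrier G"
    using assms by (auto simp: trio_def)
  have "(A <#> B) \<inter> set_inv D = {}"
  proof -
    have "a \<otimes> b \<noteq> inv d" if "a \<in> A" "b \<in> B" "d \<in> D" for a b d
      using that assms sub unfolding trio_def by (metis l_inv subsetD)
    then show ?thesis
      unfolding SET_INV_def set_mult_def by fastforce
  qed
  moreover have "A <#> B \<subseteq> carrier G"
    using sub by (simp add: set_mult_closed)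
  ultimately have "card (A <#> B) + card (set_inv D) \<le> card (carrier G)"
    using sub finite_carrier set_inv_subset[of D] by (metis Un_least card_Un_disjoint card_mono finite_subset)
  then show ?thesis
    using assms by (simp add: trio_def order_def)
qed

text \<open>Since A B misses the k inverses of elements of \<open>D\<close>, the set
  \<open>A\<close> is a competitor for \<open>B\<close>, and its growth bounds the minimal growth by
  n - 2k.\<close>

lemma trio_growth:
  assumes "trio k A B D" "0 < k" "\<one> \<in> B"
  shows "separable B A" and "growth B A + 2 * k \<le> order G"
proof -
  have sub: "A \<subseteq> carrier G" "B \<subseteq> carrier G" "card A = k"
    using assms by (auto simp: trio_def)
  have "card (A <#> B) < order G"
    using trio_card_set_mult[OF assms(1)] assms(2) by linarith
  then show "separable B A"
    using sub assms(2) by (auto simp: separable_def order_def)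
  show "growth B A + 2 * k \<le> order G"
    using trio_card_set_mult[OF assms(1)] card_set_mult_growth[of B A] sub assms(3) by simp
qed

text \<open>After moving b to \<one>, the set \<open>A\<close> competes for the translate of
  \<open>B\<close>, and the inverse of b D competes for its inverse, both with growth at most n -
  2k. If the atom has exactly this growth, then the one of the two that belongs to the atom's
  connection set is itself a minimiser and hence a union of left cosets of \<open>H\<close>.\<close>

lemma trio_atom:
  assumes t: "trio k A B D" and k: "0 < k" and b: "b \<in> B"
  obtains H B' where "subgroup H G" "B' = B #> inv b \<or> B' = set_inv (B #> inv b)"
    "B' \<subseteq> carrier G" "\<one> \<in> B'" "card B' = k" "H <#> B' \<noteq> carrier G"
    "card (H <#> B') = card H + growth B' H" "growth B' H + 2 * k \<le> order G"
    "growth B' H + 2 * k = order G \<Longrightarrow> B' = B #> inv b \<Longrightarrow> A <#> H = A"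
    "growth B' H + 2 * k = order G \<Longrightarrow> B' = set_inv (B #> inv b) \<Longrightarrow> H <#> (b <# D) = b <# D"
    "growth B' H + 2 * k = order G \<Longrightarrow> card (A <#> B) + k = order G"
proof -
  define B0 where "B0 = B #> inv b"
  define D0 where "D0 = b <# D"
  have sub: "B \<subseteq> carrier G" "D \<subseteq> carrier G" "b \<in> carrier G"
    using t b by (auto simp: trio_def)
  have t0: "trio k A B0 D0"
    unfolding B0_def D0_def by (rule trio_translate) (use t sub in auto)
  then have t1: "trio k (set_inv D0) (set_inv B0) (set_inv A)"
    by (rule trio_dual)
  have sub0: "B0 \<subseteq> carrier G" "card B0 = k" "D0 \<subseteq> carrier G"
    using t0 by (auto simp: trio_def)
  have one: "\<one> \<in> B0"
    unfolding B0_def mem_r_coset using b sub by (auto intro!: bexI[of _ b])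
  then have one': "\<one> \<in> set_inv B0"
    unfolding mem_set_inv by (auto intro!: bexI[of _ \<one>])
  note g0 = trio_growth[OF t0 k one] and g1 = trio_growth[OF t1 k one']
  obtain H B' where H: "subgroup H G" "B' = B0 \<or> B' = set_inv B0" "separable B' H"
    "\<And>U. separable B0 U \<Longrightarrow> growth B' H \<le> growth B0 U"
    "\<And>U. separable (set_inv B0) U \<Longrightarrow> growth B' H \<le> growth (set_inv B0) U"
    "\<And>U. separable B' U \<Longrightarrow> growth B' U = growth B' H \<Longrightarrow> U <#> H = U"
    using isoperimetric_atom[OF sub0(1) one g0(1)] by blast
  have B': "B' \<subseteq> carrier G" "\<one> \<in> B'" "card B' = k"
    using H(2) sub0 one one' set_inv_subset[OF sub0(1)] card_set_inv[OF sub0(1)] by metis+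
  show thesis
  proof (rule that[folded B0_def D0_def, OF H(1,2) B'])
    show "H <#> B' \<noteq> carrier G"
      using H(3) by (simp add: separable_def)
    show "card (H <#> B') = card H + growth B' H"
      using card_set_mult_growth B' subgroup.subset[OF H(1)] by blast
    show "growth B' H + 2 * k \<le> order G"
      using H(4)[OF g0(1)] g0(2) by linarith
    show "card (A <#> B) + k = order G" if "growth B' H + 2 * k = order G"
    proof -
      have "growth B0 A + 2 * k = order G"
        using H(4)[OF g0(1)] g0(2) that by linarith
      moreover have "card (A <#> B0) = card A + growth B0 A" "card A = k"
        using card_set_mult_growth[OF sub0(1) one] t by (simp_all add: trio_def)
      moreover have "A <#> B0 = (A <#> B) #> inv b"
        unfolding B0_def using t sub by (simp add: trio_def setmult_rcos_assoc)
      moreover have "A <#> B \<subseteq> carrier G"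
        using t by (simp add: trio_def set_mult_closed)
      ultimately show ?thesis
        using sub by simp
    qed
    show "A <#> H = A" if "growth B' H + 2 * k = order G" "B' = B0"
      using H(4)[OF g0(1)] g0(2) that H(6)[of A] g0(1) by simp
    show "H <#> D0 = D0" if "growth B' H + 2 * k = order G" "B' = set_inv B0"
    proof -
      have "set_inv D0 <#> H = set_inv D0"
        using H(5)[OF g1(1)] g1(2) that H(6)[of "set_inv D0"] g1(1) by simp
      then have "set_inv (set_inv D0 <#> H) = D0"
        using sub0 by simp
      then show ?thesis
        using set_inv_set_mult[of "set_inv D0" H] sub0 H(1)
        by (simp add: set_inv_subgroup subgroup.subset)
    qed
  qed
qed

text \<open>If \<open>A\<close> met both cosets, the translates a B and a' B would lie in different
  cosets, so A B would have at least 2k elements. It has at most n - k < 2k.\<close>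

lemma trio_index_two_aux:
  assumes t: "trio k A B D" "order G < 3 * k" and H: "subgroup H G" "2 * card H = order G"
    and q: "\<forall>b\<in>B. b \<in> H \<longleftrightarrow> q"
  obtains p where "\<forall>a\<in>A. a \<in> H \<longleftrightarrow> p"
proof -
  have sub: "A \<subseteq> carrier G" "B \<subseteq> carrier G" "card A = k" "card B = k"
    using t by (auto simp: trio_def)
  have "\<not> (a \<in> A \<and> a' \<in> A \<and> a \<in> H \<and> a' \<notin> H)" for a a'
  proof
    assume a: "a \<in> A \<and> a' \<in> A \<and> a \<in> H \<and> a' \<notin> H"
    then have ac: "a \<in> carrier G" "a' \<in> carrier G"
      using sub by auto
    have "(a <# B) \<inter> (a' <# B) = {}"
    proof (rule ccontr)
      assume "(a <# B) \<inter> (a' <# B) \<noteq> {}"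
      then obtain b b' where b: "b \<in> B" "b' \<in> B" "a \<otimes> b = a' \<otimes> b'"
        by (auto simp: mem_l_coset)
      then show False
        using index_two_mult[OF H, of a b] index_two_mult[OF H, of a' b'] a ac q sub
        by (metis subsetD)
    qed
    moreover have "(a <# B) \<union> (a' <# B) \<subseteq> A <#> B"
      using a unfolding set_mult_def l_coset_def by blast
    moreover have "finite (A <#> B)"
      using sub by (intro finite_subset_carrier set_mult_closed)
    ultimately have "card (a <# B) + card (a' <# B) \<le> card (A <#> B)"
      by (metis card_Un_disjoint card_mono finite_Un finite_subset)
    then show False
      using trio_card_set_mult[OF t(1)] t(2) sub ac by simp
  qed
  then have "\<exists>p. \<forall>a\<in>A. a \<in> H \<longleftrightarrow> p"
    by blast
  then show thesis
    using that by blast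
qed

text \<open>The previous lemma, applied along the rotations of the trio, puts all three sets into
  single cosets. If the parities multiplied the wrong way, a B and the inverse of \<open>D\<close>
  would be disjoint k-subsets of one coset, giving 2k \<le> n/2 in spite of n < 3k.\<close>

lemma trio_index_two:
  assumes t: "trio k A B D" "order G < 3 * k" and H: "subgroup H G" "2 * card H = order G"
    and q: "\<forall>b\<in>B. b \<in> H \<longleftrightarrow> q"
  obtains p where "\<forall>a\<in>A. a \<in> H \<longleftrightarrow> p" "\<forall>d\<in>D. d \<in> H \<longleftrightarrow> (p \<longleftrightarrow> \<not> q)"
proof -
  obtain p where p: "\<forall>a\<in>A. a \<in> H \<longleftrightarrow> p"
    using trio_index_two_aux[OF t H q] by blast
  obtain r where r: "\<forall>d\<in>D. d \<in> H \<longleftrightarrow> r"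
    using trio_index_two_aux[OF trio_rotate[OF trio_rotate[OF t(1)]] t(2) H p] by blast
  have sub: "A \<subseteq> carrier G" "B \<subseteq> carrier G" "D \<subseteq> carrier G" "card A = k" "card B = k" "card D = k"
    using t by (auto simp: trio_def)
  have k: "0 < k"
    using t(2) by simp
  then obtain a where a: "a \<in> A" "a \<in> carrier G"
    using sub by (metis card.empty ex_in_conv less_numeral_extra(3) subsetD)
  interpret H: subgroup H G by fact
  have "r \<longleftrightarrow> (p \<longleftrightarrow> \<not> q)"
  proof (rule ccontr)
    assume n: "\<not> ?thesis"
    define K where "K = {x \<in> carrier G. x \<in> H \<longleftrightarrow> r}"
    have card_K: "2 * card K = order G"
    proof (cases r)
      case True
      then have "K = H"
        unfolding K_def using H.subset by auto
      then show ?thesis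
        using H by simp
    next
      case False
      then have "K = carrier G - H"
        unfolding K_def by auto
      then show ?thesis
        using H card_Diff_subset[of H "carrier G"] H.subset
        by (simp add: finite_subset_carrier order_def)
    qed
    have inv_mem: "inv d \<in> H \<longleftrightarrow> d \<in> H" if "d \<in> carrier G" for d
      using that by (metis H.m_inv_closed inv_inv)
    have "a <# B \<subseteq> K"
      using index_two_mult[OF H a(2)] a p q n sub unfolding K_def
      by (auto simp: mem_l_coset subset_iff)
    moreover have "set_inv D \<subseteq> K"
      using inv_mem r sub unfolding K_def by (auto simp: mem_set_inv subset_iff)
    moreover have "(a <# B) \<inter> set_inv D = {}"
      using t(1) a sub unfolding trio_def by (fastforce simp: mem_l_coset mem_set_inv)
    moreover have "finite K"
      by (rule finite_subset_carrier) (auto simp: K_def)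
    ultimately have "card (a <# B) + card (set_inv D) \<le> card K"
      by (metis Un_least card_Un_disjoint card_mono finite_subset)
    then show False
      using card_K t(2) a sub by simp
  qed
  then show thesis
    using that p r by blast
qed

text \<open>Here \<open>m\<close> counts the cosets of the atom \<open>H\<close> that make up H B',
  so the growth of \<open>H\<close> is (m - 1)|H| and the bound n - 2k becomes the displayed
  inequality. For m = 1 the set B' lies inside \<open>H\<close>, and then 3|H| \<ge> 3k > n leaves
  index two as the only possibility.\<close>

theorem trio_dichotomy:
  assumes t: "trio k A B D" "order G < 3 * k" and b: "b \<in> B"
  obtains (index_two) H p q where "subgroup H G" "2 * card H = order G"
      "\<forall>a\<in>A. a \<in> H \<longleftrightarrow> p" "\<forall>b\<in>B. b \<in> H \<longleftrightarrow> q" "\<forall>d\<in>D. d \<in> H \<longleftrightarrow> (p \<longleftrightarrow> \<not> q)"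
    | (atom) H B' m where "subgroup H G" "B' = B #> inv b \<or> B' = set_inv (B #> inv b)"
      "B' \<subseteq> H <#> B'" "card B' = k" "card (H <#> B') = m * card H" "2 \<le> m" "k \<le> m * card H"
      "m * card H + 2 * k \<le> order G + card H" "card H dvd order G" "m * card H < order G"
      "m * card H + 2 * k = order G + card H \<Longrightarrow> B' = B #> inv b \<Longrightarrow> A <#> H = A"
      "m * card H + 2 * k = order G + card H \<Longrightarrow> B' = set_inv (B #> inv b) \<Longrightarrow> H <#> (b <# D) = b <# D"
      "m * card H + 2 * k = order G + card H \<Longrightarrow> card (A <#> B) + k = order G"
proof -
  have k: "0 < k"
    using t(2) by simp
  have sub: "A \<subseteq> carrier G" "B \<subseteq> carrier G" "D \<subseteq> carrier G" "b \<in> carrier G"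
    using t b by (auto simp: trio_def)
  obtain H B' where H: "subgroup H G" "B' = B #> inv b \<or> B' = set_inv (B #> inv b)"
    "B' \<subseteq> carrier G" "\<one> \<in> B'" "card B' = k" "H <#> B' \<noteq> carrier G"
    "card (H <#> B') = card H + growth B' H" "growth B' H + 2 * k \<le> order G"
    "growth B' H + 2 * k = order G \<Longrightarrow> B' = B #> inv b \<Longrightarrow> A <#> H = A"
    "growth B' H + 2 * k = order G \<Longrightarrow> B' = set_inv (B #> inv b) \<Longrightarrow> H <#> (b <# D) = b <# D"
    "growth B' H + 2 * k = order G \<Longrightarrow> card (A <#> B) + k = order G"
    using trio_atom[OF t(1) k b] by blast
  interpret H: subgroup H G by fact
  have HB: "H <#> B' \<subseteq> carrier G"
    using H(3) H.subset by (simp add: set_mult_closed)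
  have "H <#> (H <#> B') = H <#> B'"
    using H(3) H.subset by (simp add: set_mult_assoc[symmetric] subgroup_mult_id[OF H(1)])
  then have "card H dvd card (H <#> B')"
    using card_dvd_left_invariant[OF H(1) HB] by simp
  then obtain m where m: "card (H <#> B') = m * card H"
    by (metis dvd_div_mult_self)
  have B'_le: "B' \<subseteq> H <#> B'"
    using H(3) by (force simp: mem_set_mult intro: bexI[of _ \<one>])
  have fin: "finite (H <#> B')" "finite H" "finite B'"
    using HB H(3) H.subset by (auto intro: finite_subset_carrier)
  have H_pos: "0 < card H"
    using fin H.one_closed card_gt_0_iff by blast
  have lt: "card (H <#> B') < order G"
    unfolding order_def using HB H(6) by (intro psubset_card_mono) auto
  show thesis
  proof (cases "m \<ge> 2")
    case True
    show thesis
    proof (rule atom[OF H(1,2) B'_le H(5) m True])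
      show "k \<le> m * card H"
        using B'_le fin m H(5) by (metis card_mono)
      show "card H dvd order G"
        by (rule card_subgroup_dvd) fact
      show "m * card H < order G"
        using lt m by simp
      show "m * card H + 2 * k \<le> order G + card H"
        using H(7,8) m by simp
    qed (use H(7,9,10,11) m in simp_all)
  next
    case False
    have "k \<le> m * card H"
      using B'_le fin m H(5) by (metis card_mono)
    then have "m \<noteq> 0"
      using k by (intro notI) simp
    then have "card (H <#> B') = card H"
      using False m by simp
    moreover have "H \<subseteq> H <#> B'"
      using H(4) by (force simp: mem_set_mult)
    ultimately have HBH: "H <#> B' = H"
      using fin by (metis card_subset_eq)
    then have "B' \<subseteq> H"
      using B'_le by simp
    then have k_le: "k \<le> card H"
      using H(5) fin by (metis card_mono)
    have B0: "B #> inv b \<subseteq> H"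
    proof (cases "B' = B #> inv b")
      case False
      then have "set_inv B' = B #> inv b"
        using H(2) sub by (simp add: r_coset_subset_G)
      moreover have "set_inv B' \<subseteq> H"
        using \<open>B' \<subseteq> H\<close> H.m_inv_closed unfolding SET_INV_def by blast
      ultimately show ?thesis
        by simp
    qed (use \<open>B' \<subseteq> H\<close> in simp)
    obtain j where j: "order G = j * card H"
      using card_subgroup_dvd[OF H(1)] by (metis dvd_div_mult_self)
    have "card H < order G"
      using lt HBH by simp
    then have "1 < j"
      using j by simp
    moreover have "j < 3"
    proof (rule ccontr)
      assume "\<not> j < 3"
      then have "3 * card H \<le> order G"
        using j by simp
      then show False
        using t(2) k_le by linarith
    qed
    ultimately have "j = 2"
      by linarith
    then have index: "2 * card H = order G"
      using j by simp
    have q: "\<forall>x\<in>B. x \<in> H \<longleftrightarrow> b \<in> H"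
    proof (intro ballI)
      fix x
      assume x: "x \<in> B"
      then have xc: "x \<in> carrier G"
        using sub by auto
      have "x \<otimes> inv b \<in> H"
        using B0 x unfolding r_coset_def by blast
      then have "x \<in> H \<longleftrightarrow> inv b \<in> H"
        using index_two_mult[OF H(1) index xc, of "inv b"] sub by simp
      then show "x \<in> H \<longleftrightarrow> b \<in> H"
        using sub by (metis H.m_inv_closed inv_inv)
    qed
    show thesis
      using trio_index_two[OF t H(1) index q] index_two[OF H(1) index _ q] by blast
  qed
qed

text \<open>In the atom branch |H| is at most half of m|H|, so k/2 \<le> (m - 1)|H| \<le> n - 2k,
  that is, 5k \<le> 2n.\<close>

lemma trio_index_two_large:
  assumes t: "trio k A B D" "2 * order G < 5 * k"
  obtains H p q where "subgroup H G" "2 * card H = order G"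
      "\<forall>a\<in>A. a \<in> H \<longleftrightarrow> p" "\<forall>b\<in>B. b \<in> H \<longleftrightarrow> q" "\<forall>d\<in>D. d \<in> H \<longleftrightarrow> (p \<longleftrightarrow> \<not> q)"
proof -
  have k: "0 < k" "order G < 3 * k"
    using t(2) by auto
  obtain b where b: "b \<in> B"
    using t(1) k(1) unfolding trio_def by fastforce
  show thesis
  proof (rule trio_dichotomy[OF t(1) k(2) b])
    fix H B' m
    assume a: "2 \<le> m" "k \<le> m * card H" "m * card H + 2 * k \<le> order G + card H"
    have "2 * card H \<le> m * card H"
      using a(1) by simp
    then show thesis
      using a(2,3) t(2) by linarith
  qed (use that in blast)
qed

end

section \<open>Maximal partial transversals of Cayley tables\<close>

text \<open>Such a permutation is a product of |A|/2 disjoint transpositions. The induction removes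
  one of them by composing with the transposition of x and p x.\<close>

lemma sign_fixpoint_free_involution:
  assumes "finite A" "p permutes A" "\<And>x. x \<in> A \<Longrightarrow> p x \<noteq> x" "\<And>x. p (p x) = x"
  shows "even (card A)" and "sign p = (-1) ^ (card A div 2)"
proof -
  have "even (card A) \<and> sign p = (-1) ^ (card A div 2)"
    using assms
  proof (induction "card A" arbitrary: A p rule: less_induct)
    case less
    show ?case
    proof (cases "A = {}")
      case True
      then have "p = id"
        using less.prems(2) by simp
      then show ?thesis
        using True by simp
    next
      case False
      then obtain x where x: "x \<in> A"
        by auto
      define y where "y = p x"
      have y: "y \<in> A" "y \<noteq> x" "p y = x" "p x = y"
        using less.prems x permutes_in_image[of p A x] by (auto simp: y_def)
      define q where "q = transpose x y \<circ> p"
      define C where "C = A - {x, y}"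
      have p_mem: "p z \<in> A \<longleftrightarrow> z \<in> A" for z
        using less.prems(2) by (rule permutes_in_image)
      have p_eq: "p z = x \<longleftrightarrow> z = y" "p z = y \<longleftrightarrow> z = x" for z
        using y less.prems(4) by metis+
      have q_eq: "q z = (if z = x \<or> z = y then z else p z)" for z
        using p_eq y by (auto simp: q_def transpose_def)
      have card: "card C + 2 = card A"
        using x y less.prems(1) card_Suc_Diff1[of A x] card_Suc_Diff1[of "A - {x}" y]
        by (simp add: C_def insert_commute Diff_insert2[symmetric])
      have q_perm: "q permutes C"
      proof (rule bij_imp_permutes)
        have "q z \<in> C" "q (q z) = z" if "z \<in> C" for z
          using that p_mem p_eq less.prems(4) by (auto simp: q_eq C_def)
        then show "bij_betw q C C"
          by (intro bij_betwI[where g = q]) auto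
        show "q z = z" if "z \<notin> C" for z
          using that less.prems(2) p_mem[of z] by (auto simp: q_eq C_def permutes_def)
      qed
      have "even (card C) \<and> sign q = (-1) ^ (card C div 2)"
      proof (rule less.hyps)
        show "q z \<noteq> z" if "z \<in> C" for z
          using that less.prems(3) by (auto simp: q_eq C_def)
        show "q (q z) = z" for z
          using less.prems(4) p_eq by (auto simp: q_eq)
      qed (use card less.prems(1) q_perm in \<open>auto simp: C_def\<close>)
      moreover have "p = transpose x y \<circ> q"
        by (auto simp: q_def fun_eq_iff)
      then have "sign p = sign (transpose x y) * sign q"
        using less.prems(1) q_perm by (metis C_def finite_Diff permutation_permutes permutation_swap_id sign_compose)
      ultimately show ?thesis
        using y(2) by (auto simp: sign_swap_id card[symmetric])
    qed
  qed
  then show "even (card A)" and "sign p = (-1) ^ (card A div 2)"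
    by auto
qed

context finite_group
begin

text \<open>Maximality is left out on purpose: the counting identities hold for every partial
  transversal, and maximality is expressed separately by \<open>trio\<close>.\<close>

definition transversal_gap :: "'a set \<Rightarrow> 'a set \<Rightarrow> 'a set \<Rightarrow> bool" where
  "transversal_gap R C S \<longleftrightarrow> (\<exists>T. partial_transversal (cayley_table G) T \<and>
     R = carrier G - (\<lambda>(r, c, s). r) ` T \<and> C = carrier G - (\<lambda>(r, c, s). c) ` T \<and>
     S = carrier G - (\<lambda>(r, c, s). s) ` T)"

lemma cayley_table_subset: "cayley_table G \<subseteq> carrier G \<times> carrier G \<times> carrier G"
  by (auto simp: cayley_table_def)

text \<open>A cell in a free row and a free column whose symbol is free as well could be added to
  the transversal. Maximality therefore says that products of free rows and free columns are never
  free symbols.\<close>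

lemma has_maximal_of_lengthE:
  assumes "has_maximal_of_length (cayley_table G) l"
  obtains R C S where "transversal_gap R C S" "l \<le> order G" "trio (order G - l) R C (set_inv S)"
    "R \<subseteq> carrier G" "C \<subseteq> carrier G" "S \<subseteq> carrier G" "card S = order G - l"
proof -
  obtain T where T: "partial_transversal (cayley_table G) T" "card T = l"
    and max: "\<nexists>T'. partial_transversal (cayley_table G) T' \<and> T \<subseteq> T' \<and> card T < card T'"
    using assms by (auto simp: has_maximal_of_length_def maximal_partial_transversal_def)
  have sub: "T \<subseteq> cayley_table G" "T \<subseteq> carrier G \<times> carrier G \<times> carrier G"
    and inj: "inj_on (\<lambda>(r, c, s). r) T" "inj_on (\<lambda>(r, c, s). c) T" "inj_on (\<lambda>(r, c, s). s) T"
    using T cayley_table_subset by (auto simp: partial_transversal_def)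
  have fin: "finite T"
    using sub(2) by (rule finite_subset) simp
  have im: "(\<lambda>(r, c, s). r) ` T \<subseteq> carrier G" "(\<lambda>(r, c, s). c) ` T \<subseteq> carrier G"
    "(\<lambda>(r, c, s). s) ` T \<subseteq> carrier G"
    using sub(2) by auto
  define R where "R = carrier G - (\<lambda>(r, c, s). r) ` T"
  define C where "C = carrier G - (\<lambda>(r, c, s). c) ` T"
  define S where "S = carrier G - (\<lambda>(r, c, s). s) ` T"
  have card: "card R = order G - l" "card C = order G - l" "card S = order G - l"
    using inj im fin T(2) unfolding R_def C_def S_def order_def
    by (simp_all add: card_Diff_subset card_image)
  have "l \<le> order G"
    using card_mono[OF finite_carrier im(1)] card_image[OF inj(1)] T(2) by (simp add: order_def)
  moreover have "transversal_gap R C S"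
    unfolding transversal_gap_def R_def C_def S_def using T by blast
  moreover have "r \<otimes> c \<notin> S" if rc: "r \<in> R" "c \<in> C" for r c
  proof
    assume s: "r \<otimes> c \<in> S"
    define T' where "T' = insert (r, c, r \<otimes> c) T"
    have new: "r \<notin> (\<lambda>(r, c, s). r) ` T" "c \<notin> (\<lambda>(r, c, s). c) ` T" "r \<otimes> c \<notin> (\<lambda>(r, c, s). s) ` T"
      using rc s by (simp_all add: R_def C_def S_def)
    then have notin: "(r, c, r \<otimes> c) \<notin> T"
      by force
    have "partial_transversal (cayley_table G) T'"
      unfolding partial_transversal_def T'_def
    proof (intro conjI)
      show "insert (r, c, r \<otimes> c) T \<subseteq> cayley_table G"
        using sub(1) rc by (auto simp: cayley_table_def R_def C_def)
      show "inj_on (\<lambda>(r, c, s). r) (insert (r, c, r \<otimes> c) T)"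
        "inj_on (\<lambda>(r, c, s). c) (insert (r, c, r \<otimes> c) T)"
        "inj_on (\<lambda>(r, c, s). s) (insert (r, c, r \<otimes> c) T)"
        using inj new notin by (simp_all only: inj_on_insert) auto
    qed
    moreover have "card T < card T'"
      using fin notin by (simp add: T'_def)
    ultimately show False
      using max by (auto simp: T'_def)
  qed
  then have "trio (order G - l) R C (set_inv S)"
    unfolding trio_def
  proof (intro conjI ballI)
    fix r c d
    assume d: "r \<in> R" "c \<in> C" "d \<in> set_inv S"
    then obtain s where s: "s \<in> S" "d = inv s"
      by (auto simp: mem_set_inv)
    then have "r \<otimes> c \<noteq> s" "r \<in> carrier G" "c \<in> carrier G" "s \<in> carrier G"
      using d \<open>\<And>r c. r \<in> R \<Longrightarrow> c \<in> C \<Longrightarrow> r \<otimes> c \<notin> S\<close> by (auto simp: R_def C_def S_def)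
    then show "r \<otimes> c \<otimes> d \<noteq> \<one>"
      using s(2) by (metis inv_closed inv_equality inv_inv m_closed)
  qed (use card set_inv_subset[of S] card_set_inv[of S] in \<open>auto simp: R_def C_def S_def\<close>)
  ultimately show thesis
    using that[of R C S] card(3) by (auto simp: R_def C_def S_def)
qed

lemma transversal_gap_full:
  assumes "has_maximal_of_length (cayley_table G) (order G)"
  shows "transversal_gap {} {} {}"
proof -
  obtain R C S where *: "transversal_gap R C S" "trio (order G - order G) R C (set_inv S)"
    "R \<subseteq> carrier G" "C \<subseteq> carrier G" "S \<subseteq> carrier G" "card S = order G - order G"
    using has_maximal_of_lengthE[OF assms] by metis
  then have "card R = 0" "card C = 0" "card S = 0"
    by (simp_all add: trio_def)
  then have "R = {}" "C = {}" "S = {}"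
    using *(3-5) finite_subset_carrier by auto
  then show ?thesis
    using *(1) by simp
qed

text \<open>Every triple of the transversal satisfies f s - f r - f c \<equiv> 0. Each coordinate
  runs over all of G except its gap, so summing over the triples leaves one total of f together with
  the three gap sums.\<close>

lemma transversal_gap_sum:
  fixes f :: "'a \<Rightarrow> int"
  assumes gap: "transversal_gap R C S"
    and hom: "\<And>x y. x \<in> carrier G \<Longrightarrow> y \<in> carrier G \<Longrightarrow> m dvd f (x \<otimes> y) - f x - f y"
  shows "m dvd sum f (carrier G) + sum f S - sum f R - sum f C"
proof -
  obtain T where T: "partial_transversal (cayley_table G) T"
    and R: "R = carrier G - (\<lambda>(r, c, s). r) ` T" and C: "C = carrier G - (\<lambda>(r, c, s). c) ` T"
    and S: "S = carrier G - (\<lambda>(r, c, s). s) ` T"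
    using gap by (auto simp: transversal_gap_def)
  have sub: "T \<subseteq> cayley_table G"
    and inj: "inj_on (\<lambda>(r, c, s). r) T" "inj_on (\<lambda>(r, c, s). c) T" "inj_on (\<lambda>(r, c, s). s) T"
    using T by (auto simp: partial_transversal_def)
  have sum_gap: "sum f (carrier G) - sum f (carrier G - g ` T) = (\<Sum>t\<in>T. f (g t))"
    if "inj_on g T" "g ` T \<subseteq> carrier G" for g
  proof -
    have "sum f (carrier G) = sum f (carrier G - g ` T) + sum f (g ` T)"
      using that(2) by (intro sum.subset_diff) auto
    then show ?thesis
      using sum.reindex[OF that(1), of f] by simp
  qed
  have im: "(\<lambda>(r, c, s). r) ` T \<subseteq> carrier G" "(\<lambda>(r, c, s). c) ` T \<subseteq> carrier G"
    "(\<lambda>(r, c, s). s) ` T \<subseteq> carrier G"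
    using sub cayley_table_subset by auto
  have "m dvd (\<Sum>t\<in>T. f (case t of (r, c, s) \<Rightarrow> s) - f (case t of (r, c, s) \<Rightarrow> r)
      - f (case t of (r, c, s) \<Rightarrow> c))"
    using sub hom by (intro dvd_sum) (auto simp: cayley_table_def)
  then have "m dvd (sum f (carrier G) - sum f S) - (sum f (carrier G) - sum f R)
      - (sum f (carrier G) - sum f C)"
    unfolding R C S sum_gap[OF inj(1) im(1)] sum_gap[OF inj(2) im(2)] sum_gap[OF inj(3) im(3)]
    by (simp add: sum_subtractf case_prod_unfold)
  then have "m dvd - ((sum f (carrier G) - sum f S) - (sum f (carrier G) - sum f R)
      - (sum f (carrier G) - sum f C))"
    by (simp only: dvd_minus_iff)
  then show ?thesis
    by (simp add: algebra_simps)
qed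

text \<open>The character is the parity modulo \<open>H\<close>. Its total is |H|, and in each of
  the four coset patterns allowed for \<open>R\<close>, \<open>C\<close> and \<open>S\<close> the
  gap sums contribute k modulo 2.\<close>

lemma index_two_parity:
  assumes gap: "transversal_gap R C S" and t: "trio k R C (set_inv S)" and S: "S \<subseteq> carrier G"
    and H: "subgroup H G" "2 * card H = order G"
    and p: "\<forall>a\<in>R. a \<in> H \<longleftrightarrow> p" and q: "\<forall>b\<in>C. b \<in> H \<longleftrightarrow> q"
    and r: "\<forall>d\<in>set_inv S. d \<in> H \<longleftrightarrow> (p \<longleftrightarrow> \<not> q)"
  shows "even (card H + k)"
proof -
  interpret H: subgroup H G by fact
  define f :: "'a \<Rightarrow> int" where "f x = (if x \<in> H then 0 else 1)" for x
  have card: "card R = k" "card C = k" "card S = k"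
    using t S by (auto simp: trio_def)
  have "2 dvd sum f (carrier G) + sum f S - sum f R - sum f C"
    by (rule transversal_gap_sum[OF gap]) (auto simp: f_def index_two_mult[OF H])
  moreover have "sum f (carrier G) = int (card H)"
  proof -
    have "sum f (carrier G) = (\<Sum>x\<in>carrier G - H. 1)"
      by (intro sum.mono_neutral_cong_right) (auto simp: f_def)
    also have "\<dots> = int (card (carrier G - H))"
      by simp
    also have "card (carrier G - H) = card H"
      using H(2) H.subset by (simp add: card_Diff_subset finite_subset_carrier order_def)
    finally show ?thesis .
  qed
  moreover have "sum f R = (if p then 0 else int k)" "sum f C = (if q then 0 else int k)"
    using p q card by (simp_all add: f_def)
  moreover have "sum f S = (if p = q then int k else 0)"
  proof -
    have "f s = (if p = q then 1 else 0)" if s: "s \<in> S" for s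
    proof -
      have sc: "s \<in> carrier G"
        using s S by auto
      have "inv s \<in> set_inv S"
        using s by (auto simp: mem_set_inv)
      moreover have "inv s \<in> H \<longleftrightarrow> s \<in> H"
        using sc by (metis H.m_inv_closed inv_inv)
      ultimately show ?thesis
        using r by (auto simp: f_def)
    qed
    then show ?thesis
      using card by simp
  qed
  ultimately have "even (int (card H + k))"
    by (auto split: if_splits)
  then show ?thesis
    by simp
qed

text \<open>Above the threshold a subgroup of index two must exist, which is impossible for odd
  order; otherwise the parity count requires n/2 + k to be even.\<close>

lemma missing_of_large_gap:
  assumes k: "2 * order G < 5 * k" "k \<le> order G" and odd: "odd (order G) \<or> odd (order G div 2 + k)"
  shows "\<not> has_maximal_of_length (cayley_table G) (order G - k)"
proof
  assume "has_maximal_of_length (cayley_table G) (order G - k)"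
  then obtain R C S where *: "transversal_gap R C S" "trio k R C (set_inv S)" "S \<subseteq> carrier G"
    using k(2) by (elim has_maximal_of_lengthE) simp
  obtain H p q where H: "subgroup H G" "2 * card H = order G"
    "\<forall>a\<in>R. a \<in> H \<longleftrightarrow> p" "\<forall>b\<in>C. b \<in> H \<longleftrightarrow> q" "\<forall>d\<in>set_inv S. d \<in> H \<longleftrightarrow> (p \<longleftrightarrow> \<not> q)"
    using trio_index_two_large[OF *(2) k(1)] by blast
  have "even (card H + k)"
    using index_two_parity[OF * H] .
  moreover have "order G div 2 = card H" "even (order G)"
    using H(2) by (simp_all flip: H(2))
  ultimately show False
    using odd by auto
qed

end

lemma (in finite_group) subgroup_finite_group:
  assumes "subgroup H G"
  shows "finite_group (G\<lparr>carrier := H\<rparr>)"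
  using assms subgroup.subgroup_is_group[OF assms is_group] finite_subset_carrier[OF subgroup.subset[OF assms]]
  by (simp add: finite_group_def finite_group_axioms_def)

context finite_group
begin

text \<open>For \<open>k = order G div 2\<close> the transversal lives on a single coset rectangle, that is, on a
  translate of the Cayley table of \<open>H\<close>.\<close>

lemma half_gap_transversal:
  assumes gap: "transversal_gap R C S" and t: "trio k R C (set_inv S)" and S: "S \<subseteq> carrier G"
    and H: "subgroup H G" "2 * card H = order G" and k: "k = card H"
    and p: "\<forall>a\<in>R. a \<in> H \<longleftrightarrow> p" and q: "\<forall>b\<in>C. b \<in> H \<longleftrightarrow> q"
    and r: "\<forall>d\<in>set_inv S. d \<in> H \<longleftrightarrow> (p \<longleftrightarrow> \<not> q)"
  shows "finite_group.transversal_gap (G\<lparr>carrier := H\<rparr>) {} {} {}"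
proof -
  interpret H: subgroup H G by fact
  interpret GH: finite_group "G\<lparr>carrier := H\<rparr>"
    by (rule subgroup_finite_group) fact
  obtain T where T: "partial_transversal (cayley_table G) T"
    and R: "R = carrier G - (\<lambda>(r, c, s). r) ` T" and C: "C = carrier G - (\<lambda>(r, c, s). c) ` T"
    and SS: "S = carrier G - (\<lambda>(r, c, s). s) ` T"
    using gap by (auto simp: transversal_gap_def)
  have sub: "T \<subseteq> cayley_table G" "T \<subseteq> carrier G \<times> carrier G \<times> carrier G"
    and inj: "inj_on (\<lambda>(r, c, s). r) T" "inj_on (\<lambda>(r, c, s). c) T" "inj_on (\<lambda>(r, c, s). s) T"
    using T cayley_table_subset by (auto simp: partial_transversal_def)
  have card: "card R = card H" "card C = card H" "R \<subseteq> carrier G" "C \<subseteq> carrier G"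
    using t k by (auto simp: trio_def)
  have card_par: "card {x \<in> carrier G. x \<in> H \<longleftrightarrow> b} = card H" for b
  proof (cases b)
    case True
    then have "{x \<in> carrier G. x \<in> H \<longleftrightarrow> b} = H"
      using H.subset by auto
    then show ?thesis
      by simp
  next
    case False
    then have "{x \<in> carrier G. x \<in> H \<longleftrightarrow> b} = carrier G - H"
      by auto
    then show ?thesis
      using H(2) H.subset by (simp add: card_Diff_subset finite_subset_carrier order_def)
  qed
  \<comment> \<open>The free rows are as many as the elements of their coset, so they fill it. The
    transversal then occupies exactly the opposite coset; the same happens for the columns.\<close>
  have R_eq: "R = {x \<in> carrier G. x \<in> H \<longleftrightarrow> p}"
    by (rule card_subset_eq) (use p card card_par[of p] in auto)
  have C_eq: "C = {x \<in> carrier G. x \<in> H \<longleftrightarrow> q}"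
    by (rule card_subset_eq) (use q card card_par[of q] in auto)
  have rows: "(\<lambda>(r, c, s). r) ` T = {x \<in> carrier G. x \<in> H \<longleftrightarrow> \<not> p}"
    using R R_eq sub(2) by auto
  have cols: "(\<lambda>(r, c, s). c) ` T = {x \<in> carrier G. x \<in> H \<longleftrightarrow> \<not> q}"
    using C C_eq sub(2) by auto
  have ne: "{x \<in> carrier G. x \<in> H \<longleftrightarrow> b} \<noteq> {}" for b
    using card_par[of b] H.one_closed finite_subset_carrier[OF H.subset]
    by (metis card.empty card_0_eq empty_iff)
  obtain x y where x: "x \<in> carrier G" "x \<in> H \<longleftrightarrow> \<not> p" and y: "y \<in> carrier G" "y \<in> H \<longleftrightarrow> \<not> q"
    using ne[of "\<not> p"] ne[of "\<not> q"] by auto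
  \<comment> \<open>The representatives x and y lie in the cosets of occupied rows and columns.
    Since x^-1 (r c) y^-1 = (x^-1 r)(c y^-1), triples of the table of G go to triples of the table
    of \<open>H\<close>.\<close>
  define \<phi> where "\<phi> = (\<lambda>(r, c, s). (inv x \<otimes> r, c \<otimes> inv y, inv x \<otimes> s \<otimes> inv y))"
  have inv_mem: "inv z \<in> H \<longleftrightarrow> z \<in> H" if "z \<in> carrier G" for z
    using that by (metis H.m_inv_closed inv_inv)
  have cells: "inv x \<otimes> r \<in> H \<and> c \<otimes> inv y \<in> H \<and> r \<in> carrier G \<and> c \<in> carrier G \<and> s = r \<otimes> c"
    if t: "(r, c, s) \<in> T" for r c s
  proof -
    have rc: "r \<in> carrier G" "c \<in> carrier G" "s = r \<otimes> c"
      using t sub by (auto simp: cayley_table_def)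
    have "r \<in> (\<lambda>(r, c, s). r) ` T" "c \<in> (\<lambda>(r, c, s). c) ` T"
      using t by force+
    then have "r \<in> H \<longleftrightarrow> \<not> p" "c \<in> H \<longleftrightarrow> \<not> q"
      unfolding rows cols by auto
    then show ?thesis
      using rc index_two_mult[OF H, of "inv x" r] index_two_mult[OF H, of c "inv y"] x y inv_mem
      by simp
  qed
  have \<phi>_cell: "\<phi> t \<in> cayley_table (G\<lparr>carrier := H\<rparr>)" if "t \<in> T" for t
  proof -
    obtain r c s where t: "t = (r, c, s)"
      by (cases t)
    then have *: "inv x \<otimes> r \<in> H" "c \<otimes> inv y \<in> H" "r \<in> carrier G" "c \<in> carrier G" "s = r \<otimes> c"
      using cells that by blast+
    then have "inv x \<otimes> s \<otimes> inv y = (inv x \<otimes> r) \<otimes> (c \<otimes> inv y)"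
      using x y by (simp add: m_assoc)
    then show ?thesis
      using * by (simp add: \<phi>_def t cayley_table_def)
  qed
  have 1: "t = t'" if "t \<in> T" "t' \<in> T" "fst (\<phi> t) = fst (\<phi> t')" for t t'
  proof -
    have "fst t = fst t'"
      using that x cells[of "fst t" "fst (snd t)" "snd (snd t)"] cells[of "fst t'" "fst (snd t')" "snd (snd t')"]
      by (auto simp: \<phi>_def split: prod.splits)
    then show ?thesis
      using that inj(1) unfolding inj_on_def case_prod_unfold by blast
  qed
  have 2: "t = t'" if "t \<in> T" "t' \<in> T" "fst (snd (\<phi> t)) = fst (snd (\<phi> t'))" for t t'
  proof -
    have "fst (snd t) = fst (snd t')"
      using that y cells[of "fst t" "fst (snd t)" "snd (snd t)"] cells[of "fst t'" "fst (snd t')" "snd (snd t')"]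
      by (auto simp: \<phi>_def split: prod.splits)
    then show ?thesis
      using that inj(2) unfolding inj_on_def case_prod_unfold by blast
  qed
  have 3: "t = t'" if "t \<in> T" "t' \<in> T" "snd (snd (\<phi> t)) = snd (snd (\<phi> t'))" for t t'
  proof -
    have "snd (snd t) = snd (snd t')"
      using that x y cells[of "fst t" "fst (snd t)" "snd (snd t)"] cells[of "fst t'" "fst (snd t')" "snd (snd t')"]
      by (auto simp: \<phi>_def split: prod.splits)
    then show ?thesis
      using that inj(3) unfolding inj_on_def case_prod_unfold by blast
  qed
  have inj': "inj_on (\<lambda>(r, c, s). r) (\<phi> ` T)" "inj_on (\<lambda>(r, c, s). c) (\<phi> ` T)" "inj_on (\<lambda>(r, c, s). s) (\<phi> ` T)"
    unfolding inj_on_def case_prod_unfold using 1 2 3 by blast+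
  have "inj_on \<phi> T"
    by (rule inj_onI) (use 1 in simp)
  moreover have "card T = card H"
    using card_image[OF inj(1)] rows card_par[of "\<not> p"] by simp
  ultimately have cardT: "card (\<phi> ` T) = card H"
    by (simp add: card_image)
  have pt: "partial_transversal (cayley_table (G\<lparr>carrier := H\<rparr>)) (\<phi> ` T)"
    unfolding partial_transversal_def using \<phi>_cell inj' by auto
  have "(\<phi> ` T) \<subseteq> H \<times> H \<times> H"
    using pt GH.cayley_table_subset by (auto simp: partial_transversal_def)
  then have im: "(\<lambda>(r, c, s). r) ` \<phi> ` T \<subseteq> H" "(\<lambda>(r, c, s). c) ` \<phi> ` T \<subseteq> H" "(\<lambda>(r, c, s). s) ` \<phi> ` T \<subseteq> H"
    by auto
  have finH: "finite H"
    by (rule finite_subset_carrier) (rule H.subset)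
  have "(\<lambda>(r, c, s). r) ` \<phi> ` T = H" "(\<lambda>(r, c, s). c) ` \<phi> ` T = H" "(\<lambda>(r, c, s). s) ` \<phi> ` T = H"
    using card_subset_eq[OF finH im(1)] card_subset_eq[OF finH im(2)] card_subset_eq[OF finH im(3)]
      card_image[OF inj'(1)] card_image[OF inj'(2)] card_image[OF inj'(3)] cardT by simp_all
  then show ?thesis
    unfolding GH.transversal_gap_def using pt by (intro exI[of _ "\<phi> ` T"]) simp
qed

text \<open>The gap n/2 always exceeds 2n/5, so a maximal partial transversal of length n/2 would be
  a translate of a full transversal of some subgroup of index two.\<close>

lemma half_missing:
  assumes even: "even (order G)"
    and H: "\<And>H. subgroup H G \<Longrightarrow> 2 * card H = order G \<Longrightarrow> \<not> finite_group.transversal_gap (G\<lparr>carrier := H\<rparr>) {} {} {}"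
  shows "\<not> has_maximal_of_length (cayley_table G) (order G div 2)"
proof
  assume "has_maximal_of_length (cayley_table G) (order G div 2)"
  moreover have "order G - order G div 2 = order G div 2"
    using even by auto
  ultimately obtain R C S where *: "transversal_gap R C S" "trio (order G div 2) R C (set_inv S)" "S \<subseteq> carrier G"
    by (elim has_maximal_of_lengthE) simp
  have "0 < order G"
    by (simp add: order_gt_0_iff_finite)
  then have "2 * order G < 5 * (order G div 2)"
    using even by auto
  then obtain H p q where H': "subgroup H G" "2 * card H = order G"
    "\<forall>a\<in>R. a \<in> H \<longleftrightarrow> p" "\<forall>b\<in>C. b \<in> H \<longleftrightarrow> q" "\<forall>d\<in>set_inv S. d \<in> H \<longleftrightarrow> (p \<longleftrightarrow> \<not> q)"
    using trio_index_two_large[OF *(2)] by blast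
  moreover have "order G div 2 = card H"
    using H'(2) by (simp flip: H'(2))
  ultimately show False
    using half_gap_transversal[OF * H'(1,2) _ H'(3-5)] H by blast
qed

section \<open>Involutions and the sign character\<close>

lemma exists_prime_order:
  assumes "Factorial_Ring.prime (p :: nat)" "p dvd order G"
  obtains a where "a \<in> carrier G" "ord a = p"
proof -
  \<comment> \<open>Sylow's theorem is applied to the first power of p only; the cofactor may still
    be divisible by p.\<close>
  obtain m where "order G = p ^ 1 * m"
    using assms(2) by (auto elim: dvdE)
  then obtain H where H: "subgroup H G" "card H = p"
    using sylow_thm[OF assms(1) is_group, of 1 m] by auto
  interpret H: subgroup H G by fact
  have "1 < card H"
    using assms(1) H(2) prime_gt_1_nat by simp
  then have "\<not> H \<subseteq> {\<one>}"
    using card_mono[of "{\<one>}" H] by auto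
  then obtain a where a: "a \<in> H" "a \<noteq> \<one>"
    by blast
  have incl: "generate G {a} \<subseteq> H"
    using a(1) by (intro generate_subgroup_incl H(1)) auto
  have "subgroup (generate G {a}) (G\<lparr>carrier := H\<rparr>)"
    using a(1) H(1) H.mem_carrier incl by (intro subgroup_incl generate_is_subgroup) auto
  then have "card (generate G {a}) dvd card H"
    using finite_group.card_subgroup_dvd[OF subgroup_finite_group[OF H(1)]] by (simp add: order_def)
  then have "ord a dvd p"
    using a H(2) generate_pow_card[of a] H.mem_carrier by simp
  moreover have "ord a \<noteq> 1"
    using a H.mem_carrier ord_eq_1 by blast
  ultimately have "ord a = p"
    using assms(1) by (metis prime_nat_iff)
  then show thesis
    using that a H.mem_carrier by blast
qed

text \<open>The character is the sign of left translation. A non-trivial involution moves every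
  element, so its translation is a product of n/2 transpositions, an odd number when n \<equiv> 2
  modulo 4.\<close>

lemma parity_character:
  assumes "order G mod 4 = 2"
  obtains f :: "'a \<Rightarrow> int" where
    "\<And>x y. x \<in> carrier G \<Longrightarrow> y \<in> carrier G \<Longrightarrow> 2 dvd f (x \<otimes> y) - f x - f y"
    "\<And>h. h \<in> carrier G \<Longrightarrow> h \<noteq> \<one> \<Longrightarrow> h \<otimes> h = \<one> \<Longrightarrow> odd (f h)"
proof -
  define L where "L g = (\<lambda>x. if x \<in> carrier G then g \<otimes> x else x)" for g
  have perm: "L g permutes carrier G" if g: "g \<in> carrier G" for g
  proof (rule bij_imp_permutes)
    show "bij_betw (L g) (carrier G) (carrier G)"
      using g by (intro bij_betwI[where g = "L (inv g)"]) (auto simp: L_def m_assoc[symmetric])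
  qed (simp add: L_def)
  have comp: "L (g \<otimes> h) = L g \<circ> L h" if "g \<in> carrier G" "h \<in> carrier G" for g h
    using that by (auto simp: L_def fun_eq_iff m_assoc)
  have sign: "sign (L (g \<otimes> h)) = sign (L g) * sign (L h)" if "g \<in> carrier G" "h \<in> carrier G" for g h
    unfolding comp[OF that] using perm that finite_carrier permutation_permutes sign_compose by blast
  define f where "f g = (if sign (L g) = 1 then 0 else 1 :: int)" for g
  show thesis
  proof (rule that[of f])
    fix x y
    assume "x \<in> carrier G" "y \<in> carrier G"
    then have "sign (L (x \<otimes> y)) = sign (L x) * sign (L y)"
      by (rule sign)
    then show "2 dvd f (x \<otimes> y) - f x - f y"
      by (cases "L x" rule: sign_cases; cases "L y" rule: sign_cases) (simp_all add: f_def)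
  next
    fix h
    assume h: "h \<in> carrier G" "h \<noteq> \<one>" "h \<otimes> h = \<one>"
    have "sign (L h) = (-1) ^ (card (carrier G) div 2)"
    proof (rule sign_fixpoint_free_involution(2))
      show "L h x \<noteq> x" if "x \<in> carrier G" for x
        using that h by (simp add: L_def)
      show "L h (L h x) = x" for x
        using h by (auto simp: L_def m_assoc[symmetric])
    qed (use perm h in auto)
    moreover have "odd (card (carrier G) div 2)"
      using assms by (simp add: order_def) presburger
    ultimately show "odd (f h)"
      by (simp add: f_def)
  qed
qed

text \<open>Multiplication by h pairs the elements of \<open>U\<close> with opposite parities, so
  exactly half of \<open>U\<close> is odd. Both sides are allowed because the isoperimetric argument
  does not determine on which side the invariance occurs.\<close>

lemma involution_sum:
  fixes f :: "'a \<Rightarrow> int"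
  assumes U: "finite U" "U \<subseteq> carrier G" and h: "h \<in> carrier G" "h \<noteq> \<one>" "h \<otimes> h = \<one>" "odd (f h)"
    and hom: "\<And>x y. x \<in> carrier G \<Longrightarrow> y \<in> carrier G \<Longrightarrow> 2 dvd f (x \<otimes> y) - f x - f y"
    and inv: "(\<forall>u\<in>U. h \<otimes> u \<in> U) \<or> (\<forall>u\<in>U. u \<otimes> h \<in> U)"
  shows "even (card U)" "even (sum f U) \<longleftrightarrow> even (card U div 2)"
proof -
  define g where "g u = (if \<forall>u\<in>U. h \<otimes> u \<in> U then h \<otimes> u else u \<otimes> h)" for u
  have g: "g u \<in> U" "g (g u) = u" "odd (f (g u)) \<longleftrightarrow> even (f u)" if "u \<in> U" for u
  proof -
    have u: "u \<in> carrier G"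
      using that U by auto
    show "g u \<in> U"
      using that inv by (auto simp: g_def)
    show "g (g u) = u"
      using u h by (auto simp: g_def m_assoc[symmetric]) (simp add: m_assoc)
    show "odd (f (g u)) \<longleftrightarrow> even (f u)"
      using hom[OF h(1) u] hom[OF u h(1)] h(4) by (auto simp: g_def)
  qed
  define E where "E = {u \<in> U. even (f u)}"
  define D where "D = {u \<in> U. odd (f u)}"
  have "bij_betw g E D"
    by (rule bij_betwI[where g = g]) (use g in \<open>auto simp: E_def D_def\<close>)
  then have "card E = card D"
    by (rule bij_betw_same_card)
  moreover have "card U = card E + card D"
    using U(1) by (subst card_Un_disjoint[symmetric]) (auto simp: E_def D_def intro: arg_cong[of _ _ card])
  ultimately have 1: "card U = 2 * card D"
    by simp
  then show "even (card U)"
    by simp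
  have "even (sum f U) \<longleftrightarrow> even (card D)"
    using U(1) by (simp add: even_sum_iff D_def)
  then show "even (sum f U) \<longleftrightarrow> even (card U div 2)"
    using 1 by simp
qed

text \<open>Empty gaps mean a transversal of full length, which would make the total of the sign
  character even. By the pairing under an involution that total has the parity of n/2, which is
  odd.\<close>

lemma no_full_gap_singly_even:
  assumes "order G mod 4 = 2"
  shows "\<not> transversal_gap {} {} {}"
proof
  assume gap: "transversal_gap {} {} {}"
  obtain f :: "'a \<Rightarrow> int" where
    hom: "\<And>x y. x \<in> carrier G \<Longrightarrow> y \<in> carrier G \<Longrightarrow> 2 dvd f (x \<otimes> y) - f x - f y" and
    odd: "\<And>h. h \<in> carrier G \<Longrightarrow> h \<noteq> \<one> \<Longrightarrow> h \<otimes> h = \<one> \<Longrightarrow> odd (f h)"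
    using parity_character[OF assms] by blast
  have "2 dvd order G"
    using assms by presburger
  then obtain h where h: "h \<in> carrier G" "ord h = 2"
    using exists_prime_order[OF two_is_prime_nat] by blast
  have h2: "h \<noteq> \<one>" "h \<otimes> h = \<one>"
    using h ord_id pow_ord_eq_1[OF h(1)] by (auto simp: numeral_2_eq_2)
  have "even (sum f (carrier G)) \<longleftrightarrow> even (card (carrier G) div 2)"
    by (rule involution_sum(2)[of _ h]) (use h h2 odd hom in auto)
  moreover have "2 dvd sum f (carrier G) + sum f {} - sum f {} - sum f {}"
    by (rule transversal_gap_sum[OF gap hom])
  moreover have "odd (card (carrier G) div 2)"
    using assms by (simp add: order_def) presburger
  ultimately show False
    by simp
qed

lemma full_missing_singly_even:
  "order G mod 4 = 2 \<Longrightarrow> \<not> has_maximal_of_length (cayley_table G) (order G)"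
  using no_full_gap_singly_even transversal_gap_full by blast

lemma half_missing_doubly_even:
  assumes "order G mod 8 = 4"
  shows "\<not> has_maximal_of_length (cayley_table G) (order G div 2)"
proof (rule half_missing)
  show "even (order G)"
    using assms by presburger
  fix H
  assume H: "subgroup H G" "2 * card H = order G"
  then have "card H mod 4 = 2"
    using assms by presburger
  then show "\<not> finite_group.transversal_gap (G\<lparr>carrier := H\<rparr>) {} {} {}"
    using finite_group.no_full_gap_singly_even[OF subgroup_finite_group[OF H(1)]] by (simp add: order_def)
qed

end

section \<open>Groups of order 8 and 16\<close>

context finite_group
begin

section \<open>Central involutions of 2-groups\<close>

definition center :: "'a set" where
  "center = {z \<in> carrier G. \<forall>x\<in>carrier G. z \<otimes> x = x \<otimes> z}"

lemma subgroup_center: "subgroup center G"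
proof (rule subgroupI)
  fix a
  assume a: "a \<in> center"
  show "inv a \<in> center"
    unfolding center_def
  proof (intro CollectI conjI ballI)
    show "inv a \<in> carrier G"
      using a by (auto simp: center_def)
    fix x
    assume x: "x \<in> carrier G"
    then show "inv a \<otimes> x = x \<otimes> inv a"
      using a unfolding center_def by (simp add: inv_solve_left inv_solve_right m_assoc)
  qed
  fix b
  assume b: "b \<in> center"
  have ab: "a \<in> carrier G" "b \<in> carrier G"
    using a b by (auto simp: center_def)
  have "a \<otimes> b \<otimes> x = x \<otimes> (a \<otimes> b)" if x: "x \<in> carrier G" for x
  proof -
    have "b \<otimes> x = x \<otimes> b" "a \<otimes> x = x \<otimes> a"
      using a b x unfolding center_def by blast+
    then show ?thesis
      using ab x by (metis m_assoc)
  qed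
  then show "a \<otimes> b \<in> center"
    using ab by (simp add: center_def)
qed (auto simp: center_def)

text \<open>The class equation modulo 2: a conjugacy class outside the centre has size a power of
  two greater than 1. It is written as a sum of indicators over the orbits of conjugation.\<close>

lemma even_card_center:
  assumes "order G = 2 ^ k" "0 < k"
  shows "even (card center)"
proof -
  let ?\<phi> = "\<lambda>g. \<lambda>h \<in> carrier G. g \<otimes> h \<otimes> inv g"
  interpret conj: group_action G "carrier G" ?\<phi>
    by (rule action_by_conjugation)
  have "(\<Sum>orb\<in>orbits G (carrier G) ?\<phi>. \<Sum>x\<in>orb. of_bool (x \<notin> center)) = (\<Sum>x\<in>carrier G. of_bool (x \<notin> center) :: nat)"
    by (rule conj.disjoint_sum) simp
  moreover have "even (\<Sum>x\<in>orb. of_bool (x \<notin> center) :: nat)" if orb_in: "orb \<in> orbits G (carrier G) ?\<phi>" for orb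
  proof -
    obtain x where x: "x \<in> carrier G" "orb = orbit G ?\<phi> x"
      using orb_in unfolding orbits_def by blast
    have orb: "orb = {g \<otimes> x \<otimes> inv g | g. g \<in> carrier G}"
      using x by (auto simp: orbit_def)
    have x_in: "x \<in> orb"
      using x conj.orbit_refl by blast
    have orb_sub: "orb \<subseteq> carrier G"
      using x(1) by (auto simp: orb)
    have fin: "finite orb"
      by (rule finite_subset_carrier) (rule orb_sub)
    have central: "orb = {y}" if y: "y \<in> orb" "y \<in> center" for y
    proof -
      obtain g where g: "g \<in> carrier G" "y = g \<otimes> x \<otimes> inv g"
        using y(1) by (auto simp: orb)
      have comm: "y \<otimes> h = h \<otimes> y" if "h \<in> carrier G" for h
        using y(2) that unfolding center_def by blast
      have yc: "y \<in> carrier G"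
        using y(2) by (simp add: center_def)
      have conj_y: "h \<otimes> y \<otimes> inv h = y" if "h \<in> carrier G" for h
        using comm[OF that] yc that by (metis inv_solve_right m_closed)
      have "x = inv g \<otimes> y \<otimes> g"
        using g x(1) by (simp add: m_assoc) (simp add: m_assoc[symmetric])
      also have "\<dots> = y"
        using conj_y[of "inv g"] g(1) by simp
      finally have "x = y" .
      then have "h \<otimes> x \<otimes> inv h = x" if "h \<in> carrier G" for h
        using conj_y that by simp
      then have "orb \<subseteq> {x}"
        by (auto simp: orb)
      then show ?thesis
        using \<open>x = y\<close> x_in by blast
    qed
    show ?thesis
    proof (cases "orb \<inter> center = {}")
      case True
      then have "(\<Sum>x\<in>orb. of_bool (x \<notin> center) :: nat) = card orb"
        by (subst sum.cong[OF refl, of _ _ "\<lambda>_. 1"]) auto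
      moreover have "card orb dvd 2 ^ k"
        unfolding assms(1)[symmetric] x(2) conj.orbit_stabilizer_theorem[OF x(1), symmetric]
        by (rule dvd_triv_left)
      then obtain j where j: "card orb = 2 ^ j"
        using divides_primepow_nat[OF two_is_prime_nat] by blast
      moreover have "j \<noteq> 0"
      proof
        assume "j = 0"
        then have "orb = {x}"
          using j x_in by (auto simp: card_1_singleton_iff)
        then have "g \<otimes> x \<otimes> inv g = x" if "g \<in> carrier G" for g
          using that unfolding orb by blast
        then have "g \<otimes> x = x \<otimes> g" if "g \<in> carrier G" for g
          using that x(1) inv_solve_right[of x "g \<otimes> x" g] by simp
        then have "x \<in> center"
          using x(1) by (simp add: center_def)
        then show False
          using True x_in by blast
      qed
      ultimately show ?thesis
        by simp
    next
      case False
      then obtain y where "y \<in> orb" "y \<in> center"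
        by blast
      then show ?thesis
        using central[of y] by simp
    qed
  qed
  then have "even (\<Sum>orb\<in>orbits G (carrier G) ?\<phi>. \<Sum>x\<in>orb. of_bool (x \<notin> center) :: nat)"
    by (rule dvd_sum)
  ultimately have "even (\<Sum>x\<in>carrier G. of_bool (x \<notin> center) :: nat)"
    by argo
  moreover have "(\<Sum>x\<in>carrier G. of_bool (x \<notin> center) :: nat) = card (carrier G - center)"
  proof -
    have "(\<Sum>x\<in>carrier G. of_bool (x \<notin> center) :: nat) = (\<Sum>x\<in>carrier G - center. 1)"
      by (rule sum.mono_neutral_cong_right) auto
    then show ?thesis
      by simp
  qed
  moreover have "card (carrier G - center) + card center = order G"
    using subgroup.subset[OF subgroup_center]
    by (simp add: card_Diff_subset finite_subset_carrier card_mono order_def)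
  moreover have "even (order G)"
    using assms by simp
  ultimately show ?thesis
    by (metis even_add)
qed

text \<open>Cauchy's theorem inside the centre. The involution found serves as the last generator
  when a presentation is lifted from the quotient by it.\<close>

lemma central_involution:
  assumes "order G = 2 ^ k" "0 < k"
  shows "\<exists>z\<in>carrier G. z \<noteq> \<one> \<and> z \<otimes> z = \<one> \<and> (\<forall>x\<in>carrier G. z \<otimes> x = x \<otimes> z)"
proof -
  interpret Z: subgroup center G
    by (rule subgroup_center)
  interpret GZ: finite_group "G\<lparr>carrier := center\<rparr>"
    by (rule subgroup_finite_group) (rule subgroup_center)
  have "2 dvd order (G\<lparr>carrier := center\<rparr>)"
    using even_card_center[OF assms] by (simp add: order_def)
  then obtain z where z: "z \<in> center" "GZ.ord z = 2"
    using GZ.exists_prime_order[OF two_is_prime_nat] by auto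
  have "z [^]\<^bsub>G\<lparr>carrier := center\<rparr>\<^esub> (2::nat) = \<one>"
    using GZ.pow_ord_eq_1[of z] z by simp
  then have "z \<otimes> z = \<one>"
    using z(1) by (simp add: numeral_2_eq_2 Z.mem_carrier)
  moreover have "z \<noteq> \<one>"
    using z(2) GZ.ord_id by auto
  moreover have "z \<in> carrier G" "\<forall>x\<in>carrier G. z \<otimes> x = x \<otimes> z"
    using z(1) unfolding center_def by blast+
  ultimately show ?thesis
    by blast
qed

end

section \<open>Power-commutator presentations of groups of order 2, 4, 8 and 16\<close>

type_synonym bits = "bool \<times> bool \<times> bool \<times> bool"

text \<open>A power-commutator presentation on generators \<open>g\<^sub>1, \<dots>, g\<^sub>4\<close> of a group of order at most 16, each
  central modulo the later ones. The parameters \<open>(x, y, w, s, t, p, u, v, i, j)\<close> are the exponents in the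
  relations below.\<close>

type_synonym pres = "bool \<times> bool \<times> bool \<times> bool \<times> bool \<times> bool \<times> bool \<times> bool \<times> bool \<times> bool"

text \<open>The power with exponent 0 or 1. The unit here, and the multiplication in
  \<open>word\<close> and \<open>rel\<close>, are parameters because the same expressions are
  evaluated both in a group and on exponent vectors under \<open>mul P\<close>, where associativity
  may fail.\<close>

definition pw :: "'a \<Rightarrow> 'a \<Rightarrow> bool \<Rightarrow> 'a" where
  "pw e g b = (if b then g else e)"

fun word :: "('a \<Rightarrow> 'a \<Rightarrow> 'a) \<Rightarrow> 'a \<Rightarrow> 'a \<Rightarrow> 'a \<Rightarrow> 'a \<Rightarrow> 'a \<Rightarrow> bits \<Rightarrow> 'a" where
  "word m e g1 g2 g3 g4 (a, b, c, d) = m (pw e g1 a) (m (pw e g2 b) (m (pw e g3 c) (pw e g4 d)))"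

fun rel :: "('a \<Rightarrow> 'a \<Rightarrow> 'a) \<Rightarrow> 'a \<Rightarrow> pres \<Rightarrow> 'a \<Rightarrow> 'a \<Rightarrow> 'a \<Rightarrow> 'a \<Rightarrow> bool" where
  "rel m e (x, y, w, s, t, p, u, v, i, j) g1 g2 g3 g4 \<longleftrightarrow>
     m g1 g1 = m (pw e g2 x) (m (pw e g3 y) (pw e g4 w)) \<and>
     m g2 g2 = m (pw e g3 s) (pw e g4 t) \<and>
     m g3 g3 = pw e g4 p \<and> m g4 g4 = e \<and>
     m g2 g1 = m g1 (m g2 (m (pw e g3 u) (pw e g4 v))) \<and>
     m g3 g1 = m g1 (m g3 (pw e g4 i)) \<and>
     m g3 g2 = m g2 (m g3 (pw e g4 j)) \<and>
     m g4 g1 = m g1 g4 \<and> m g4 g2 = m g2 g4 \<and> m g4 g3 = m g3 g4"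

text \<open>\<open>mul1 P\<close>, \<dots>, \<open>mul4\<close> act on exponent vectors of normal words as right multiplication by \<open>g\<^sub>1, \<dots>, g\<^sub>4\<close>.\<close>

fun mul4 :: "bits \<Rightarrow> bits" where
  "mul4 (a, b, c, d) = (a, b, c, \<not> d)"

fun mul3 :: "pres \<Rightarrow> bits \<Rightarrow> bits" where
  "mul3 (x, y, w, s, t, p, u, v, i, j) (a, b, c, d) = (a, b, \<not> c, d \<noteq> (c \<and> p))"

fun mul2 :: "pres \<Rightarrow> bits \<Rightarrow> bits" where
  "mul2 (x, y, w, s, t, p, u, v, i, j) (a, b, c, d) =
     (if b then
        (if s then mul3 (x, y, w, s, t, p, u, v, i, j) (a, False, c, (d \<noteq> (c \<and> j)) \<noteq> t)
         else (a, False, c, (d \<noteq> (c \<and> j)) \<noteq> t))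
      else (a, True, c, d \<noteq> (c \<and> j)))"

definition ap :: "bool \<Rightarrow> ('b \<Rightarrow> 'b) \<Rightarrow> 'b \<Rightarrow> 'b" where
  "ap b f x = (if b then f x else x)"

fun mul1 :: "pres \<Rightarrow> bits \<Rightarrow> bits" where
  "mul1 (x, y, w, s, t, p, u, v, i, j) (a, b, c, d) =
     ap ((d \<noteq> (c \<and> i)) \<noteq> (b \<and> v)) mul4
       (ap c (mul3 (x, y, w, s, t, p, u, v, i, j))
         (ap (b \<and> u) (mul3 (x, y, w, s, t, p, u, v, i, j))
           (ap b (mul2 (x, y, w, s, t, p, u, v, i, j))
             (if a then (False, x, y, w) else (True, False, False, False)))))"

fun mul :: "pres \<Rightarrow> bits \<Rightarrow> bits \<Rightarrow> bits" where
  "mul P e (a, b, c, d) = ap d mul4 (ap c (mul3 P) (ap b (mul2 P) (ap a (mul1 P) e)))"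

context group
begin

lemma pw_closed [simp]: "g \<in> carrier G \<Longrightarrow> pw \<one> g b \<in> carrier G"
  by (simp add: pw_def)

lemma word_closed [simp]:
  "g1 \<in> carrier G \<Longrightarrow> g2 \<in> carrier G \<Longrightarrow> g3 \<in> carrier G \<Longrightarrow> g4 \<in> carrier G \<Longrightarrow>
   word (\<otimes>) \<one> g1 g2 g3 g4 e \<in> carrier G"
  by (cases e) auto

text \<open>Collection: the right factor is fed in one generator at a time and each is moved to its
  place with the relations. The identity holds even when different exponent vectors name the same
  element, so it is available before the presentation is known to be consistent.\<close>

lemma word_mul:
  assumes g: "g1 \<in> carrier G" "g2 \<in> carrier G" "g3 \<in> carrier G" "g4 \<in> carrier G"
    and rel: "rel (\<otimes>) \<one> P g1 g2 g3 g4"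
  defines "\<phi> \<equiv> word (\<otimes>) \<one> g1 g2 g3 g4"
  shows "\<phi> e \<otimes> \<phi> f = \<phi> (mul P e f)"
proof -
  obtain x y w s t p u v i j where P: "P = (x, y, w, s, t, p, u, v, i, j)"
    by (metis surj_pair)
  note R = rel[unfolded P rel.simps]
  have closed: "\<phi> e \<in> carrier G" for e
    using g by (simp add: \<phi>_def)
  have R': "g3 \<otimes> (g3 \<otimes> h) = pw \<one> g4 p \<otimes> h" "g4 \<otimes> (g4 \<otimes> h) = h"
    "g4 \<otimes> (g1 \<otimes> h) = g1 \<otimes> (g4 \<otimes> h)" "g4 \<otimes> (g2 \<otimes> h) = g2 \<otimes> (g4 \<otimes> h)" "g4 \<otimes> (g3 \<otimes> h) = g3 \<otimes> (g4 \<otimes> h)"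
    "g2 \<otimes> (g2 \<otimes> h) = pw \<one> g3 s \<otimes> (pw \<one> g4 t \<otimes> h)"
    "g3 \<otimes> (g2 \<otimes> h) = g2 \<otimes> (g3 \<otimes> (pw \<one> g4 j \<otimes> h))"
    if "h \<in> carrier G" for h
    using that g R by (simp_all add: m_assoc[symmetric])
  have 4: "\<phi> e \<otimes> g4 = \<phi> (mul4 e)" for e
    using g R by (cases e) (auto simp: \<phi>_def pw_def m_assoc R')
  have 3: "\<phi> e \<otimes> g3 = \<phi> (mul3 P e)" for e
    using g R by (cases e) (auto simp: P \<phi>_def pw_def m_assoc R')
  have w4: "\<phi> e \<otimes> pw \<one> g4 b = \<phi> (ap b mul4 e)" for e b
    using 4 closed by (simp add: pw_def ap_def)
  have w3: "\<phi> e \<otimes> pw \<one> g3 b = \<phi> (ap b (mul3 P) e)" for e b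
    using 3 closed by (simp add: pw_def ap_def)
  have 2: "\<phi> e \<otimes> g2 = \<phi> (mul2 P e)" for e
    using g R by (cases e) (auto simp: P \<phi>_def pw_def m_assoc R')
  have w2: "\<phi> e \<otimes> pw \<one> g2 b = \<phi> (ap b (mul2 P) e)" for e b
    using 2 closed by (simp add: pw_def ap_def)
  have 1: "\<phi> e \<otimes> g1 = \<phi> (mul1 P e)" for e
  proof -
    obtain a b c d where e: "e = (a, b, c, d)"
      by (cases e)
    define e0 where "e0 = (if a then (False, x, y, w) else (True, False, False, False))"
    have a: "pw \<one> g1 a \<otimes> g1 = \<phi> e0"
      using g R by (simp add: e0_def \<phi>_def pw_def)
    \<comment> \<open>These equations carry g1 to the left past g4, g3 and g2. The commutator
      factors left behind involve only later generators and are collected by the cases already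
      proved.\<close>
    have c4: "pw \<one> g4 d \<otimes> g1 = g1 \<otimes> pw \<one> g4 d"
      using g R by (simp add: pw_def)
    have c3: "pw \<one> g3 c \<otimes> (g1 \<otimes> h) = g1 \<otimes> (pw \<one> g3 c \<otimes> (pw \<one> g4 (c \<and> i) \<otimes> h))"
      if "h \<in> carrier G" for h
      using g R that by (simp add: pw_def m_assoc[symmetric])
    have c2: "pw \<one> g2 b \<otimes> (g1 \<otimes> h) =
        g1 \<otimes> (pw \<one> g2 b \<otimes> (pw \<one> g3 (b \<and> u) \<otimes> (pw \<one> g4 (b \<and> v) \<otimes> h)))"
      if "h \<in> carrier G" for h
      using g R that by (simp add: pw_def m_assoc[symmetric])
    have c34: "pw \<one> g4 (b \<and> v) \<otimes> (pw \<one> g3 c \<otimes> (pw \<one> g4 (c \<and> i) \<otimes> pw \<one> g4 d)) =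
        pw \<one> g3 c \<otimes> pw \<one> g4 ((d \<noteq> (c \<and> i)) \<noteq> (b \<and> v))"
      using g R by (auto simp: pw_def m_assoc R')
    have "\<phi> e \<otimes> g1 = pw \<one> g1 a \<otimes> g1 \<otimes> pw \<one> g2 b \<otimes> pw \<one> g3 (b \<and> u) \<otimes> pw \<one> g3 c
        \<otimes> pw \<one> g4 ((d \<noteq> (c \<and> i)) \<noteq> (b \<and> v))"
      using g unfolding e \<phi>_def word.simps by (simp add: m_assoc c4 c3 c2 c34)
    then show ?thesis
      unfolding a w2 w3 w4 unfolding e P by (simp add: e0_def)
  qed
  have w1: "\<phi> e \<otimes> pw \<one> g1 b = \<phi> (ap b (mul1 P) e)" for e b
    using 1 closed by (simp add: pw_def ap_def)
  obtain a b c d where f: "f = (a, b, c, d)"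
    by (cases f)
  have "\<phi> e \<otimes> \<phi> f = \<phi> e \<otimes> pw \<one> g1 a \<otimes> pw \<one> g2 b \<otimes> pw \<one> g3 c \<otimes> pw \<one> g4 d"
    using g closed[of e] by (simp add: f \<phi>_def m_assoc)
  then show ?thesis
    unfolding w1 w2 w3 w4 unfolding f by simp
qed

end

context finite_group
begin

text \<open>The set \<open>E\<close> of admissible exponent vectors lets groups of order 2, 4, 8 and
  16 share one format with four generators, the surplus generators of the smaller groups being
  \<one>.\<close>

definition pc_group :: "bits set \<Rightarrow> pres \<Rightarrow> 'a \<Rightarrow> 'a \<Rightarrow> 'a \<Rightarrow> 'a \<Rightarrow> bool" where
  "pc_group E P g1 g2 g3 g4 \<longleftrightarrow>
     g1 \<in> carrier G \<and> g2 \<in> carrier G \<and> g3 \<in> carrier G \<and> g4 \<in> carrier G \<and>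
     rel (\<otimes>) \<one> P g1 g2 g3 g4 \<and> bij_betw (word (\<otimes>) \<one> g1 g2 g3 g4) E (carrier G)"

lemma pc_group_mul:
  "pc_group E P g1 g2 g3 g4 \<Longrightarrow>
   word (\<otimes>) \<one> g1 g2 g3 g4 e \<otimes> word (\<otimes>) \<one> g1 g2 g3 g4 f = word (\<otimes>) \<one> g1 g2 g3 g4 (mul P e f)"
  unfolding pc_group_def by (simp add: word_mul)

text \<open>Moving every generator one slot forward frees the last slot for the next central
  involution. The squares of the new g1 and g2 are the old squares of g2 and g3, and the new
  commutator bit is the old \<open>j\<close>.\<close>

lemma pc_group_shift:
  assumes "pc_group {(a, b, c, d). (\<not> a) \<and> (b, c, d) \<in> F} (x, y, w, s, t, p, u, v, i, j) \<one> h1 h2 h3"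
  shows "pc_group {(a, b, c, d). \<not> d \<and> (a, b, c) \<in> F} (s, t, False, p, False, False, j, False, False, False) h1 h2 h3 \<one>"
proof -
  let ?\<phi> = "word (\<otimes>) \<one> \<one> h1 h2 h3" and ?\<psi> = "word (\<otimes>) \<one> h1 h2 h3 \<one>"
  have h: "h1 \<in> carrier G" "h2 \<in> carrier G" "h3 \<in> carrier G"
    and bij: "bij_betw ?\<phi> {(a, b, c, d). \<not> a \<and> (b, c, d) \<in> F} (carrier G)"
    using assms by (auto simp: pc_group_def)
  have eq: "?\<psi> e = ?\<phi> (case e of (a, b, c, d) \<Rightarrow> (False, a, b, c))" if "e \<in> {(a, b, c, d). \<not> d \<and> (a, b, c) \<in> F}" for e
    using that h by (cases e) (auto simp: pw_def)
  have "bij_betw (\<lambda>(a, b, c, d). (False, a, b, c)) {(a, b, c, d). \<not> d \<and> (a, b, c) \<in> F}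
      {(a, b, c, d). \<not> a \<and> (b, c, d) \<in> F}"
    by (rule bij_betwI[where g = "\<lambda>(a, b, c, d). (b, c, d, False)"]) auto
  from bij_betw_trans[OF this bij]
  have "bij_betw ?\<psi> {(a, b, c, d). \<not> d \<and> (a, b, c) \<in> F} (carrier G)"
    by (rule bij_betw_cong[THEN iffD2, rotated]) (simp add: eq split_beta del: word.simps)
  moreover have "rel (\<otimes>) \<one> (s, t, False, p, False, False, j, False, False, False) h1 h2 h3 \<one>"
    using assms h by (simp add: pc_group_def pw_def)
  ultimately show ?thesis
    using h by (simp add: pc_group_def)
qed

lemma central_quotient:
  assumes z: "z \<in> carrier G" "z \<noteq> \<one>" "z \<otimes> z = \<one>" "\<And>x. x \<in> carrier G \<Longrightarrow> z \<otimes> x = x \<otimes> z"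
  shows "{\<one>, z} \<lhd> G" and "finite_group (G Mod {\<one>, z})" and "order (G Mod {\<one>, z}) * 2 = order G"
proof -
  have sub: "subgroup {\<one>, z} G"
  proof (rule subgroupI)
    have "inv z = z"
      using z(1-3) by (intro inv_equality) auto
    then show "inv a \<in> {\<one>, z}" if "a \<in> {\<one>, z}" for a
      using that by auto
  qed (use z(1-3) in auto)
  have "x \<otimes> h \<otimes> inv x \<in> {\<one>, z}" if "x \<in> carrier G" "h \<in> {\<one>, z}" for x h
    using that z(1) inv_solve_right[of z "x \<otimes> z" x] z(4)[OF that(1)] by auto
  then show N: "{\<one>, z} \<lhd> G"
    using sub by (simp add: normal_inv_iff)
  interpret N: normal "{\<one>, z}" G
    by (rule N)
  have "finite (carrier (G Mod {\<one>, z}))"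
    by (simp add: carrier_FactGroup)
  then show "finite_group (G Mod {\<one>, z})"
    using N.factorgroup_is_group by (simp add: finite_group_def finite_group_axioms_def)
  have "card (rcosets {\<one>, z}) * card {\<one>, z} = order G"
    by (rule lagrange) (rule sub)
  then show "order (G Mod {\<one>, z}) * 2 = order G"
    using z(2) by (simp add: order_def FactGroup_def)
qed

text \<open>A relation of the quotient holds in G up to a factor \<one> or z. The six binary choices
  are the new parameters \<open>w\<close>, \<open>t\<close>, \<open>p\<close>, \<open>v\<close>,
  \<open>i\<close>, \<open>j\<close>. Trivial generators are lifted to \<one> itself, so that their
  slots remain free for the shift.\<close>

lemma pc_group_lift:
  assumes z: "z \<in> carrier G" "z \<noteq> \<one>" "z \<otimes> z = \<one>" "\<And>x. x \<in> carrier G \<Longrightarrow> z \<otimes> x = x \<otimes> z"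
    and Q: "finite_group.pc_group (G Mod {\<one>, z}) {(a, b, c, d). \<not> d \<and> (a, b, c) \<in> F}
      (x, y, False, s, False, False, u, False, False, False) h1 h2 h3 \<one>\<^bsub>G Mod {\<one>, z}\<^esub>"
  obtains w t p v i j g1 g2 g3 where
    "pc_group {(a, b, c, d). (a, b, c) \<in> F} (x, y, w, s, t, p, u, v, i, j) g1 g2 g3 z"
    "h1 = \<one>\<^bsub>G Mod {\<one>, z}\<^esub> \<Longrightarrow> g1 = \<one>" "h2 = \<one>\<^bsub>G Mod {\<one>, z}\<^esub> \<Longrightarrow> g2 = \<one>"
proof -
  define N where "N = {\<one>, z}"
  note cq = central_quotient[OF z, folded N_def]
  interpret N: normal N G
    by (rule cq(1))
  interpret Q: finite_group "G Mod N"
    by (rule cq(2))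
  note Q' = Q[folded N_def, unfolded Q.pc_group_def]
  have lift: "\<exists>g\<in>carrier G. h = N #> g \<and> (h = N \<longrightarrow> g = \<one>)" if "h \<in> carrier (G Mod N)" for h
  proof (cases "h = N")
    case True
    then show ?thesis
      using N.subset by (intro bexI[of _ \<one>]) auto
  next
    case False
    then show ?thesis
      using that by (auto simp: carrier_FactGroup)
  qed
  obtain g1 g2 g3 where g: "g1 \<in> carrier G" "g2 \<in> carrier G" "g3 \<in> carrier G"
    and h: "h1 = N #> g1" "h2 = N #> g2" "h3 = N #> g3" and g1: "h1 = N \<longrightarrow> g1 = \<one>" "h2 = N \<longrightarrow> g2 = \<one>"
    using lift Q' by metis
  have hom: "(N #> a) \<otimes>\<^bsub>G Mod N\<^esub> (N #> b) = N #> (a \<otimes> b)" if "a \<in> carrier G" "b \<in> carrier G" for a b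
    using that by (simp add: N.rcos_sum)
  have one: "\<one>\<^bsub>G Mod N\<^esub> = N #> \<one>"
    using N.subset by simp
  have pwQ: "pw (N #> \<one>) (N #> a) b = N #> pw \<one> a b" if "a \<in> carrier G" for a b
    using that by (simp add: pw_def)
  have split: "\<exists>b. k = l \<otimes> pw \<one> z b" if "N #> k = N #> l" "k \<in> carrier G" "l \<in> carrier G" for k l
  proof -
    have "k \<in> N #> l"
      using that N.subset by (metis rcos_self N.is_subgroup)
    then have "k = l \<or> k = z \<otimes> l"
      using that(3) by (auto simp: N_def r_coset_def)
    then show ?thesis
    proof
      assume "k = l"
      then show ?thesis
        using that by (intro exI[of _ False]) (simp add: pw_def)
    next
      assume "k = z \<otimes> l"
      then show ?thesis
        using z(4)[OF that(3)] by (intro exI[of _ True]) (simp add: pw_def)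
    qed
  qed
  note R = Q'[THEN conjunct2, THEN conjunct2, THEN conjunct2, THEN conjunct2, THEN conjunct1,
      unfolded rel.simps h]
  note m = m_closed pw_closed one_closed
  have pwz: "pw \<one> z False = \<one>"
    by (simp add: pw_def)
  have "N #> (g1 \<otimes> g1) = N #> (pw \<one> g2 x \<otimes> pw \<one> g3 y)"
    "N #> (g2 \<otimes> g2) = N #> pw \<one> g3 s" "N #> (g3 \<otimes> g3) = N #> \<one>"
    "N #> (g2 \<otimes> g1) = N #> (g1 \<otimes> (g2 \<otimes> pw \<one> g3 u))"
    "N #> (g3 \<otimes> g1) = N #> (g1 \<otimes> g3)" "N #> (g3 \<otimes> g2) = N #> (g2 \<otimes> g3)"
    using R g by (simp_all add: pwQ hom one pw_def[of _ _ False] del: mult_FactGroup one_FactGroup)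
  then obtain w t p v i j where
    *: "g1 \<otimes> g1 = pw \<one> g2 x \<otimes> pw \<one> g3 y \<otimes> pw \<one> z w"
    "g2 \<otimes> g2 = pw \<one> g3 s \<otimes> pw \<one> z t" "g3 \<otimes> g3 = \<one> \<otimes> pw \<one> z p"
    "g2 \<otimes> g1 = g1 \<otimes> (g2 \<otimes> pw \<one> g3 u) \<otimes> pw \<one> z v"
    "g3 \<otimes> g1 = g1 \<otimes> g3 \<otimes> pw \<one> z i" "g3 \<otimes> g2 = g2 \<otimes> g3 \<otimes> pw \<one> z j"
    using split[of "g1 \<otimes> g1"] split[of "g2 \<otimes> g2"] split[of "g3 \<otimes> g3"] split[of "g2 \<otimes> g1"]
      split[of "g3 \<otimes> g1"] split[of "g3 \<otimes> g2"] g by (metis m)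
  let ?P = "(x, y, w, s, t, p, u, v, i, j)"
  have rel: "rel (\<otimes>) \<one> ?P g1 g2 g3 z"
    using * g z(1,3) z(4)[OF g(1)] z(4)[OF g(2)] z(4)[OF g(3)] by (simp add: m_assoc)
  let ?\<phi> = "word (\<otimes>) \<one> g1 g2 g3 z"
  let ?\<psi> = "word (\<otimes>\<^bsub>G Mod N\<^esub>) \<one>\<^bsub>G Mod N\<^esub> h1 h2 h3 \<one>\<^bsub>G Mod N\<^esub>"
  let ?E = "{(a, b, c, d). \<not> d \<and> (a, b, c) \<in> F}" and ?E' = "{(a, b, c, d :: bool). (a, b, c) \<in> F}"
  have bij: "bij_betw ?\<psi> ?E (carrier (G Mod N))"
    using Q' by blast
  have \<psi>: "?\<psi> (a, b, c, False) = N #> ?\<phi> (a, b, c, False)" for a b c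
    using g by (simp add: h pwQ hom one pw_def[of _ _ False] del: mult_FactGroup one_FactGroup)
  \<comment> \<open>Surjectivity is enough, because adding the last bit doubles the number of
    admissible vectors, just as passing from the quotient to G doubles the order.\<close>
  have surj: "carrier G \<subseteq> ?\<phi> ` ?E'"
  proof
    fix k
    assume k: "k \<in> carrier G"
    then have "N #> k \<in> carrier (G Mod N)"
      by (auto simp: carrier_FactGroup)
    then have "N #> k \<in> ?\<psi> ` ?E"
      using bij by (simp add: bij_betw_def)
    then obtain a b c where abc: "(a, b, c) \<in> F" "N #> k = ?\<psi> (a, b, c, False)"
      by auto
    then obtain d where "k = ?\<phi> (a, b, c, False) \<otimes> pw \<one> z d"
      using split[of k "?\<phi> (a, b, c, False)"] k g z(1) unfolding \<psi> by auto
    then have "k = ?\<phi> (a, b, c, d)"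
      using g z(1) by (simp add: m_assoc pw_def[of _ _ False])
    then show "k \<in> ?\<phi> ` ?E'"
      using abc(1) by (intro image_eqI[of _ _ "(a, b, c, d)"]) auto
  qed
  have fin: "finite ?E'"
    by (rule finite_subset[OF subset_UNIV]) simp
  have "?\<phi> ` ?E' = carrier G"
    using surj g z(1) by (auto simp del: word.simps)
  moreover have "card ?E' = order G"
  proof -
    have "card ?E = order (G Mod N)"
      using bij_betw_same_card[OF bij] by (simp add: order_def)
    moreover have "?E' = ?E \<union> mul4 ` ?E" "?E \<inter> mul4 ` ?E = {}"
      by (auto simp: image_iff)
    moreover have "card (mul4 ` ?E) = card ?E"
      by (rule card_image) (auto simp: inj_on_def)
    moreover have "finite ?E"
      by (rule finite_subset[OF subset_UNIV]) simp
    ultimately have "card ?E' = order (G Mod N) * 2"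
      by (simp add: card_Un_disjoint)
    then show ?thesis
      using cq(3) by simp
  qed
  ultimately have "bij_betw ?\<phi> ?E' (carrier G)"
    using fin by (simp add: bij_betw_def eq_card_imp_inj_on order_def)
  then have "pc_group ?E' ?P g1 g2 g3 z"
    using rel g z(1) by (simp add: pc_group_def)
  then show thesis
    using that g1 by (simp add: N_def)
qed

end

text \<open>The generator is put into the third slot, so that the fourth is available when z is
  adjoined.\<close>

lemma pc_group_order2:
  fixes G (structure)
  assumes "finite_group G" "order G = 2"
  shows "\<exists>h. finite_group.pc_group G {(a, b, c, d). \<not> d \<and> (a, b, c) \<in> {(False, False, True), (False, False, False)}}
     (False, False, False, False, False, False, False, False, False, False) \<one> \<one> h \<one>"
proof -
  interpret finite_group G
    by fact
  have "order G = 2 ^ 1"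
    using assms(2) by simp
  then obtain z where z: "z \<in> carrier G" "z \<noteq> \<one>" "z \<otimes> z = \<one>"
    using central_involution[OF _ zero_less_one] by metis
  have carrier: "carrier G = {\<one>, z}"
    using z assms(2) by (intro card_subset_eq[symmetric]) (auto simp: order_def)
  have "{(a, b, c, d). \<not> d \<and> (a, b, c) \<in> {(False, False, True), (False, False, False)}} =
      {(False, False, True, False), (False, False, False, False)}"
    by auto
  then show ?thesis
    unfolding pc_group_def using z
    by (intro exI[of _ z]) (simp add: pw_def carrier bij_betw_def insert_commute)
qed

text \<open>One round of the extension procedure: pass to the quotient by a central involution, lift
  its presentation, then shift. Order 8 repeats the round.\<close>

lemma pc_group_order4:
  fixes G (structure)
  assumes "finite_group G" "order G = 4"
  shows "\<exists>t p j h2 h3. finite_group.pc_group G {(a, b, c, d). \<not> d \<and> (a, b, c) \<in> {(a, b, c). \<not> a}}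
     (False, t, False, p, False, False, j, False, False, False) \<one> h2 h3 \<one>"
proof -
  interpret finite_group G
    by fact
  have "order G = 2 ^ 2"
    using assms(2) by simp
  then obtain z where z: "z \<in> carrier G" "z \<noteq> \<one>" "z \<otimes> z = \<one>" "\<And>x. x \<in> carrier G \<Longrightarrow> z \<otimes> x = x \<otimes> z"
    using central_involution[OF _ zero_less_numeral] by metis
  note cq = central_quotient[OF z]
  have "order (G Mod {\<one>, z}) = 2"
    using cq(3) assms(2) by simp
  then obtain h where Q: "finite_group.pc_group (G Mod {\<one>, z}) {(a, b, c, d). \<not> d \<and> (a, b, c) \<in> {(False, False, True), (False, False, False)}}
     (False, False, False, False, False, False, False, False, False, False)
     \<one>\<^bsub>G Mod {\<one>, z}\<^esub> \<one>\<^bsub>G Mod {\<one>, z}\<^esub> h \<one>\<^bsub>G Mod {\<one>, z}\<^esub>"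
    using pc_group_order2[OF cq(2)] by blast
  obtain w t p v i j g3 where
    *: "pc_group {(a, b, c, d). (a, b, c) \<in> {(False, False, True), (False, False, False)}}
      (False, False, w, False, t, p, False, v, i, j) \<one> \<one> g3 z"
    using pc_group_lift[OF z Q] by metis
  have eq: "{(a, b, c, d). (a, b, c) \<in> {(False, False, True), (False, False, False)}} =
      {(a, b, c, d). \<not> a \<and> (b, c, d) \<in> {(b, c, d). \<not> b}}"
    by auto
  show ?thesis
    using pc_group_shift[OF *[unfolded eq]] by blast
qed

lemma pc_group_order8:
  fixes G (structure)
  assumes "finite_group G" "order G = 8"
  shows "\<exists>x y s u g1 g2 g3. finite_group.pc_group G {(a, b, c, d). \<not> d \<and> (a, b, c) \<in> UNIV}
     (x, y, False, s, False, False, u, False, False, False) g1 g2 g3 \<one>"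
proof -
  interpret finite_group G
    by fact
  have "order G = 2 ^ 3"
    using assms(2) by simp
  then obtain z where z: "z \<in> carrier G" "z \<noteq> \<one>" "z \<otimes> z = \<one>" "\<And>x. x \<in> carrier G \<Longrightarrow> z \<otimes> x = x \<otimes> z"
    using central_involution[OF _ zero_less_numeral] by metis
  note cq = central_quotient[OF z]
  have "order (G Mod {\<one>, z}) = 4"
    using cq(3) assms(2) by simp
  then obtain y s u h2 h3 where Q: "finite_group.pc_group (G Mod {\<one>, z}) {(a, b, c, d). \<not> d \<and> (a, b, c) \<in> {(a, b, c). \<not> a}}
     (False, y, False, s, False, False, u, False, False, False)
     \<one>\<^bsub>G Mod {\<one>, z}\<^esub> h2 h3 \<one>\<^bsub>G Mod {\<one>, z}\<^esub>"
    using pc_group_order4[OF cq(2)] by blast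
  obtain w t p v i j g2 g3 where
    *: "pc_group {(a, b, c, d). (a, b, c) \<in> {(a, b, c). \<not> a}}
      (False, y, w, s, t, p, u, v, i, j) \<one> g2 g3 z"
    using pc_group_lift[OF z Q] by metis
  have eq: "{(a, b, c, d). (a, b, c) \<in> {(a, b, c). \<not> a}} = {(a, b, c, d). \<not> a \<and> (b, c, d) \<in> UNIV}"
    by auto
  show ?thesis
    using pc_group_shift[OF *[unfolded eq]] by blast
qed

section \<open>Tables of presentations and their verification by evaluation\<close>

datatype hex = H0 | H1 | H2 | H3 | H4 | H5 | H6 | H7 | H8 | H9 | HA | HB | HC | HD | HE | HF

text \<open>The leading bit belongs to g1, so \<open>H8\<close>, \<open>H4\<close>,
  \<open>H2\<close>, \<open>H1\<close> name the four generators and \<open>H0\<close> the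
  unit.\<close>

primrec bits_of :: "hex \<Rightarrow> bits" where
  "bits_of H0 = (False, False, False, False)" |
  "bits_of H1 = (False, False, False, True)" |
  "bits_of H2 = (False, False, True, False)" |
  "bits_of H3 = (False, False, True, True)" |
  "bits_of H4 = (False, True, False, False)" |
  "bits_of H5 = (False, True, False, True)" |
  "bits_of H6 = (False, True, True, False)" |
  "bits_of H7 = (False, True, True, True)" |
  "bits_of H8 = (True, False, False, False)" |
  "bits_of H9 = (True, False, False, True)" |
  "bits_of HA = (True, False, True, False)" |
  "bits_of HB = (True, False, True, True)" |
  "bits_of HC = (True, True, False, False)" |
  "bits_of HD = (True, True, False, True)" |
  "bits_of HE = (True, True, True, False)" |
  "bits_of HF = (True, True, True, True)"

definition all_hex :: "hex list" where
  "all_hex = [H0, H1, H2, H3, H4, H5, H6, H7, H8, H9, HA, HB, HC, HD, HE, HF]"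

definition pres_of :: "hex \<Rightarrow> hex \<Rightarrow> hex \<Rightarrow> pres" where
  "pres_of h k l = (case (bits_of h, bits_of k, bits_of l) of
     ((x, y, w, s), (t, p, u, v), (_, _, i, j)) \<Rightarrow> (x, y, w, s, t, p, u, v, i, j))"

definition all_bits :: "bits list" where
  "all_bits = map bits_of all_hex"

text \<open>The normal words with g4 absent, that is, the elements of a group of order 8.\<close>

definition even_bits :: "bits list" where
  "even_bits = map bits_of [H0, H2, H4, H6, H8, HA, HC, HE]"

text \<open>A certificate for a change of generators. It is checked on exponent vectors alone, and
  \<open>word_mul\<close> transports it to every group with the presentation \<open>P\<close>.
  Distinctness of the listed words makes the substitution a permutation of
  \<open>es\<close>.\<close>

definition regenerates :: "bits list \<Rightarrow> pres \<Rightarrow> pres \<Rightarrow> bits \<Rightarrow> bits \<Rightarrow> bits \<Rightarrow> bits \<Rightarrow> bool" where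
  "regenerates es P P' w1 w2 w3 w4 \<longleftrightarrow> rel (mul P) (bits_of H0) P' w1 w2 w3 w4 \<and>
     (let l = map (word (mul P) (bits_of H0) w1 w2 w3 w4) es in distinct l \<and> list_all (\<lambda>x. x \<in> set es) l)"

text \<open>A failure of associativity of \<open>mul P\<close> forces two distinct words to be equal in every group satisfying
  the relations \<open>P\<close>.\<close>

definition inconsistent :: "pres \<Rightarrow> bool" where
  "inconsistent P \<longleftrightarrow> list_ex (\<lambda>(a, b, c). mul P (mul P (bits_of a) (bits_of b)) (bits_of c) \<noteq>
       mul P (bits_of a) (mul P (bits_of b) (bits_of c)))
     [(H8, H8, H8), (H4, H8, H8), (H4, H4, H8), (H4, H4, H4)]"

definition pres8 :: "bits \<Rightarrow> pres" where
  "pres8 = (\<lambda>(x, y, s, u). (x, y, False, s, False, False, u, False, False, False))"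

text \<open>The five groups of order 8: \<open>E\<^sub>8\<close>, \<open>\<int>\<^sub>4 \<times> \<int>\<^sub>2\<close>, \<open>\<int>\<^sub>8\<close>, \<open>D\<^sub>8\<close> and \<open>Q\<^sub>8\<close>.\<close>

definition groups8 :: "hex list" where
  "groups8 = [H0, H4, HA, H1, H7]"

text \<open>For each consistent presentation, a computer search found an isomorphic one in the list, and words that
  generate the same group and satisfy the relations of the latter.\<close>

definition changes8 :: "(hex \<times> hex \<times> hex \<times> hex \<times> hex) list" where
  "changes8 = [
    (H0, H0, H2, H4, H8), (H1, H1, H4, H8, H2), (H2, H4, H4, H8, H2), (H3, H1, H8, HC, H2),
    (H4, H4, H8, H4, H2), (H5, H1, H4, HC, H2), (H6, H4, H4, HC, H2), (H7, H7, H4, H8, H2),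
    (H8, H4, H8, H2, H4), (HA, HA, H8, H4, H2), (HC, H4, H8, H2, H6), (HE, HA, H8, H6, H2)]"

text \<open>The nine non-abelian groups of order 16.\<close>

definition groups16 :: "pres list" where
  "groups16 = [
    pres_of H0 H0 H1, pres_of H0 H1 H3, pres_of H0 HC H1, pres_of H4 H1 H0, pres_of H4 H5 H0,
    pres_of H4 H9 H0, pres_of H0 H6 H3, pres_of H0 HE H3, pres_of H2 HE H3]"

definition changes16 :: "(pres \<times> pres \<times> hex \<times> hex \<times> hex \<times> hex) list" where
  "changes16 = [
    (pres_of H0 H0 H1, pres_of H0 H0 H1, H8, H2, H4, H1),
    (pres_of H0 H0 H2, pres_of H0 H0 H1, H4, H2, H8, H1),
    (pres_of H0 H0 H3, pres_of H0 H0 H1, HC, H2, H4, H1),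
    (pres_of H0 H1 H0, pres_of H0 H0 H1, H2, H4, H8, H1),
    (pres_of H0 H1 H1, pres_of H0 H0 H1, HA, H2, H4, H1),
    (pres_of H0 H1 H2, pres_of H0 H0 H1, H6, H2, H8, H1),
    (pres_of H0 H1 H3, pres_of H0 H1 H3, H2, H4, H8, H1),
    (pres_of H0 H4 H1, pres_of H0 H0 H1, H8, H4, H6, H1),
    (pres_of H0 H4 H2, pres_of H0 H0 H1, H4, H8, HA, H1),
    (pres_of H0 H4 H3, pres_of H0 H0 H1, HC, H4, H6, H1),
    (pres_of H0 H5 H0, pres_of H0 H1 H3, H4, H8, HE, H1),
    (pres_of H0 H5 H1, pres_of H0 H1 H3, H4, H6, H8, H1),
    (pres_of H0 H5 H2, pres_of H0 H1 H3, H4, H8, HA, H1),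
    (pres_of H0 H5 H3, pres_of H0 H0 H1, HE, H4, H6, H1),
    (pres_of H0 H8 H1, pres_of H0 H0 H1, H8, H2, H6, H1),
    (pres_of H0 H8 H2, pres_of H0 H1 H3, H2, H8, HE, H1),
    (pres_of H0 H8 H3, pres_of H0 H1 H3, H2, H6, H8, H1),
    (pres_of H0 H9 H0, pres_of H0 H0 H1, H2, H8, HC, H1),
    (pres_of H0 H9 H1, pres_of H0 H0 H1, HA, H2, H6, H1),
    (pres_of H0 H9 H2, pres_of H0 H1 H3, H2, H8, HC, H1),
    (pres_of H0 H9 H3, pres_of H0 H0 H1, HE, H2, H6, H1),
    (pres_of H0 HC H1, pres_of H0 HC H1, H8, H2, H4, H1),
    (pres_of H0 HC H2, pres_of H0 H1 H3, H6, H8, HA, H1),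
    (pres_of H0 HC H3, pres_of H0 H1 H3, H8, HA, HE, H1),
    (pres_of H0 HD H0, pres_of H0 H1 H3, H6, H8, HC, H1),
    (pres_of H0 HD H1, pres_of H0 H1 H3, H8, HC, HE, H1),
    (pres_of H0 HD H2, pres_of H0 H0 H1, H6, H8, HA, H1),
    (pres_of H0 HD H3, pres_of H0 H1 H3, H8, HA, HC, H1),
    (pres_of H2 H0 H1, pres_of H0 H1 H3, H2, H4, HE, H1),
    (pres_of H2 H0 H2, pres_of H0 H0 H1, H4, H2, HA, H1),
    (pres_of H2 H0 H3, pres_of H0 H1 H3, H2, H4, HA, H1),
    (pres_of H2 H1 H0, pres_of H0 H0 H1, H2, H4, HC, H1),
    (pres_of H2 H1 H1, pres_of H0 H1 H3, H2, H4, HC, H1),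
    (pres_of H2 H1 H2, pres_of H0 H0 H1, H6, H2, HA, H1),
    (pres_of H2 H1 H3, pres_of H0 H0 H1, HE, H2, H4, H1),
    (pres_of H2 H4 H1, pres_of H0 H1 H3, H4, H6, HA, H1),
    (pres_of H2 H4 H2, pres_of H0 HC H1, H4, H2, H8, H1),
    (pres_of H2 H4 H3, pres_of H0 H1 H3, H4, H6, HE, H1),
    (pres_of H2 H5 H0, pres_of H0 H1 H3, H4, HA, HC, H1),
    (pres_of H2 H5 H1, pres_of H0 H0 H1, HA, H4, H6, H1),
    (pres_of H2 H5 H2, pres_of H0 H1 H3, H4, HC, HE, H1),
    (pres_of H2 H5 H3, pres_of H0 H1 H3, H4, H6, HC, H1),
    (pres_of H2 H8 H1, pres_of H0 H1 H3, H2, H6, HC, H1),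
    (pres_of H2 H8 H2, pres_of H0 H1 H3, H2, HA, HC, H1),
    (pres_of H2 H8 H3, pres_of H0 H0 H1, HC, H2, H6, H1),
    (pres_of H2 H9 H0, pres_of H0 HC H1, H2, H4, H8, H1),
    (pres_of H2 H9 H1, pres_of H0 H1 H3, H2, H6, HE, H1),
    (pres_of H2 H9 H2, pres_of H0 H1 H3, H2, HA, HE, H1),
    (pres_of H2 H9 H3, pres_of H0 H1 H3, H2, H6, HA, H1),
    (pres_of H2 HC H1, pres_of H0 H1 H3, HA, HC, HE, H1),
    (pres_of H2 HC H2, pres_of H0 H1 H3, H6, HC, HE, H1),
    (pres_of H2 HC H3, pres_of H0 HC H1, HC, H2, H4, H1),
    (pres_of H2 HD H0, pres_of H0 H1 H3, H6, HA, HE, H1),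
    (pres_of H2 HD H1, pres_of H0 HC H1, HA, H2, H4, H1),
    (pres_of H2 HD H2, pres_of H0 HC H1, H6, H2, H8, H1),
    (pres_of H2 HD H3, pres_of H0 HC H1, HE, H2, H4, H1),
    (pres_of H4 H1 H0, pres_of H4 H1 H0, H8, H4, H2, H1),
    (pres_of H4 H5 H0, pres_of H4 H5 H0, H8, H4, H2, H1),
    (pres_of H4 H9 H0, pres_of H4 H9 H0, H8, H4, H2, H1),
    (pres_of H4 HD H0, pres_of H4 H5 H0, H8, H6, H2, H1),
    (pres_of H6 H1 H0, pres_of H4 H1 H0, H8, H4, H3, H1),
    (pres_of H6 H5 H0, pres_of H4 H5 H0, H8, H4, H3, H1),
    (pres_of H6 H9 H0, pres_of H4 H9 H0, H8, H4, H3, H1),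
    (pres_of H6 HD H0, pres_of H4 H5 H0, H8, H6, H3, H1),
    (pres_of H0 H2 H0, pres_of H0 H0 H1, H1, H4, H8, H2),
    (pres_of H0 H3 H0, pres_of H0 H0 H1, H1, H4, H8, H3),
    (pres_of H0 H6 H3, pres_of H0 H6 H3, H4, H8, H3, H1),
    (pres_of H0 H7 H3, pres_of H0 H6 H3, H4, H8, H2, H1),
    (pres_of H0 HA H0, pres_of H4 H1 H0, H4, H8, H1, H2),
    (pres_of H0 HB H0, pres_of H4 H1 H0, H4, H8, H1, H3),
    (pres_of H0 HE H3, pres_of H0 HE H3, H8, H4, H2, H1),
    (pres_of H0 HF H3, pres_of H0 HE H3, H8, H4, H3, H1),
    (pres_of H2 H2 H0, pres_of H4 H1 H0, H8, H4, H1, H2),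
    (pres_of H2 H3 H0, pres_of H4 H1 H0, H8, H4, H1, H3),
    (pres_of H2 H6 H3, pres_of H0 HE H3, H4, H8, H3, H1),
    (pres_of H2 H7 H3, pres_of H0 HE H3, H4, H8, H2, H1),
    (pres_of H2 HA H0, pres_of H4 H9 H0, H4, HC, H1, H2),
    (pres_of H2 HB H0, pres_of H4 H9 H0, H4, HC, H1, H3),
    (pres_of H2 HE H3, pres_of H2 HE H3, H4, H8, H3, H1),
    (pres_of H2 HF H3, pres_of H2 HE H3, H4, H8, H2, H1),
    (pres_of H5 H2 H0, pres_of H0 HC H1, H1, H4, H8, H2),
    (pres_of H5 H3 H0, pres_of H4 H9 H0, H4, HC, H2, H3),
    (pres_of H5 HA H0, pres_of H4 H9 H0, H4, H8, H3, H2),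
    (pres_of H5 HB H0, pres_of H4 H9 H0, H8, H4, H2, H3),
    (pres_of H7 H2 H0, pres_of H4 H9 H0, H8, H4, H3, H2),
    (pres_of H7 H3 H0, pres_of H4 H9 H0, H4, H8, H2, H3),
    (pres_of H7 HA H0, pres_of H4 H9 H0, H4, HC, H3, H2),
    (pres_of H7 HB H0, pres_of H0 HC H1, H1, H4, H8, H3)]"

text \<open>The partial transversals below and the characters in \<open>characters8\<close> were found by computer search.\<close>

definition transversals16 :: "(pres \<times> (hex \<times> hex) list list) list" where
  "transversals16 = [
   (pres_of H0 H0 H1, [
     [(H8,H7), (H9,H2), (HA,H0), (HB,H4), (HC,H1), (HD,H5), (HE,H6), (HF,H3)],
     [(H0,HB), (H1,HF), (H2,H0), (H3,HD), (H4,H4), (H5,H1), (HA,HE), (HB,HA), (HE,H5), (HF,H8)],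
     [(H2,H3), (H4,H8), (H6,H4), (H7,H9), (H8,HA), (H9,H6), (HA,HC), (HB,H1), (HD,H0), (HE,H7), (HF,H5)],
     [(H0,HC), (H1,HF), (H2,H4), (H3,HB), (H4,H5), (H5,H8), (H9,H2), (HA,H3), (HB,H9), (HC,HA), (HD,HD),
      (HF,H0)],
     [(H0,H8), (H1,H3), (H2,HD), (H3,HA), (H4,H7), (H5,HF), (H6,HC), (H7,H2), (HA,H6), (HB,HE), (HD,H1),
      (HE,H9), (HF,H0)],
     [(H0,HD), (H1,HB), (H2,H7), (H3,H5), (H4,H8), (H6,H4), (H8,HA), (H9,H0), (HA,HE), (HB,H3), (HC,H2),
      (HD,H6), (HE,HF), (HF,H9)],
     [(H0,HF), (H1,H0), (H2,H7), (H4,H1), (H5,H9), (H6,H8), (H7,HC), (H8,H5), (H9,HA), (HA,H3), (HB,HD),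
      (HC,HE), (HD,HB), (HE,H4), (HF,H6)],
     [(H0,H8), (H1,HE), (H2,H4), (H3,HF), (H4,H6), (H5,H9), (H6,H2), (H7,H5), (H8,H3), (H9,HC), (HA,HA),
      (HB,H1), (HC,HD), (HD,HB), (HE,H0), (HF,H7)]]),
   (pres_of H0 H1 H3, [
     [(H0,HD), (H1,H3), (H6,HA), (H7,H5), (H8,H2), (H9,HC), (HE,H4), (HF,HB)],
     [(H2,HD), (H3,HF), (H4,HB), (H5,H2), (H8,HE), (H9,H4), (HA,H3), (HB,HA), (HC,HC), (HD,H5)],
     [(H0,HE), (H1,H2), (H2,H6), (H4,H5), (H6,HF), (H7,H8), (HA,H1), (HC,HD), (HD,H4), (HE,H3), (HF,HC)],
     [(H0,HA), (H2,HE), (H3,H1), (H4,H8), (H5,H2), (H6,H6), (H7,H5), (HA,HC), (HB,HF), (HC,H7), (HD,H9),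
      (HF,H0)],
     [(H0,H9), (H1,HA), (H2,HD), (H3,HE), (H4,H6), (H5,H3), (H6,H1), (H8,H0), (HA,H7), (HC,H2), (HD,HC),
      (HE,H5), (HF,HF)],
     [(H0,H9), (H1,HE), (H2,H3), (H3,H4), (H4,H0), (H5,H2), (H6,HC), (H7,H5), (H8,H8), (H9,HB), (HA,H6),
      (HB,H1), (HE,H7), (HF,HA)],
     [(H0,H0), (H1,HD), (H2,HC), (H3,HE), (H5,H2), (H6,H3), (H7,H4), (H8,H9), (H9,HA), (HA,H1), (HB,HF),
      (HC,H5), (HD,H7), (HE,H8), (HF,H6)],
     [(H0,HA), (H1,HC), (H2,H8), (H3,H3), (H4,H6), (H5,H4), (H6,HE), (H7,H5), (H8,HF), (H9,H7), (HA,H2),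
      (HB,HD), (HC,H9), (HD,H1), (HE,HB), (HF,H0)]]),
   (pres_of H0 HC H1, [
     [(H2,H3), (H3,H9), (H6,HD), (H7,H7), (H8,H6), (H9,HC), (HC,H8), (HD,H2)],
     [(H0,H6), (H1,H9), (H2,H0), (H3,H5), (H5,HA), (H8,H1), (HC,H7), (HD,H8), (HE,HB), (HF,H4)],
     [(H0,HF), (H1,H9), (H2,H3), (H3,HE), (H5,H7), (H6,HB), (H7,HC), (HA,H2), (HB,H4), (HD,H8), (HF,HA)],
     [(H0,H8), (H2,H3), (H3,H9), (H4,H2), (H5,HF), (H8,H4), (H9,HB), (HA,HC), (HB,H5), (HC,H1), (HE,HE),
      (HF,HA)],
     [(H0,H7), (H1,H8), (H3,HC), (H4,HE), (H7,H1), (H8,HA), (H9,HD), (HA,H3), (HB,HB), (HC,H9), (HD,HF),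
      (HE,H4), (HF,H2)],
     [(H1,H4), (H2,HC), (H3,H0), (H4,H5), (H5,HB), (H6,H6), (H7,HF), (H8,H3), (H9,H1), (HB,HD), (HC,H7),
      (HD,HE), (HE,H2), (HF,HA)],
     [(H0,H7), (H1,H3), (H2,HF), (H3,HB), (H5,HE), (H6,H6), (H7,H4), (H8,H8), (H9,HC), (HA,HD), (HB,H2),
      (HC,H0), (HD,H9), (HE,H5), (HF,H1)],
     [(H0,HC), (H1,H8), (H2,HB), (H3,H4), (H4,H7), (H5,H0), (H6,H1), (H7,H9), (H8,H2), (H9,HA), (HA,HE),
      (HB,H5), (HC,H6), (HD,HD), (HE,HF), (HF,H3)]]),
   (pres_of H4 H1 H0, [
     [(H0,H6), (H1,H0), (H2,H1), (H3,H7), (H4,H3), (H5,H5), (H6,H4), (H7,H2)],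
     [(H0,H5), (H2,H8), (H8,H3), (H9,H7), (HA,H2), (HB,H6), (HC,H0), (HD,H4), (HE,H1), (HF,HC)],
     [(H0,H2), (H2,H3), (H3,HF), (H4,H4), (H7,H9), (H8,HC), (H9,H0), (HC,H1), (HD,HD), (HE,HA), (HF,H5)],
     [(H1,H5), (H3,HC), (H4,H6), (H5,H9), (H6,HF), (H7,H2), (H8,HA), (H9,H8), (HA,H4), (HB,H7), (HE,HB),
      (HF,HD)],
     [(H1,H9), (H2,H3), (H3,H5), (H4,H8), (H5,H2), (H6,HB), (H7,H4), (H9,H6), (HA,H1), (HB,HD), (HC,HA),
      (HD,HE), (HE,HF)],
     [(H1,HA), (H2,H7), (H4,H6), (H5,H4), (H6,HE), (H7,HC), (H8,H0), (H9,H5), (HA,HF), (HB,HD), (HC,H9),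
      (HD,H3), (HE,H1), (HF,H2)],
     [(H0,H0), (H1,H6), (H2,HB), (H3,H1), (H4,HA), (H5,HC), (H6,HD), (H7,H3), (H9,H4), (HA,H9), (HB,H7),
      (HC,H2), (HD,H8), (HE,H5), (HF,HF)],
     [(H0,H6), (H1,H5), (H2,H3), (H3,H0), (H4,HB), (H5,HC), (H6,HA), (H7,HF), (H8,H2), (H9,HE), (HA,H8),
      (HB,H7), (HC,HD), (HD,H9), (HE,H1), (HF,H4)]]),
   (pres_of H4 H5 H0, [
     [(H8,HB), (H9,H9), (HA,HD), (HB,HE), (HC,H8), (HD,HA), (HE,HF), (HF,HC)],
     [(H0,HA), (H1,H3), (H2,H2), (H3,HB), (H8,H0), (H9,H5), (HA,H1), (HB,H8), (HC,HC), (HE,H9)],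
     [(H0,H9), (H1,H2), (H2,H6), (H3,H4), (H4,H0), (H5,H3), (H7,HC), (H9,HA), (HA,H5), (HC,H1), (HE,HE)],
     [(H0,HD), (H1,H2), (H2,HF), (H3,HC), (H7,H1), (H9,H3), (HA,HB), (HB,H9), (HC,HE), (HD,HA), (HE,H0),
      (HF,H4)],
     [(H0,H6), (H1,H8), (H4,H1), (H6,H7), (H7,HC), (H8,HD), (H9,H4), (HA,HA), (HB,H0), (HC,H3), (HD,H5),
      (HE,HE), (HF,H2)],
     [(H0,HA), (H1,H8), (H2,HB), (H3,H0), (H4,H3), (H5,H4), (H6,H9), (H7,H1), (H8,HE), (H9,H2), (HA,H5),
      (HB,H6), (HC,HD), (HD,HF)],
     [(H0,H4), (H1,H1), (H2,HF), (H3,H7), (H4,HD), (H5,HE), (H6,H0), (H8,H8), (H9,HB), (HA,H5), (HB,H3),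
      (HC,HC), (HD,H6), (HE,H2), (HF,HA)],
     [(H0,HF), (H1,HA), (H2,HC), (H3,H5), (H4,H8), (H5,H2), (H6,H4), (H7,H3), (H8,H9), (H9,H1), (HA,H0),
      (HB,H6), (HC,HE), (HD,HB), (HE,HD), (HF,H7)]]),
   (pres_of H4 H9 H0, [
     [(H4,H6), (H5,H5), (H6,HF), (H7,HC), (HC,HE), (HD,HD), (HE,H7), (HF,H4)],
     [(H0,HF), (H1,H9), (H2,HC), (H3,HA), (H4,H4), (H5,HE), (H6,HB), (H7,HD), (HA,H7), (HF,H8)],
     [(H0,H2), (H2,H4), (H4,HE), (H5,HB), (H6,H7), (H7,HF), (H9,H8), (HA,HD), (HD,H0), (HE,H6), (HF,H5)],
     [(H1,H6), (H3,HE), (H4,H4), (H5,HA), (H6,H2), (H7,HF), (H8,H1), (H9,HD), (HA,H0), (HB,HC), (HC,H3),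
      (HD,H7)],
     [(H0,H6), (H1,H4), (H2,H1), (H3,H2), (H5,HC), (H6,H9), (H7,HA), (H8,H0), (H9,H3), (HA,H7), (HB,HB),
      (HD,HF), (HF,H8)],
     [(H0,HE), (H1,H4), (H2,H5), (H3,H2), (H4,HC), (H5,H8), (H6,HF), (H7,HB), (H8,H7), (H9,HD), (HA,H0),
      (HB,HA), (HC,H6), (HE,H9)],
     [(H0,H9), (H1,HF), (H2,H6), (H3,HC), (H5,H2), (H6,HD), (H7,H7), (H8,HA), (H9,H4), (HA,HB), (HB,H1),
      (HC,H5), (HD,H8), (HE,HE), (HF,H3)],
     [(H0,H9), (H1,H7), (H2,H8), (H3,H0), (H4,H4), (H5,HB), (H6,HA), (H7,H3), (H8,H6), (H9,H1), (HA,HD),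
      (HB,HE), (HC,HC), (HD,HF), (HE,H2), (HF,H5)]]),
   (pres_of H0 H6 H3, [
     [(H4,H0), (H5,HA), (H6,HB), (H7,H1), (HC,H9), (HD,H3), (HE,H2), (HF,H8)],
     [(H1,H0), (H4,HA), (H8,H6), (H9,H2), (HA,H4), (HB,H3), (HC,HE), (HD,H1), (HE,H5), (HF,H7)],
     [(H1,H6), (H2,HC), (H4,H7), (H5,HF), (H6,HB), (H8,H2), (H9,H9), (HA,HE), (HB,HA), (HC,H1), (HE,H4)],
     [(H1,H2), (H2,HD), (H4,H1), (H5,HC), (H6,H8), (H7,H4), (H8,H0), (H9,HE), (HA,HB), (HD,H9), (HE,H7),
      (HF,H3)],
     [(H0,HD), (H1,HE), (H2,H1), (H3,H5), (H4,H8), (H6,H6), (H8,H2), (HA,HF), (HB,H3), (HC,H0), (HD,HC),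
      (HE,H4), (HF,H7)],
     [(H0,H5), (H1,HA), (H2,HC), (H3,H2), (H4,H7), (H6,HE), (H8,H9), (H9,H4), (HA,HF), (HB,H3), (HC,HD),
      (HD,H1), (HE,HB), (HF,H0)],
     [(H0,H7), (H2,HB), (H3,H2), (H4,H9), (H5,H4), (H6,H5), (H7,HE), (H8,H0), (H9,H3), (HA,HF), (HB,H6),
      (HC,HC), (HD,H1), (HE,HA), (HF,H8)],
     [(H0,H1), (H1,H7), (H2,HA), (H3,HF), (H4,H0), (H5,HE), (H6,H6), (H7,HB), (H8,HD), (H9,H2), (HA,H8),
      (HB,H5), (HC,H9), (HD,HC), (HE,H3), (HF,H4)]]),
   (pres_of H0 HE H3, [
     [(H4,HE), (H5,H5), (H6,H7), (H7,HC), (HC,H6), (HD,HD), (HE,H4), (HF,HF)],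
     [(H0,H6), (H1,HB), (H2,H4), (H3,H2), (H7,HF), (HA,H8), (HC,H5), (HD,HA), (HE,H9), (HF,H7)],
     [(H0,HE), (H2,HD), (H3,H4), (H4,H5), (H5,H0), (H7,HF), (HA,H8), (HB,H1), (HC,HC), (HE,H6), (HF,H9)],
     [(H1,HD), (H2,H0), (H3,H8), (H6,H2), (H8,H3), (H9,H6), (HA,HA), (HB,H4), (HC,H1), (HD,H5), (HE,H7),
      (HF,HB)],
     [(H0,H9), (H2,H6), (H3,H5), (H4,HF), (H7,H4), (H8,H2), (H9,HC), (HA,HA), (HB,HD), (HC,H0), (HD,H7),
      (HE,H1), (HF,H3)],
     [(H1,HB), (H2,HD), (H3,H2), (H5,H0), (H6,H9), (H7,H1), (H8,H3), (H9,HE), (HA,H5), (HB,H7), (HC,H4),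
      (HD,HF), (HE,H8), (HF,H6)],
     [(H0,H4), (H1,H7), (H2,H3), (H3,HE), (H4,HA), (H5,HF), (H6,H5), (H7,HC), (H8,HD), (H9,H8), (HA,H9),
      (HC,H2), (HD,H6), (HE,HB), (HF,H0)],
     [(H0,H0), (H1,HC), (H2,H5), (H3,HD), (H4,H6), (H5,HA), (H6,HB), (H7,H3), (H8,H1), (H9,H8), (HA,HF),
      (HB,H2), (HC,H9), (HD,H7), (HE,H4), (HF,HE)]]),
   (pres_of H2 HE H3, [
     [(H0,H1), (H1,H6), (H2,H5), (H3,H2), (H4,H0), (H5,H7), (H6,H4), (H7,H3)],
     [(H0,HB), (H1,HE), (H2,HF), (H3,HA), (H4,HC), (H5,H0), (H6,HD), (H7,H8), (H8,H6), (HC,H9)],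
     [(H0,H3), (H1,H6), (H4,HE), (H5,H9), (H6,HB), (H8,H2), (H9,HA), (HB,HC), (HC,HF), (HD,H7), (HF,H8)],
     [(H0,H3), (H1,H1), (H2,H0), (H3,HE), (H4,HC), (H5,H9), (H7,H8), (H9,HD), (HC,HF), (HD,H2), (HE,H5),
      (HF,H6)],
     [(H0,HC), (H1,H6), (H2,H3), (H3,HF), (H7,HE), (H8,H7), (H9,H0), (HA,HD), (HB,H9), (HC,HB), (HD,H4),
      (HE,H5), (HF,H1)],
     [(H0,H0), (H1,H4), (H3,H1), (H4,HC), (H5,HE), (H6,H5), (H7,HA), (H8,HF), (HA,H7), (HB,HB), (HC,H2),
      (HD,H9), (HE,H3), (HF,H8)],
     [(H0,H7), (H1,H3), (H2,H8), (H3,HC), (H4,H0), (H5,HF), (H6,HA), (H7,H1), (H8,H5), (H9,H9), (HA,H6),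
      (HB,H2), (HC,HB), (HD,HD), (HE,H4)],
     [(H0,HC), (H1,H0), (H2,H9), (H3,H6), (H4,H7), (H5,H1), (H6,HB), (H7,HF), (H8,H5), (H9,H8), (HA,HD),
      (HB,H2), (HC,H4), (HD,H3), (HE,HA), (HF,HE)]])]"

text \<open>Exhaustive over the 16 choices of the bits x, y, s, u.\<close>

lemma regenerate8: "list_all (\<lambda>h. inconsistent (pres8 (bits_of h)) \<or>
    list_ex (\<lambda>(h', k, w1, w2, w3). h' = h \<and> k \<in> set groups8 \<and>
      regenerates even_bits (pres8 (bits_of h)) (pres8 (bits_of k)) (bits_of w1) (bits_of w2) (bits_of w3) (bits_of H0)) changes8)
    all_hex"
  by code_simp

text \<open>The 64 ways of attaching a factor 1 or z to each of the six relations of a group of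
  order 8.\<close>

definition extensions8 :: "hex \<Rightarrow> pres list" where
  "extensions8 h = (case bits_of h of (x, y, s, u) \<Rightarrow>
     concat (map (\<lambda>k. map (\<lambda>l. case (bits_of k, bits_of l) of
       ((w, t, p, v), (i, j, _, _)) \<Rightarrow> (x, y, w, s, t, p, u, v, i, j)) [H0, H4, H8, HC]) all_hex))"

definition commuting :: "pres \<Rightarrow> bool" where
  "commuting = (\<lambda>(x, y, w, s, t, p, u, v, i, j). \<not> u \<and> \<not> v \<and> \<not> i \<and> \<not> j)"

text \<open>Consistent presentations without commutator bits describe abelian groups and can be set
  aside in the search for the non-abelian ones.\<close>

lemma commuting_mul: "list_all (\<lambda>h. list_all (\<lambda>P. commuting P \<longrightarrow> inconsistent P \<or>
    list_all (\<lambda>a. list_all (\<lambda>b. mul P a b = mul P b a) all_bits) all_bits) (extensions8 h)) groups8"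
  by code_simp

text \<open>Exhaustive over 5 times 64 presentations. Only the fact that the nine listed
  presentations cover all cases is used later, not that they are pairwise inequivalent.\<close>

lemma regenerate16: "list_all (\<lambda>h. list_all (\<lambda>P. inconsistent P \<or> commuting P \<or>
    list_ex (\<lambda>(P0, P', w1, w2, w3, w4). P0 = P \<and> P' \<in> set groups16 \<and>
      regenerates all_bits P P' (bits_of w1) (bits_of w2) (bits_of w3) (bits_of w4)) changes16)
    (extensions8 h)) groups8"
  by code_simp

text \<open>Only the cells are listed; the symbols are recomputed from \<open>m\<close>. When
  \<open>es\<close> lists the entire group, the last clause expresses maximality: a cell in a free
  row and a free column carries a symbol already taken.\<close>

definition maximal_witness :: "'e list \<Rightarrow> ('e \<Rightarrow> 'e \<Rightarrow> 'e) \<Rightarrow> ('e \<times> 'e) list \<Rightarrow> bool" where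
  "maximal_witness es m T \<longleftrightarrow>
     (let rs = map fst T; cs = map snd T; ss = map (\<lambda>(r, c). m r c) T in
      distinct rs \<and> distinct cs \<and> distinct ss \<and> set rs \<subseteq> set es \<and> set cs \<subseteq> set es \<and>
      list_all (\<lambda>r. r \<in> set rs \<or> list_all (\<lambda>c. c \<in> set cs \<or> m r c \<in> set ss) es) es)"

lemma transversals16_maximal:
  "list_all (\<lambda>(P, Ts). map length Ts = [8, 10, 11, 12, 13, 14, 15, 16] \<and>
     list_all (\<lambda>T. maximal_witness all_bits (mul P) (map (\<lambda>(r, c). (bits_of r, bits_of c)) T)) Ts) transversals16"
  "map fst transversals16 = groups16"
  by code_simp+

lemma all_bits_set: "set all_bits = UNIV"
proof -
  have "(a, b, c, d) \<in> set all_bits" for a b c d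
    by (cases a; cases b; cases c; cases d) (simp_all add: all_bits_def all_hex_def)
  then show ?thesis
    by auto
qed

lemma even_bits_set: "set even_bits = {(a, b, c, d). \<not> d \<and> (a, b, c) \<in> UNIV}"
proof -
  have "(a, b, c, d) \<in> set even_bits \<longleftrightarrow> \<not> d" for a b c d
    by (cases a; cases b; cases c; cases d) (simp_all add: even_bits_def)
  then show ?thesis
    by auto
qed

lemma distinct_all_bits: "distinct all_bits" "distinct even_bits"
  by code_simp+

lemma hex_cases: "h \<in> set all_hex"
  by (cases h) (simp_all add: all_hex_def)

lemma bits_of_surj: "\<exists>h. e = bits_of h"
  using all_bits_set unfolding all_bits_def by (metis UNIV_I image_iff list.set_map)

context finite_group
begin

lemma pc_group_inconsistent:
  assumes "pc_group E P g1 g2 g3 g4" "inconsistent P" "\<And>e f. e \<in> E \<Longrightarrow> f \<in> E \<Longrightarrow> mul P e f \<in> E"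
    "bits_of H8 \<in> E" "bits_of H4 \<in> E"
  shows False
proof -
  let ?\<phi> = "word (\<otimes>) \<one> g1 g2 g3 g4"
  have closed: "?\<phi> e \<in> carrier G" for e
    using assms(1) by (auto simp: pc_group_def)
  obtain a b c where abc: "{a, b, c} \<subseteq> {H4, H8}" and ne:
    "mul P (mul P (bits_of a) (bits_of b)) (bits_of c) \<noteq> mul P (bits_of a) (mul P (bits_of b) (bits_of c))"
    using assms(2) by (fastforce simp: inconsistent_def simp del: mul.simps bits_of.simps)
  have "bits_of a \<in> E" "bits_of b \<in> E" "bits_of c \<in> E"
    using abc assms(4,5) by blast+
  moreover have "?\<phi> (mul P (mul P (bits_of a) (bits_of b)) (bits_of c)) = ?\<phi> (mul P (bits_of a) (mul P (bits_of b) (bits_of c)))"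
    using pc_group_mul[OF assms(1)] closed by (metis m_assoc)
  moreover have "inj_on ?\<phi> E"
    using assms(1) by (auto simp: pc_group_def bij_betw_def)
  ultimately show False
    using ne assms(3) by (metis inj_onD)
qed

text \<open>The word map in the new generators is the old word map composed with the substitution on
  exponent vectors, and the certificate makes the latter a permutation of \<open>es\<close>.\<close>

lemma regenerated_pc_group:
  assumes pc: "pc_group (set es) P g1 g2 g3 g4" and re: "regenerates es P P' w1 w2 w3 w4"
    and es: "distinct es"
  defines "\<phi> \<equiv> word (\<otimes>) \<one> g1 g2 g3 g4"
  shows "pc_group (set es) P' (\<phi> w1) (\<phi> w2) (\<phi> w3) (\<phi> w4)"
proof -
  have g: "g1 \<in> carrier G" "g2 \<in> carrier G" "g3 \<in> carrier G" "g4 \<in> carrier G"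
    using pc by (auto simp: pc_group_def)
  have closed: "\<phi> e \<in> carrier G" for e
    using g by (simp add: \<phi>_def)
  have hom: "\<phi> (mul P e f) = \<phi> e \<otimes> \<phi> f" for e f
    using pc_group_mul[OF pc] by (simp add: \<phi>_def)
  have one: "\<phi> (bits_of H0) = \<one>"
    by (simp add: \<phi>_def pw_def)
  have pw: "\<phi> (pw (bits_of H0) w b) = pw \<one> (\<phi> w) b" for w b
    using one by (simp add: pw_def)
  have word: "\<phi> (word (mul P) (bits_of H0) w1 w2 w3 w4 e) = word (\<otimes>) \<one> (\<phi> w1) (\<phi> w2) (\<phi> w3) (\<phi> w4) e" for e
    by (cases e) (simp add: hom pw del: mul.simps bits_of.simps)
  have "rel (\<otimes>) \<one> P' (\<phi> w1) (\<phi> w2) (\<phi> w3) (\<phi> w4)"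
  proof -
    obtain x y w s t p u v i j where P': "P' = (x, y, w, s, t, p, u, v, i, j)"
      by (metis surj_pair)
    have "rel (mul P) (bits_of H0) P' w1 w2 w3 w4"
      using re by (simp add: regenerates_def)
    then show ?thesis
      unfolding P' rel.simps
      by (simp add: hom[symmetric] pw[symmetric] one del: bits_of.simps mul.simps)
  qed
  moreover have "bij_betw (word (\<otimes>) \<one> (\<phi> w1) (\<phi> w2) (\<phi> w3) (\<phi> w4)) (set es) (carrier G)"
  proof -
    let ?f = "word (mul P) (bits_of H0) w1 w2 w3 w4"
    have f: "distinct (map ?f es)" "?f ` set es \<subseteq> set es"
      using re by (auto simp: regenerates_def Let_def list_all_iff simp del: bits_of.simps)
    then have "bij_betw ?f (set es) (set es)"
      using endo_inj_surj[of "set es" ?f] by (auto simp: distinct_map bij_betw_def)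
    moreover have "bij_betw \<phi> (set es) (carrier G)"
      using pc by (simp add: pc_group_def \<phi>_def)
    ultimately have "bij_betw (\<phi> \<circ> ?f) (set es) (carrier G)"
      by (rule bij_betw_trans)
    then show ?thesis
      by (simp only: o_def word)
  qed
  ultimately show ?thesis
    using closed by (simp add: pc_group_def)
qed

end

lemma even_bits_closed:
  "e \<in> set even_bits \<Longrightarrow> f \<in> set even_bits \<Longrightarrow> mul (pres8 P) e f \<in> set even_bits"
  unfolding even_bits_set
  by (cases P; cases e; cases f) (simp add: pres8_def ap_def)

lemma pc_group_groups8:
  fixes G (structure)
  assumes "finite_group G" "order G = 8"
  shows "\<exists>k\<in>set groups8. \<exists>g1 g2 g3. finite_group.pc_group G (set even_bits) (pres8 (bits_of k)) g1 g2 g3 \<one>"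
proof -
  interpret finite_group G
    by fact
  obtain x y s u g1 g2 g3 where pc: "pc_group (set even_bits)
      (x, y, False, s, False, False, u, False, False, False) g1 g2 g3 \<one>"
    using pc_group_order8[OF assms] unfolding even_bits_set by blast
  obtain h where h: "(x, y, s, u) = bits_of h"
    using bits_of_surj by metis
  have pc: "pc_group (set even_bits) (pres8 (bits_of h)) g1 g2 g3 \<one>"
    using pc by (simp add: h[symmetric] pres8_def)
  have "\<not> inconsistent (pres8 (bits_of h))"
    using pc_group_inconsistent[OF pc _ even_bits_closed] by (auto simp: even_bits_def)
  then obtain k w1 w2 w3 where k: "k \<in> set groups8" and re:
    "regenerates even_bits (pres8 (bits_of h)) (pres8 (bits_of k)) (bits_of w1) (bits_of w2) (bits_of w3) (bits_of H0)"
    using regenerate8 hex_cases[of h] unfolding list_all_iff list_ex_iff by auto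
  have "word (\<otimes>) \<one> g1 g2 g3 \<one> (bits_of H0) = \<one>"
    by (simp add: pw_def)
  then show ?thesis
    using regenerated_pc_group[OF pc re distinct_all_bits(2)] k by auto
qed

text \<open>The quotient by a central involution has order 8 and takes one of five standard
  presentations, so G has one of the enumerated extensions. The tables then discard the inconsistent
  and the abelian ones and standardise the rest.\<close>

lemma pc_group_groups16:
  fixes G (structure)
  assumes "finite_group G" "order G = 16" "\<not> comm_group G"
  shows "\<exists>P\<in>set groups16. \<exists>g1 g2 g3 g4. finite_group.pc_group G UNIV P g1 g2 g3 g4"
proof -
  interpret finite_group G
    by fact
  have "order G = 2 ^ 4"
    using assms(2) by simp
  then obtain z where z: "z \<in> carrier G" "z \<noteq> \<one>" "z \<otimes> z = \<one>" "\<And>x. x \<in> carrier G \<Longrightarrow> z \<otimes> x = x \<otimes> z"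
    using central_involution[OF _ zero_less_numeral] by metis
  note cq = central_quotient[OF z]
  have "order (G Mod {\<one>, z}) = 8"
    using cq(3) assms(2) by simp
  then obtain k h1 h2 h3 where k: "k \<in> set groups8" and
    "finite_group.pc_group (G Mod {\<one>, z}) (set even_bits) (pres8 (bits_of k)) h1 h2 h3 \<one>\<^bsub>G Mod {\<one>, z}\<^esub>"
    using pc_group_groups8[OF cq(2)] by blast
  moreover obtain x y s u where xysu: "bits_of k = (x, y, s, u)"
    by (metis surj_pair)
  ultimately have Q: "finite_group.pc_group (G Mod {\<one>, z}) {(a, b, c, d). \<not> d \<and> (a, b, c) \<in> UNIV}
     (x, y, False, s, False, False, u, False, False, False) h1 h2 h3 \<one>\<^bsub>G Mod {\<one>, z}\<^esub>"
    by (simp only: even_bits_set pres8_def prod.case)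
  obtain w t p v i j g1 g2 g3 where
    *: "pc_group {(a, b, c, d). (a, b, c) \<in> UNIV} (x, y, w, s, t, p, u, v, i, j) g1 g2 g3 z"
    using pc_group_lift[OF z Q] by metis
  let ?P = "(x, y, w, s, t, p, u, v, i, j)"
  have pc: "pc_group (set all_bits) ?P g1 g2 g3 z"
    using * by (simp add: all_bits_set case_prod_unfold)
  have P: "?P \<in> set (extensions8 k)"
  proof -
    obtain h where h: "(w, t, p, v) = bits_of h"
      using bits_of_surj by metis
    have "\<exists>l\<in>{H0, H4, H8, HC}. bits_of l = (i, j, False, False)"
      by (cases i; cases j) simp_all
    then obtain l where l: "l \<in> {H0, H4, H8, HC}" "bits_of l = (i, j, False, False)"
      by blast
    have concat: "e \<in> set (concat (map f hs))" if "e \<in> set (f h)" "h \<in> set hs" for e h hs and f :: "hex \<Rightarrow> pres list"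
      using that by auto
    have "?P \<in> set (map (\<lambda>l. case (bits_of h, bits_of l) of
       ((w, t, p, v), (i, j, _, _)) \<Rightarrow> (x, y, w, s, t, p, u, v, i, j)) [H0, H4, H8, HC])"
      unfolding set_map by (rule image_eqI[of _ _ l]) (use h l in \<open>simp_all flip: h del: bits_of.simps\<close>)
    then show ?thesis
      unfolding extensions8_def xysu prod.case by (rule concat[OF _ hex_cases])
  qed
  have cons: "\<not> inconsistent ?P"
    using pc_group_inconsistent[OF pc] all_bits_set by auto
  have "\<not> commuting ?P"
  proof
    assume "commuting ?P"
    then have comm: "mul ?P a b = mul ?P b a" for a b
      using commuting_mul k P cons all_bits_set unfolding list_all_iff by blast
    have "x \<otimes> y = y \<otimes> x" if "x \<in> carrier G" "y \<in> carrier G" for x y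
    proof -
      let ?\<phi> = "word (\<otimes>) \<one> g1 g2 g3 z"
      have "?\<phi> ` set all_bits = carrier G"
        using pc unfolding pc_group_def bij_betw_def by blast
      then have "x \<in> ?\<phi> ` set all_bits" "y \<in> ?\<phi> ` set all_bits"
        using that by simp_all
      then obtain e f where ef: "x = ?\<phi> e" "y = ?\<phi> f"
        by (elim imageE)
      show ?thesis
        unfolding ef pc_group_mul[OF pc] comm[of e f] ..
    qed
    then show False
      using assms(3) group_comm_groupI by blast
  qed
  then obtain P' w1 w2 w3 w4 where "P' \<in> set groups16"
    "regenerates all_bits ?P P' (bits_of w1) (bits_of w2) (bits_of w3) (bits_of w4)"
    using regenerate16 k P cons unfolding list_all_iff list_ex_iff by fastforce
  then show ?thesis
    using regenerated_pc_group[OF pc _ distinct_all_bits(1)] unfolding all_bits_set by blast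
qed

text \<open>A larger partial transversal would contain a further cell. By the last clause of the
  witness that cell shares its row, column or symbol with a cell of \<open>T\<close>, and
  injectivity makes the two equal.\<close>

lemma (in finite_group) has_maximal_of_witness:
  assumes bij: "bij_betw \<phi> (set es) (carrier G)"
    and hom: "\<And>x y. x \<in> set es \<Longrightarrow> y \<in> set es \<Longrightarrow> m x y \<in> set es \<and> \<phi> x \<otimes> \<phi> y = \<phi> (m x y)"
    and wit: "maximal_witness es m T"
  shows "has_maximal_of_length (cayley_table G) (length T)"
proof -
  note w = wit[unfolded maximal_witness_def Let_def list_all_iff]
  have inj: "inj_on \<phi> (set es)" and im: "\<phi> ` set es = carrier G"
    using bij by (auto simp: bij_betw_def)
  define t where "t = (\<lambda>(r, c). (\<phi> r, \<phi> c, \<phi> (m r c)))"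
  have "fst ` set T \<subseteq> set es" "snd ` set T \<subseteq> set es"
    using w by (simp_all only: set_map)
  then have mem: "r \<in> set es" "c \<in> set es" "m r c \<in> set es" if "(r, c) \<in> set T" for r c
    using that hom by force+
  have memp: "fst p \<in> set es" "snd p \<in> set es" "m (fst p) (snd p) \<in> set es" if "p \<in> set T" for p
    using mem[of "fst p" "snd p"] that by simp_all
  have dist: "distinct T"
    using w by (simp add: distinct_map)
  have inj_row: "inj_on fst (set T)" and inj_col: "inj_on snd (set T)" and inj_sym: "inj_on (\<lambda>(r, c). m r c) (set T)"
    using w by (simp_all add: distinct_map)
  have proj: "inj_on (\<lambda>(r, c, s). r) (t ` set T)" "inj_on (\<lambda>(r, c, s). c) (t ` set T)" "inj_on (\<lambda>(r, c, s). s) (t ` set T)"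
  proof -
    have 1: "p = q" if "p \<in> set T" "q \<in> set T" "\<phi> (fst p) = \<phi> (fst q)" for p q
      using that inj_onD[OF inj that(3)] inj_onD[OF inj_row] memp by blast
    have 2: "p = q" if "p \<in> set T" "q \<in> set T" "\<phi> (snd p) = \<phi> (snd q)" for p q
      using that inj_onD[OF inj that(3)] inj_onD[OF inj_col] memp by blast
    have 3: "p = q" if "p \<in> set T" "q \<in> set T" "\<phi> (m (fst p) (snd p)) = \<phi> (m (fst q) (snd q))" for p q
      using that inj_onD[OF inj that(3)] inj_onD[OF inj_sym, of p q] memp by (simp add: case_prod_unfold)
    show "inj_on (\<lambda>(r, c, s). r) (t ` set T)" "inj_on (\<lambda>(r, c, s). c) (t ` set T)" "inj_on (\<lambda>(r, c, s). s) (t ` set T)"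
      unfolding inj_on_def t_def case_prod_unfold ball_simps(9) fst_conv snd_conv
      using 1 2 3 by (metis (no_types))+
  qed
  have sub: "t ` set T \<subseteq> cayley_table G"
  proof -
    have "\<phi> x \<in> carrier G" if "x \<in> set es" for x
      using that im by blast
    then show ?thesis
      using mem hom by (auto simp: t_def cayley_table_def)
  qed
  have pt: "partial_transversal (cayley_table G) (t ` set T)"
    unfolding partial_transversal_def using sub proj by blast
  have "inj_on t (set T)"
  proof (rule inj_onI)
    fix p q
    assume pq: "p \<in> set T" "q \<in> set T" "t p = t q"
    then have "\<phi> (fst p) = \<phi> (fst q)" "\<phi> (snd p) = \<phi> (snd q)"
      by (auto simp: t_def case_prod_unfold)
    then show "p = q"
      using inj_onD[OF inj] memp pq(1,2) by (metis prod_eq_iff)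
  qed
  then have card: "card (t ` set T) = length T"
    using dist by (simp add: card_image distinct_card)
  have "\<not> (\<exists>T'. partial_transversal (cayley_table G) T' \<and> t ` set T \<subseteq> T' \<and> card (t ` set T) < card T')"
  proof
    assume "\<exists>T'. partial_transversal (cayley_table G) T' \<and> t ` set T \<subseteq> T' \<and> card (t ` set T) < card T'"
    then obtain T' where T': "partial_transversal (cayley_table G) T'" "t ` set T \<subseteq> T'" "card (t ` set T) < card T'"
      by blast
    then obtain k where k: "k \<in> T'" "k \<notin> t ` set T"
      by (metis less_irrefl subset_antisym subsetI)
    obtain g h where gh: "k = (g, h, g \<otimes> h)" "g \<in> carrier G" "h \<in> carrier G"
      using k(1) T'(1) by (auto simp: partial_transversal_def cayley_table_def)
    then obtain r c where rc: "r \<in> set es" "c \<in> set es" "g = \<phi> r" "h = \<phi> c"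
      using im by (metis image_iff)
    have kk: "k = (\<phi> r, \<phi> c, \<phi> (m r c))"
      using gh rc hom by simp
    have inj': "inj_on (\<lambda>(r, c, s). r) T'" "inj_on (\<lambda>(r, c, s). c) T'" "inj_on (\<lambda>(r, c, s). s) T'"
      using T'(1) by (auto simp: partial_transversal_def)
    have T'_eq: "k = t p" if "p \<in> set T" "fst (t p) = fst k \<or> fst (snd (t p)) = fst (snd k) \<or> snd (snd (t p)) = snd (snd k)" for p
    proof -
      have "t p \<in> T'"
        using that(1) T'(2) by blast
      then show ?thesis
        using that(2) inj' k(1) unfolding inj_on_def case_prod_unfold by metis
    qed
    have "r \<notin> set (map fst T)"
    proof
      assume "r \<in> set (map fst T)"
      then obtain c' where "(r, c') \<in> set T"
        by auto
      then show False
        using T'_eq[of "(r, c')"] k(2) kk by (auto simp: t_def)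
    qed
    moreover have "c \<notin> set (map snd T)"
    proof
      assume "c \<in> set (map snd T)"
      then obtain r' where "(r', c) \<in> set T"
        by auto
      then show False
        using T'_eq[of "(r', c)"] k(2) kk by (auto simp: t_def)
    qed
    ultimately have "m r c \<in> set (map (\<lambda>(r, c). m r c) T)"
      using w rc by blast
    then obtain r' c' where "(r', c') \<in> set T" "m r c = m r' c'"
      by auto
    then show False
      using T'_eq[of "(r', c')"] k(2) kk by (auto simp: t_def)
  qed
  then show ?thesis
    unfolding has_maximal_of_length_def maximal_partial_transversal_def using pt card by blast
qed

lemma has_maximal_order16:
  fixes G (structure)
  assumes "finite_group G" "order G = 16" "\<not> comm_group G" "l \<in> {8, 10, 11, 12, 13, 14, 15, 16}"
  shows "has_maximal_of_length (cayley_table G) l"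
proof -
  interpret finite_group G
    by fact
  obtain P g1 g2 g3 g4 where P: "P \<in> set groups16" and pc: "pc_group UNIV P g1 g2 g3 g4"
    using pc_group_groups16[OF assms(1-3)] by blast
  then obtain Ts where "(P, Ts) \<in> set transversals16"
    unfolding transversals16_maximal(2)[symmetric] by auto
  then have Ts: "map length Ts = [8, 10, 11, 12, 13, 14, 15, 16]"
    "\<forall>T\<in>set Ts. maximal_witness all_bits (mul P) (map (\<lambda>(r, c). (bits_of r, bits_of c)) T)"
    using transversals16_maximal(1) unfolding list_all_iff by auto
  have "l \<in> set (map length Ts)"
    unfolding Ts(1) using assms(4) by simp
  then obtain T where T: "T \<in> set Ts" "length T = l"
    by auto
  have "has_maximal_of_length (cayley_table G) (length (map (\<lambda>(r, c). (bits_of r, bits_of c)) T))"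
  proof (rule has_maximal_of_witness)
    show "bij_betw (word (\<otimes>) \<one> g1 g2 g3 g4) (set all_bits) (carrier G)"
      using pc by (simp add: pc_group_def all_bits_set)
    show "mul P e f \<in> set all_bits \<and> word (\<otimes>) \<one> g1 g2 g3 g4 e \<otimes> word (\<otimes>) \<one> g1 g2 g3 g4 f = word (\<otimes>) \<one> g1 g2 g3 g4 (mul P e f)" for e f
      using pc_group_mul[OF pc] by (simp add: all_bits_set)
  qed (use Ts(2) T(1) in blast)
  then show ?thesis
    using T(2) by simp
qed

section \<open>Order 8 and abelian groups\<close>

text \<open>The possible pairs of non-trivial elements of a three-element set that has been
  translated to contain \<one>.\<close>

definition pairs8 :: "bits list list" where
  "pairs8 = filter (\<lambda>l. length l = 2) (subseqs (map bits_of [H2, H4, H6, H8, HA, HC, HE]))"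

text \<open>The parameters are the values at g1, g2 and g3. The values are kept as integers and are
  additive only modulo 4 or 8, so that gap sums can be computed over the integers first.\<close>

fun character8 :: "int \<times> int \<times> int \<Rightarrow> bits \<Rightarrow> int" where
  "character8 (v1, v2, v3) (a, b, c, d) = (if a then v1 else 0) + (if b then v2 else 0) + (if c then v3 else 0)"

definition characters8 :: "(hex \<times> (int \<times> int \<times> int) list) list" where
  "characters8 = [(H0, [(0, 0, 2), (0, 2, 0), (2, 0, 0)]), (H4, [(1, 0, 2), (0, 2, 0)]),
     (H1, [(0, 2, 0), (2, 0, 0)]), (H7, [(0, 2, 0), (2, 0, 0)])]"

text \<open>Every triple \<open>S\<close> disjoint from \<open>A B\<close> violates the sum condition of \<open>transversal_gap_sum\<close> for one of
  the characters \<open>vs\<close>, so \<open>A\<close>, \<open>B\<close>, \<open>S\<close> are not the unused rows, columns and symbols of a maximal partial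
  transversal of length 5.\<close>

definition obstructed8 :: "pres \<Rightarrow> (int \<times> int \<times> int) list \<Rightarrow> bits list \<Rightarrow> bits list \<Rightarrow> bool" where
  "obstructed8 P vs A B \<longleftrightarrow>
     (let AB = concat (map (\<lambda>a. map (mul P a) B) A);
          C = filter (\<lambda>x. x \<notin> set AB) even_bits in
      length C < 3 \<or>
      list_all (\<lambda>S. list_ex (\<lambda>v. (sum_list (map (character8 v) even_bits) + sum_list (map (character8 v) S)
         - sum_list (map (character8 v) A) - sum_list (map (character8 v) B)) mod 4 \<noteq> 0) vs)
        (filter (\<lambda>l. length l = 3) (subseqs C)))"

lemma characters8_hom: "list_all (\<lambda>(h, vs). list_all (\<lambda>v. list_all (\<lambda>e. list_all (\<lambda>f.
    (character8 v (mul (pres8 (bits_of h)) e f) - character8 v e - character8 v f) mod 4 = 0)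
    even_bits) even_bits) vs) characters8"
  by code_simp

definition obstructed_all8 :: "hex \<times> (int \<times> int \<times> int) list \<Rightarrow> bool" where
  "obstructed_all8 = (\<lambda>(h, vs). let ps = pairs8 in list_all (\<lambda>A. list_all (\<lambda>B.
    obstructed8 (pres8 (bits_of h)) vs (bits_of H0 # A) (bits_of H0 # B)) ps) ps)"

lemma obstructed_all8_0: "obstructed_all8 (H0, [(0, 0, 2), (0, 2, 0), (2, 0, 0)])"
  by code_simp

lemma obstructed_all8_4: "obstructed_all8 (H4, [(1, 0, 2), (0, 2, 0)])"
  by code_simp

lemma obstructed_all8_1: "obstructed_all8 (H1, [(0, 2, 0), (2, 0, 0)])"
  by code_simp

lemma obstructed_all8_7: "obstructed_all8 (H7, [(0, 2, 0), (2, 0, 0)])"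
  by code_simp

lemma characters8_obstruct: "list_all (\<lambda>(h, vs). list_all (\<lambda>A. list_all (\<lambda>B.
    obstructed8 (pres8 (bits_of h)) vs (bits_of H0 # A) (bits_of H0 # B)) pairs8) pairs8) characters8"
  using obstructed_all8_0 obstructed_all8_4 obstructed_all8_1 obstructed_all8_7
  by (simp add: characters8_def obstructed_all8_def Let_def)

lemma cyclic8_hom: "list_all (\<lambda>e. list_all (\<lambda>f.
    (character8 (1, 2, 4) (mul (pres8 (bits_of HA)) e f) - character8 (1, 2, 4) e - character8 (1, 2, 4) f) mod 8 = 0)
    even_bits) even_bits"
  by code_simp

lemma unique_involution8: "list_all (\<lambda>h. list_all (\<lambda>e. mul (pres8 (bits_of h)) e e = bits_of H0 \<longrightarrow>
    e = bits_of H0 \<or> e = bits_of H2) even_bits) [HA, H7]"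
  by code_simp

lemma commutative8: "list_all (\<lambda>h. list_all (\<lambda>e. list_all (\<lambda>f.
    mul (pres8 (bits_of h)) e f = mul (pres8 (bits_of h)) f e) even_bits) even_bits) [H0, H4, HA]"
  by code_simp

lemma set_concat_map2: "set (concat (map (\<lambda>a. map (f a) ys) xs)) = {f a b | a b. a \<in> set xs \<and> b \<in> set ys}"
  by auto

lemma groups8_eq: "set groups8 = {H0, H4, HA, H1, H7}"
  by (auto simp: groups8_def)

context finite_group
begin

text \<open>Transfers a character computed on exponent vectors to the group and turns sums over
  subsets of the group into list sums that can be evaluated.\<close>

lemma pc_group_character:
  fixes val :: "bits \<Rightarrow> int"
  assumes pc: "pc_group (set es) P g1 g2 g3 g4"
    and closed: "\<And>e f. e \<in> set es \<Longrightarrow> f \<in> set es \<Longrightarrow> mul P e f \<in> set es"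
    and hom: "\<And>e f. e \<in> set es \<Longrightarrow> f \<in> set es \<Longrightarrow> m dvd val (mul P e f) - val e - val f"
  defines "\<phi> \<equiv> word (\<otimes>) \<one> g1 g2 g3 g4"
  shows "\<exists>f :: 'a \<Rightarrow> int. (\<forall>x\<in>carrier G. \<forall>y\<in>carrier G. m dvd f (x \<otimes> y) - f x - f y) \<and>
    (\<forall>l. distinct l \<longrightarrow> set l \<subseteq> set es \<longrightarrow> sum f (\<phi> ` set l) = sum_list (map val l))"
proof -
  have bij: "bij_betw \<phi> (set es) (carrier G)"
    using pc by (simp add: pc_group_def \<phi>_def)
  define f where "f x = val (inv_into (set es) \<phi> x)" for x
  have f: "f (\<phi> e) = val e" if "e \<in> set es" for e
    using bij that by (simp add: f_def bij_betw_def inv_into_f_f)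
  have "m dvd f (x \<otimes> y) - f x - f y" if xy: "x \<in> carrier G" "y \<in> carrier G" for x y
  proof -
    have "x \<in> \<phi> ` set es" "y \<in> \<phi> ` set es"
      using bij xy by (simp_all add: bij_betw_def)
    then obtain a b where ab: "a \<in> set es" "b \<in> set es" "x = \<phi> a" "y = \<phi> b"
      by (elim imageE)
    have "x \<otimes> y = \<phi> (mul P a b)"
      using pc_group_mul[OF pc] by (simp add: \<phi>_def ab)
    then show ?thesis
      using hom[OF ab(1,2)] by (simp add: f closed ab)
  qed
  moreover have "sum f (\<phi> ` set l) = sum_list (map val l)" if l: "distinct l" "set l \<subseteq> set es" for l
  proof -
    have "inj_on \<phi> (set l)"
      using bij l(2) by (auto simp: bij_betw_def intro: inj_on_subset)
    then have "sum f (\<phi> ` set l) = (\<Sum>e\<in>set l. f (\<phi> e))"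
      by (simp add: sum.reindex)
    also have "\<dots> = (\<Sum>e\<in>set l. val e)"
      using l(2) by (intro sum.cong) (auto simp: f)
    also have "\<dots> = sum_list (map val l)"
      using l(1) by (simp add: sum_list_distinct_conv_sum_set)
    finally show ?thesis .
  qed
  ultimately show ?thesis
    by blast
qed

definition character :: "int \<Rightarrow> ('a \<Rightarrow> int) \<Rightarrow> bool" where
  "character m f \<longleftrightarrow> (\<forall>x\<in>carrier G. \<forall>y\<in>carrier G. m dvd f (x \<otimes> y) - f x - f y)"

lemma character_sum_translate:
  assumes f: "character m f" and g: "g \<in> carrier G" and U: "U \<subseteq> carrier G"
  shows "m dvd sum f (g <# U) - (sum f U + int (card U) * f g)"
    and "m dvd sum f (U #> g) - (sum f U + int (card U) * f g)"
proof -
  have "sum f (g <# U) = (\<Sum>u\<in>U. f (g \<otimes> u))"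
  proof -
    have "g <# U = (\<lambda>u. g \<otimes> u) ` U"
      by (auto simp: l_coset_def)
    moreover have "inj_on (\<lambda>u. g \<otimes> u) U"
      using U g by (intro inj_onI) (auto simp: subset_iff)
    ultimately show ?thesis
      by (simp add: sum.reindex)
  qed
  moreover have "m dvd (\<Sum>u\<in>U. f (g \<otimes> u) - f g - f u)"
    using f g U by (intro dvd_sum) (auto simp: character_def)
  ultimately show "m dvd sum f (g <# U) - (sum f U + int (card U) * f g)"
    by (simp add: sum_subtractf algebra_simps)
  have "sum f (U #> g) = (\<Sum>u\<in>U. f (u \<otimes> g))"
  proof -
    have "U #> g = (\<lambda>u. u \<otimes> g) ` U"
      by (auto simp: r_coset_def)
    moreover have "inj_on (\<lambda>u. u \<otimes> g) U"
      using U g by (intro inj_onI) (auto simp: subset_iff)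
    ultimately show ?thesis
      by (simp add: sum.reindex)
  qed
  moreover have "m dvd (\<Sum>u\<in>U. f (u \<otimes> g) - f u - f g)"
    using f g U by (intro dvd_sum) (auto simp: character_def)
  ultimately show "m dvd sum f (U #> g) - (sum f U + int (card U) * f g)"
    by (simp add: sum_subtractf algebra_simps)
qed

lemma gap_character_sum:
  assumes "transversal_gap R C S" "character m f"
  shows "m dvd sum f (carrier G) + sum f S - sum f R - sum f C"
  using assms by (intro transversal_gap_sum) (auto simp: character_def)

lemma subset_as_list:
  assumes bij: "bij_betw \<phi> (set es) (carrier G)" and es: "distinct es" and U: "U \<subseteq> \<phi> ` set xs" "set xs \<subseteq> set es"
    and xs: "distinct xs"
  obtains l where "l \<in> set (subseqs xs)" "distinct l" "set l \<subseteq> set xs" "length l = card U" "\<phi> ` set l = U"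
proof -
  define V where "V = {e \<in> set xs. \<phi> e \<in> U}"
  have "V \<in> set ` set (subseqs xs)"
    by (simp add: V_def subseqs_powset)
  then obtain l where l: "l \<in> set (subseqs xs)" "set l = V"
    by auto
  then have d: "distinct l"
    using subseqs_distinctD xs by blast
  have im: "\<phi> ` V = U"
    using U(1) by (auto simp: V_def)
  moreover have "inj_on \<phi> V"
    using bij U(2) by (auto simp: bij_betw_def V_def intro: inj_on_subset)
  ultimately have "card V = card U"
    by (metis card_image)
  then have "length l = card U"
    using d l(2) by (metis distinct_card)
  then show thesis
    using that l d im by (auto simp: V_def)
qed

text \<open>With \<one> in \<open>A\<close> and \<open>B\<close> these sets correspond to entries of
  \<open>pairs8\<close>, and \<open>S\<close> to a sublist of the complement of A B, so the
  exhaustive check supplies the character.\<close>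

lemma order8_obstruction_normalised:
  assumes pc: "pc_group (set even_bits) (pres8 (bits_of k)) g1 g2 g3 \<one>" and k: "k \<in> {H0, H4, H1, H7}"
    and A: "A \<subseteq> carrier G" "card A = 3" "\<one> \<in> A" and B: "B \<subseteq> carrier G" "card B = 3" "\<one> \<in> B"
    and S: "S \<subseteq> carrier G" "card S = 3" and disj: "\<And>a b. a \<in> A \<Longrightarrow> b \<in> B \<Longrightarrow> a \<otimes> b \<notin> S"
  obtains f where "character 4 f" "\<not> 4 dvd sum f (carrier G) + sum f S - sum f A - sum f B"
proof -
  let ?P = "pres8 (bits_of k)"
  define \<phi> where "\<phi> = word (\<otimes>) \<one> g1 g2 g3 \<one>"
  have bij: "bij_betw \<phi> (set even_bits) (carrier G)"
    using pc by (simp add: pc_group_def \<phi>_def)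
  then have inj: "inj_on \<phi> (set even_bits)" and im: "\<phi> ` set even_bits = carrier G"
    by (auto simp: bij_betw_def)
  have one: "\<phi> (bits_of H0) = \<one>"
    by (simp add: \<phi>_def pw_def)
  let ?nz = "map bits_of [H2, H4, H6, H8, HA, HC, HE]"
  have nz: "even_bits = bits_of H0 # ?nz" "distinct ?nz" "set ?nz \<subseteq> set even_bits"
    by (simp_all add: even_bits_def)
  have three: "\<exists>l\<in>set pairs8. distinct (bits_of H0 # l) \<and> set (bits_of H0 # l) \<subseteq> set even_bits \<and> \<phi> ` set (bits_of H0 # l) = U"
    if U: "U \<subseteq> carrier G" "card U = 3" "\<one> \<in> U" for U
  proof -
    have "U - {\<one>} \<subseteq> \<phi> ` set ?nz"
      using U(1) im one by (auto simp: nz(1) simp del: bits_of.simps list.map)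
    then obtain l where l: "l \<in> set (subseqs ?nz)" "distinct l" "set l \<subseteq> set ?nz" "length l = card (U - {\<one>})" "\<phi> ` set l = U - {\<one>}"
      using subset_as_list[OF bij distinct_all_bits(2) _ nz(3,2)] by blast
    have "length l = 2"
      using l(4) U finite_subset_carrier by simp
    then have "l \<in> set pairs8"
      using l(1) by (simp add: pairs8_def del: bits_of.simps list.map subseqs.simps)
    moreover have "bits_of H0 \<notin> set l"
      using l(3) by auto
    moreover have "set l \<subseteq> set even_bits"
      using l(3) nz(3) by blast
    moreover have "\<phi> ` set (bits_of H0 # l) = U"
      using l(5) one U(3) by (auto simp del: bits_of.simps)
    moreover have "bits_of H0 \<in> set even_bits"
      by (simp add: even_bits_def)
    ultimately show ?thesis
      using l(2) by (intro bexI[of _ l]) (simp_all del: bits_of.simps)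
  qed
  obtain la where la: "la \<in> set pairs8" "distinct (bits_of H0 # la)" "set (bits_of H0 # la) \<subseteq> set even_bits" "\<phi> ` set (bits_of H0 # la) = A"
    using three[OF A] by blast
  obtain lb where lb: "lb \<in> set pairs8" "distinct (bits_of H0 # lb)" "set (bits_of H0 # lb) \<subseteq> set even_bits" "\<phi> ` set (bits_of H0 # lb) = B"
    using three[OF B] by blast
  obtain vs where vs: "(k, vs) \<in> set characters8"
    using k by (auto simp: characters8_def)
  then have ob: "obstructed8 ?P vs (bits_of H0 # la) (bits_of H0 # lb)"
    using characters8_obstruct la(1) lb(1) unfolding list_all_iff by blast
  define C where "C = filter (\<lambda>x. x \<notin> set (concat (map (\<lambda>a. map (mul ?P a) (bits_of H0 # lb)) (bits_of H0 # la)))) even_bits"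
  have C: "distinct C" "set C \<subseteq> set even_bits"
    using distinct_all_bits(2) by (auto simp: C_def)
  have SC: "S \<subseteq> \<phi> ` set C"
  proof
    fix s
    assume s: "s \<in> S"
    then have "s \<in> \<phi> ` set even_bits"
      using S(1) im by blast
    then obtain e where e: "e \<in> set even_bits" "s = \<phi> e"
      by (elim imageE)
    have "e \<noteq> mul ?P a b" if ab: "a \<in> set (bits_of H0 # la)" "b \<in> set (bits_of H0 # lb)" for a b
    proof
      assume "e = mul ?P a b"
      then have "s = \<phi> a \<otimes> \<phi> b"
        using pc_group_mul[OF pc] e(2) by (simp add: \<phi>_def)
      moreover have "\<phi> a \<in> A" "\<phi> b \<in> B"
        using ab la(4) lb(4) by blast+
      ultimately show False
        using disj s by blast
    qed
    then have "e \<in> set C"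
      using e(1) unfolding C_def set_filter set_concat_map2 by blast
    then show "s \<in> \<phi> ` set C"
      using e(2) by blast
  qed
  obtain ls where ls: "ls \<in> set (subseqs C)" "distinct ls" "set ls \<subseteq> set C" "length ls = card S" "\<phi> ` set ls = S"
    using subset_as_list[OF bij distinct_all_bits(2) SC C(2,1)] by blast
  have "card S \<le> length C"
    using ls(2-4) C(1) by (metis card_mono distinct_card List.finite_set)
  then obtain v where v: "v \<in> set vs" and ne: "(sum_list (map (character8 v) even_bits) + sum_list (map (character8 v) ls)
         - sum_list (map (character8 v) (bits_of H0 # la)) - sum_list (map (character8 v) (bits_of H0 # lb))) mod 4 \<noteq> 0"
    using ob ls(1,4) S(2) unfolding obstructed8_def Let_def C_def[symmetric] list_all_iff list_ex_iff by auto
  have "\<exists>f :: 'a \<Rightarrow> int. (\<forall>x\<in>carrier G. \<forall>y\<in>carrier G. 4 dvd f (x \<otimes> y) - f x - f y) \<and>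
    (\<forall>l. distinct l \<longrightarrow> set l \<subseteq> set even_bits \<longrightarrow> sum f (\<phi> ` set l) = sum_list (map (character8 v) l))"
    unfolding \<phi>_def
  proof (rule pc_group_character[OF pc even_bits_closed])
    show "4 dvd character8 v (mul ?P e f) - character8 v e - character8 v f" if "e \<in> set even_bits" "f \<in> set even_bits" for e f
    proof -
      have "\<forall>v\<in>set vs. \<forall>e\<in>set even_bits. \<forall>f\<in>set even_bits.
          (character8 v (mul ?P e f) - character8 v e - character8 v f) mod 4 = 0"
        using characters8_hom vs unfolding list_all_iff by blast
      then show ?thesis
        using v that unfolding dvd_eq_mod_eq_0 by blast
    qed
  qed
  then obtain f where f: "character 4 f"
    "\<And>l. distinct l \<Longrightarrow> set l \<subseteq> set even_bits \<Longrightarrow> sum f (\<phi> ` set l) = sum_list (map (character8 v) l)"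
    unfolding character_def by blast
  have "sum f (carrier G) = sum_list (map (character8 v) even_bits)"
    using f(2)[OF distinct_all_bits(2)] im by simp
  moreover have "sum f A = sum_list (map (character8 v) (bits_of H0 # la))"
    using f(2)[OF la(2,3)] unfolding la(4) .
  moreover have "sum f B = sum_list (map (character8 v) (bits_of H0 # lb))"
    using f(2)[OF lb(2,3)] unfolding lb(4) .
  moreover have "sum f S = sum_list (map (character8 v) ls)"
    using f(2)[OF ls(2) subset_trans[OF ls(3) C(2)]] unfolding ls(5) .
  ultimately have "\<not> 4 dvd sum f (carrier G) + sum f S - sum f A - sum f B"
    using ne by (simp only: dvd_eq_mod_eq_0 not_False_eq_True)
  then show thesis
    by (rule that[OF f(1)])
qed

text \<open>Replacing \<open>A\<close>, \<open>B\<close>, \<open>S\<close> by a^-1 A, B b^-1, a^-1 S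
  b^-1 preserves disjointness. It changes the sum over \<open>S\<close> by 3 f(a^-1) + 3 f(b^-1)
  modulo 4, exactly the change of the sums over \<open>A\<close> and \<open>B\<close> together, so
  the obstruction is unaffected.\<close>

lemma order8_obstruction:
  assumes pc: "pc_group (set even_bits) (pres8 (bits_of k)) g1 g2 g3 \<one>" and k: "k \<in> {H0, H4, H1, H7}"
    and A: "A \<subseteq> carrier G" "card A = 3" and B: "B \<subseteq> carrier G" "card B = 3"
    and S: "S \<subseteq> carrier G" "card S = 3" and disj: "\<And>a b. a \<in> A \<Longrightarrow> b \<in> B \<Longrightarrow> a \<otimes> b \<notin> S"
  obtains f where "character 4 f" "\<not> 4 dvd sum f (carrier G) + sum f S - sum f A - sum f B"
proof -
  obtain a b where ab: "a \<in> A" "b \<in> B" "a \<in> carrier G" "b \<in> carrier G"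
    using A B by (metis card.empty ex_in_conv subsetD zero_neq_numeral)
  define A' where "A' = inv a <# A"
  define B' where "B' = B #> inv b"
  define S' where "S' = (inv a <# S) #> inv b"
  have ia: "inv a <# S \<subseteq> carrier G" "inv a <# A \<subseteq> carrier G" "B #> inv b \<subseteq> carrier G"
    using A B S ab by (simp_all add: l_coset_subset_G r_coset_subset_G)
  then have sub: "A' \<subseteq> carrier G" "B' \<subseteq> carrier G" "S' \<subseteq> carrier G"
    using ab by (simp_all add: A'_def B'_def S'_def r_coset_subset_G)
  have card: "card A' = 3" "card B' = 3" "card S' = 3"
    using A B S ab ia by (simp_all add: A'_def B'_def S'_def)
  have one: "\<one> \<in> A'" "\<one> \<in> B'"
    unfolding A'_def B'_def mem_l_coset mem_r_coset using ab by (metis l_inv r_inv)+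
  have disj': "x \<otimes> y \<notin> S'" if xy: "x \<in> A'" "y \<in> B'" for x y
  proof
    assume "x \<otimes> y \<in> S'"
    then obtain s where s: "s \<in> S" "x \<otimes> y = inv a \<otimes> s \<otimes> inv b"
      by (auto simp: S'_def mem_r_coset mem_l_coset)
    obtain a' b' where a'b': "a' \<in> A" "b' \<in> B" "x = inv a \<otimes> a'" "y = b' \<otimes> inv b"
      using xy by (auto simp: A'_def B'_def mem_r_coset mem_l_coset)
    have c: "a' \<in> carrier G" "b' \<in> carrier G" "s \<in> carrier G"
      using a'b' s A B S by auto
    have "inv a \<otimes> (a' \<otimes> b') \<otimes> inv b = inv a \<otimes> s \<otimes> inv b"
      using s(2) a'b' c ab by (simp add: m_assoc)
    then have "a' \<otimes> b' = s"
      using c ab by simp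
    then show False
      using disj a'b' s(1) by blast
  qed
  obtain f where f: "character 4 f" "\<not> 4 dvd sum f (carrier G) + sum f S' - sum f A' - sum f B'"
    using order8_obstruction_normalised[OF pc k sub(1) card(1) one(1) sub(2) card(2) one(2) sub(3) card(3) disj'] by blast
  have d: "4 dvd sum f A' - (sum f A + 3 * f (inv a))" "4 dvd sum f B' - (sum f B + 3 * f (inv b))"
    "4 dvd sum f (inv a <# S) - (sum f S + 3 * f (inv a))" "4 dvd sum f S' - (sum f (inv a <# S) + 3 * f (inv b))"
    using character_sum_translate[OF f(1)] A B S ab ia card_l_coset[OF S(1), of "inv a"]
    unfolding A'_def B'_def S'_def by (metis inv_closed of_nat_numeral)+
  have "4 dvd (sum f S' - (sum f (inv a <# S) + 3 * f (inv b))) + (sum f (inv a <# S) - (sum f S + 3 * f (inv a)))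
      - (sum f A' - (sum f A + 3 * f (inv a))) - (sum f B' - (sum f B + 3 * f (inv b)))"
    by (intro dvd_add dvd_diff d)
  then have "4 dvd (sum f (carrier G) + sum f S' - sum f A' - sum f B') - (sum f (carrier G) + sum f S - sum f A - sum f B)"
    by (simp add: algebra_simps)
  then have "\<not> 4 dvd sum f (carrier G) + sum f S - sum f A - sum f B"
    using f(2) by (metis diff_add_cancel dvd_add)
  then show thesis
    using that f(1) by blast
qed

text \<open>The total 28 = 0 + 1 + ... + 7 is 4 modulo 8. Its exact value is recorded because it
  reappears, multiplied by 3, for groups of order 24 with cyclic quotient.\<close>

lemma order8_cyclic_character:
  assumes pc: "pc_group (set even_bits) (pres8 (bits_of HA)) g1 g2 g3 \<one>"
  obtains f where "character 8 f" "sum f (carrier G) = 28"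
proof -
  let ?P = "pres8 (bits_of HA)"
  define \<phi> where "\<phi> = word (\<otimes>) \<one> g1 g2 g3 \<one>"
  have "\<exists>f :: 'a \<Rightarrow> int. (\<forall>x\<in>carrier G. \<forall>y\<in>carrier G. 8 dvd f (x \<otimes> y) - f x - f y) \<and>
    (\<forall>l. distinct l \<longrightarrow> set l \<subseteq> set even_bits \<longrightarrow> sum f (\<phi> ` set l) = sum_list (map (character8 (1, 2, 4)) l))"
    unfolding \<phi>_def
  proof (rule pc_group_character[OF pc even_bits_closed])
    show "8 dvd character8 (1, 2, 4) (mul ?P e f) - character8 (1, 2, 4) e - character8 (1, 2, 4) f"
      if "e \<in> set even_bits" "f \<in> set even_bits" for e f
      using cyclic8_hom that unfolding list_all_iff dvd_eq_mod_eq_0 by blast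
  qed
  then obtain f where f: "character 8 f"
    "\<And>l. distinct l \<Longrightarrow> set l \<subseteq> set even_bits \<Longrightarrow> sum f (\<phi> ` set l) = sum_list (map (character8 (1, 2, 4)) l)"
    unfolding character_def by blast
  have "\<phi> ` set even_bits = carrier G"
    using pc by (simp add: pc_group_def \<phi>_def bij_betw_def)
  then have "sum f (carrier G) = sum_list (map (character8 (1, 2, 4)) even_bits)"
    using f(2)[OF distinct_all_bits(2)] by simp
  also have "\<dots> = 28"
    by (simp add: even_bits_def)
  finally show thesis
    using that f(1) by blast
qed

end

text \<open>The multiplicative form of \<open>transversal_gap_sum\<close>, with the identity map in
  the role of the character.\<close>

lemma (in finite_group) abelian_gap:
  assumes "comm_group G" and gap: "transversal_gap R C S"
  shows "finprod G (\<lambda>x. x) (carrier G) \<otimes> finprod G (\<lambda>x. x) S = finprod G (\<lambda>x. x) R \<otimes> finprod G (\<lambda>x. x) C"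
proof -
  interpret comm_group G
    by fact
  obtain T where T: "partial_transversal (cayley_table G) T"
    and R: "R = carrier G - (\<lambda>(r, c, s). r) ` T" and C: "C = carrier G - (\<lambda>(r, c, s). c) ` T"
    and S: "S = carrier G - (\<lambda>(r, c, s). s) ` T"
    using gap by (auto simp: transversal_gap_def)
  have sub: "T \<subseteq> cayley_table G" "T \<subseteq> carrier G \<times> carrier G \<times> carrier G"
    and inj: "inj_on (\<lambda>(r, c, s). r) T" "inj_on (\<lambda>(r, c, s). c) T" "inj_on (\<lambda>(r, c, s). s) T"
    using T cayley_table_subset by (auto simp: partial_transversal_def)
  have fin: "finite T"
    using sub(2) by (rule finite_subset) simp
  let ?\<Pi> = "\<lambda>U. finprod G (\<lambda>x. x) U"
  have split: "?\<Pi> (carrier G) = ?\<Pi> (carrier G - g ` T) \<otimes> finprod G g T"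
    if "inj_on g T" "g ` T \<subseteq> carrier G" for g
  proof -
    have "?\<Pi> (carrier G) = ?\<Pi> ((carrier G - g ` T) \<union> g ` T)"
      using that(2) by (metis Diff_partition Un_commute)
    also have "\<dots> = ?\<Pi> (carrier G - g ` T) \<otimes> ?\<Pi> (g ` T)"
      using that(2) fin by (intro finprod_Un_disjoint) auto
    also have "?\<Pi> (g ` T) = finprod G g T"
      using that by (subst finprod_reindex) (auto simp: comp_def)
    finally show ?thesis .
  qed
  have im: "(\<lambda>(r, c, s). r) ` T \<subseteq> carrier G" "(\<lambda>(r, c, s). c) ` T \<subseteq> carrier G"
    "(\<lambda>(r, c, s). s) ` T \<subseteq> carrier G"
    using sub(2) by auto
  define r c s where "r = finprod G (\<lambda>(r, c, s). r) T" and "c = finprod G (\<lambda>(r, c, s). c) T"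
    and "s = finprod G (\<lambda>(r, c, s). s) T"
  have closed: "r \<in> carrier G" "c \<in> carrier G" "s \<in> carrier G" "?\<Pi> R \<in> carrier G" "?\<Pi> C \<in> carrier G" "?\<Pi> S \<in> carrier G"
    unfolding r_def c_def s_def R C S using sub(2) by (auto intro!: finprod_closed)
  have "s = finprod G (\<lambda>t. (case t of (r, c, s) \<Rightarrow> r) \<otimes> (case t of (r, c, s) \<Rightarrow> c)) T"
    unfolding s_def using sub by (intro finprod_cong') (auto simp: cayley_table_def)
  also have "\<dots> = r \<otimes> c"
    unfolding r_def c_def using sub(2) by (intro finprod_multf) auto
  finally have s: "s = r \<otimes> c" .
  have P: "?\<Pi> (carrier G) = ?\<Pi> R \<otimes> r" "?\<Pi> (carrier G) = ?\<Pi> C \<otimes> c" "?\<Pi> (carrier G) = ?\<Pi> S \<otimes> s"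
    unfolding r_def c_def s_def R C S using split[OF inj(1) im(1)] split[OF inj(2) im(2)] split[OF inj(3) im(3)]
    by blast+
  have "?\<Pi> (carrier G) \<otimes> ?\<Pi> S \<otimes> s = ?\<Pi> (carrier G) \<otimes> ?\<Pi> (carrier G)"
    using P(3) closed by (simp add: m_assoc)
  also have "\<dots> = (?\<Pi> R \<otimes> r) \<otimes> (?\<Pi> C \<otimes> c)"
    using P(1,2) by metis
  also have "\<dots> = (?\<Pi> R \<otimes> ?\<Pi> C) \<otimes> s"
    unfolding s using closed by (simp add: m_ac)
  finally show ?thesis
    using closed by (simp add: finprod_closed)
qed

text \<open>A full transversal forces the product of all elements to be \<one>. Given this, a gap
  consisting of one row r, one column c and one symbol s satisfies s = r c, so the missing cell
  could be added.\<close>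

lemma (in finite_group) abelian_missing:
  assumes comm: "comm_group G"
  shows "\<not> has_maximal_of_length (cayley_table G) (order G) \<or> \<not> has_maximal_of_length (cayley_table G) (order G - 1)"
proof (rule ccontr)
  interpret comm_group G
    by fact
  let ?\<Pi> = "\<lambda>U. finprod G (\<lambda>x. x) U"
  assume "\<not> ?thesis"
  then have full: "has_maximal_of_length (cayley_table G) (order G)"
    and "has_maximal_of_length (cayley_table G) (order G - 1)"
    by auto
  then obtain R C S where *: "transversal_gap R C S" "trio (order G - (order G - 1)) R C (set_inv S)"
    "S \<subseteq> carrier G"
    by (elim has_maximal_of_lengthE[of "order G - 1"]) blast
  have closed: "?\<Pi> (carrier G) \<in> carrier G"
    by (rule finprod_closed) auto
  have "?\<Pi> (carrier G) \<otimes> \<one> = \<one>"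
    using abelian_gap[OF comm transversal_gap_full[OF full]] by simp
  then have P: "?\<Pi> (carrier G) = \<one>"
    using closed by simp
  have "order G - (order G - 1) = 1"
    using order_gt_0_iff_finite by simp
  then have t: "trio 1 R C (set_inv S)"
    using *(2) by simp
  then have "card R = 1" "card C = 1" "card S = 1"
    using *(3) by (auto simp: trio_def)
  then obtain r c s where rcs: "R = {r}" "C = {c}" "S = {s}"
    by (meson card_1_singletonE)
  have mem: "r \<in> carrier G" "c \<in> carrier G" "s \<in> carrier G"
    using t *(3) rcs by (auto simp: trio_def)
  have "s = r \<otimes> c"
    using abelian_gap[OF comm *(1)] mem by (simp add: rcs P)
  moreover have "r \<otimes> c \<otimes> inv s \<noteq> \<one>"
    using t unfolding trio_def rcs by (auto simp: mem_set_inv)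
  ultimately show False
    using mem by simp
qed

text \<open>At most one involution makes the group cyclic: h3 is an involution, so h2 is not one and
  its square is h3. The character with values 0, 1, 2, 3 has total 6, not a multiple of 4.\<close>

lemma (in finite_group) no_full_gap_order4:
  assumes "order G = 4" and unique: "\<And>x. x \<in> carrier G \<Longrightarrow> x \<otimes> x = \<one> \<Longrightarrow> x = \<one> \<or> x = z"
  shows "\<not> transversal_gap {} {} {}"
proof
  assume gap: "transversal_gap {} {} {}"
  let ?es = "map bits_of [H0, H2, H4, H6]"
  obtain t p j h2 h3 where "pc_group {(a, b, c, d). \<not> d \<and> (a, b, c) \<in> {(a, b, c). \<not> a}}
     (False, t, False, p, False, False, j, False, False, False) \<one> h2 h3 \<one>"
    using pc_group_order4[OF finite_group_axioms assms(1)] by blast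
  moreover have "{(a, b, c, d). \<not> d \<and> (a, b, c) \<in> {(a, b, c). \<not> a}} = set ?es"
  proof -
    have "(a, b, c, d) \<in> {(a, b, c, d). \<not> d \<and> (a, b, c) \<in> {(a, b, c). \<not> a}} \<longleftrightarrow> (a, b, c, d) \<in> set ?es" for a b c d
      by (cases a; cases b; cases c; cases d) simp_all
    then show ?thesis
      by auto
  qed
  ultimately have pc: "pc_group (set ?es) (False, t, False, p, False, False, j, False, False, False) \<one> h2 h3 \<one>"
    by argo
  let ?\<phi> = "word (\<otimes>) \<one> \<one> h2 h3 \<one>"
  have h: "h2 \<in> carrier G" "h3 \<in> carrier G" "h2 \<otimes> h2 = pw \<one> h3 p" "h3 \<otimes> h3 = \<one>"
    using pc by (auto simp: pc_group_def pw_def)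
  have \<phi>: "?\<phi> (bits_of H0) = \<one>" "?\<phi> (bits_of H2) = h3" "?\<phi> (bits_of H4) = h2"
    using h by (simp_all add: pw_def)
  have "inj_on ?\<phi> (set ?es)"
    using pc by (auto simp: pc_group_def bij_betw_def)
  then have ne: "?\<phi> (bits_of H0) \<noteq> ?\<phi> (bits_of H2)" "?\<phi> (bits_of H0) \<noteq> ?\<phi> (bits_of H4)" "?\<phi> (bits_of H2) \<noteq> ?\<phi> (bits_of H4)"
    unfolding inj_on_def by (force simp del: word.simps)+
  have p: "p"
  proof (rule ccontr)
    assume "\<not> p"
    then have "h2 \<otimes> h2 = \<one>"
      using h by (simp add: pw_def)
    then show False
      using unique[OF h(1)] unique[OF h(2) h(4)] ne unfolding \<phi> by metis
  qed
  have "\<exists>f :: 'a \<Rightarrow> int. (\<forall>x\<in>carrier G. \<forall>y\<in>carrier G. 4 dvd f (x \<otimes> y) - f x - f y) \<and>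
    (\<forall>l. distinct l \<longrightarrow> set l \<subseteq> set ?es \<longrightarrow> sum f (?\<phi> ` set l) = sum_list (map (character8 (0, 1, 2)) l))"
    by (rule pc_group_character[OF pc]) (use p in \<open>auto simp: ap_def\<close>)
  then obtain f where f: "character 4 f"
    "\<And>l. distinct l \<Longrightarrow> set l \<subseteq> set ?es \<Longrightarrow> sum f (?\<phi> ` set l) = sum_list (map (character8 (0, 1, 2)) l)"
    unfolding character_def by blast
  have im: "?\<phi> ` set ?es = carrier G"
    using pc by (simp add: pc_group_def bij_betw_def)
  have "distinct ?es"
    by simp
  then have "sum f (carrier G) = sum_list (map (character8 (0, 1, 2)) ?es)"
    using f(2)[OF _ subset_refl] unfolding im by blast
  then have "sum f (carrier G) = 6"
    by simp
  then show False
    using gap_character_sum[OF gap f(1)] by simp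
qed

context finite_group
begin

lemma order8_missing5:
  assumes n: "order G = 8" and pc: "pc_group (set even_bits) (pres8 (bits_of k)) g1 g2 g3 \<one>" and k: "k \<in> {H0, H4, H1, H7}"
  shows "\<not> has_maximal_of_length (cayley_table G) 5"
proof
  assume "has_maximal_of_length (cayley_table G) 5"
  then obtain R C S where *: "transversal_gap R C S" "trio (order G - 5) R C (set_inv S)" "S \<subseteq> carrier G" "card S = order G - 5"
    by (elim has_maximal_of_lengthE) blast
  then have t: "trio 3 R C (set_inv S)" "card S = 3"
    using n by simp_all
  have RC: "R \<subseteq> carrier G" "C \<subseteq> carrier G" "card R = 3" "card C = 3"
    using t by (auto simp: trio_def)
  have "a \<otimes> b \<notin> S" if "a \<in> R" "b \<in> C" for a b
  proof
    assume s: "a \<otimes> b \<in> S"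
    then have "inv (a \<otimes> b) \<in> set_inv S"
      by (auto simp: mem_set_inv)
    then have "a \<otimes> b \<otimes> inv (a \<otimes> b) \<noteq> \<one>"
      using t(1) that unfolding trio_def by blast
    then show False
      using *(3) s by auto
  qed
  then obtain f where "character 4 f" "\<not> 4 dvd sum f (carrier G) + sum f S - sum f R - sum f C"
    using order8_obstruction[OF pc k RC(1,3,2,4) *(3) t(2)] by blast
  then show False
    using gap_character_sum[OF *(1)] by blast
qed

text \<open>A subgroup of order 4 inherits the uniqueness of the involution, so it has no full
  transversal; yet length 4 would need one in a subgroup of index two.\<close>

lemma order8_missing4:
  assumes n: "order G = 8" and pc: "pc_group (set even_bits) (pres8 (bits_of k)) g1 g2 g3 \<one>" and k: "k \<in> {HA, H7}"
  shows "\<not> has_maximal_of_length (cayley_table G) 4"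
proof -
  let ?\<phi> = "word (\<otimes>) \<one> g1 g2 g3 \<one>"
  have bij: "bij_betw ?\<phi> (set even_bits) (carrier G)"
    using pc by (simp add: pc_group_def)
  have one: "?\<phi> (bits_of H0) = \<one>"
    by (simp add: pw_def)
  have H0: "bits_of H0 \<in> set even_bits"
    by (simp add: even_bits_def)
  have unique: "x = \<one> \<or> x = ?\<phi> (bits_of H2)" if x: "x \<in> carrier G" "x \<otimes> x = \<one>" for x
  proof -
    obtain e where e: "e \<in> set even_bits" "x = ?\<phi> e"
      using bij x(1) unfolding bij_betw_def by blast
    have "?\<phi> (mul (pres8 (bits_of k)) e e) = ?\<phi> (bits_of H0)"
      using pc_group_mul[OF pc, of e e] x(2) e(2) one by argo
    then have "mul (pres8 (bits_of k)) e e = bits_of H0"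
      using bij even_bits_closed[OF e(1,1)] H0 unfolding bij_betw_def by (meson inj_onD)
    then have "e = bits_of H0 \<or> e = bits_of H2"
      using unique_involution8 k e(1) unfolding list_all_iff by auto
    then show ?thesis
      using e(2) one by metis
  qed
  have "\<not> has_maximal_of_length (cayley_table G) (order G div 2)"
  proof (rule half_missing)
    show "even (order G)"
      using n by simp
    fix H
    assume H: "subgroup H G" "2 * card H = order G"
    interpret H: subgroup H G
      by fact
    interpret GH: finite_group "G\<lparr>carrier := H\<rparr>"
      by (rule subgroup_finite_group) fact
    show "\<not> GH.transversal_gap {} {} {}"
    proof (rule GH.no_full_gap_order4)
      show "order (G\<lparr>carrier := H\<rparr>) = 4"
        using H(2) n by (simp add: order_def)
      show "x = \<one>\<^bsub>G\<lparr>carrier := H\<rparr>\<^esub> \<or> x = ?\<phi> (bits_of H2)"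
        if "x \<in> carrier (G\<lparr>carrier := H\<rparr>)" "x \<otimes>\<^bsub>G\<lparr>carrier := H\<rparr>\<^esub> x = \<one>\<^bsub>G\<lparr>carrier := H\<rparr>\<^esub>" for x
        using unique[of x] that H.mem_carrier by simp
    qed
  qed
  then show ?thesis
    using n by simp
qed

lemma order8_abelian:
  assumes pc: "pc_group (set even_bits) (pres8 (bits_of k)) g1 g2 g3 \<one>" and k: "k \<in> {H0, H4, HA}"
  shows "comm_group G"
proof (rule group_comm_groupI)
  let ?\<phi> = "word (\<otimes>) \<one> g1 g2 g3 \<one>"
  fix x y
  assume "x \<in> carrier G" "y \<in> carrier G"
  moreover have "?\<phi> ` set even_bits = carrier G"
    using pc by (simp add: pc_group_def bij_betw_def)
  ultimately have "x \<in> ?\<phi> ` set even_bits" "y \<in> ?\<phi> ` set even_bits"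
    by simp_all
  then obtain e f where ef: "x = ?\<phi> e" "y = ?\<phi> f" "e \<in> set even_bits" "f \<in> set even_bits"
    by (elim imageE)
  have "mul (pres8 (bits_of k)) e f = mul (pres8 (bits_of k)) f e"
    using commutative8 k ef(3,4) unfolding list_all_iff by auto
  then show "x \<otimes> y = y \<otimes> x"
    unfolding ef(1,2) pc_group_mul[OF pc] by simp
qed

end

text \<open>The rotation is g1 g2, whose square is g3, and the reflection is g1.\<close>

fun dihedral8_bits :: "int \<times> bool \<Rightarrow> bits" where
  "dihedral8_bits (i, e) = bits_of
     (if e then (if i = 0 then H8 else if i = 1 then H6 else if i = 2 then HA else H4)
      else (if i = 0 then H0 else if i = 1 then HC else if i = 2 then H2 else HE))"

lemma dihedral8_bits_mul: "list_all (\<lambda>x. list_all (\<lambda>y.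
    dihedral8_bits ((if snd x then fst x - fst y else fst x + fst y) mod 4, snd x \<noteq> snd y) =
    mul (pres8 (bits_of H1)) (dihedral8_bits x) (dihedral8_bits y))
    (List.product [0, 1, 2, 3] [False, True])) (List.product [0, 1, 2, 3] [False, True])"
  by code_simp

lemma dihedral8_bits_bij: "distinct (map dihedral8_bits (List.product [0, 1, 2, 3] [False, True]))"
  "set (map dihedral8_bits (List.product [0, 1, 2, 3] [False, True])) = set even_bits"
  by code_simp+

lemma atLeastLessThan_int_4: "{0..<4 :: int} = set [0, 1, 2, 3]"
  by auto

lemma is_isoI:
  assumes "bij_betw f (carrier H) (carrier K)"
    and "\<And>x y. x \<in> carrier H \<Longrightarrow> y \<in> carrier H \<Longrightarrow> f (x \<otimes>\<^bsub>H\<^esub> y) = f x \<otimes>\<^bsub>K\<^esub> f y"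
  shows "H \<cong> K"
proof -
  have "f \<in> hom H K"
    using assms by (intro homI) (auto simp: bij_betw_def)
  then show ?thesis
    using assms(1) by (auto simp: is_iso_def iso_def)
qed

lemma (in finite_group) order8_dihedral:
  assumes pc: "pc_group (set even_bits) (pres8 (bits_of H1)) g1 g2 g3 \<one>"
  shows "G \<cong> dihedral_group 8"
proof -
  let ?\<phi> = "word (\<otimes>) \<one> g1 g2 g3 \<one>" and ?l = "List.product [0, 1, 2, 3] [False, True]"
  have carrier: "carrier (dihedral_group 8) = set ?l"
    by (simp add: dihedral_group_def atLeastLessThan_int_4 UNIV_bool)
  have "bij_betw dihedral8_bits (set ?l) (set even_bits)"
    using dihedral8_bits_bij by (simp only: bij_betw_def distinct_map set_map)
  moreover have bij: "bij_betw ?\<phi> (set even_bits) (carrier G)"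
    using pc by (simp add: pc_group_def)
  ultimately have "bij_betw (?\<phi> \<circ> dihedral8_bits) (carrier (dihedral_group 8)) (carrier G)"
    unfolding carrier by (rule bij_betw_trans)
  moreover have "?\<phi> (dihedral8_bits (x \<otimes>\<^bsub>dihedral_group 8\<^esub> y)) = ?\<phi> (dihedral8_bits x) \<otimes> ?\<phi> (dihedral8_bits y)"
    if xy: "x \<in> set ?l" "y \<in> set ?l" for x y
  proof -
    have eq: "x \<otimes>\<^bsub>dihedral_group 8\<^esub> y = ((if snd x then fst x - fst y else fst x + fst y) mod 4, snd x \<noteq> snd y)"
      by (simp add: dihedral_group_def case_prod_unfold)
    have "dihedral8_bits (x \<otimes>\<^bsub>dihedral_group 8\<^esub> y) = mul (pres8 (bits_of H1)) (dihedral8_bits x) (dihedral8_bits y)"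
      unfolding eq by (rule dihedral8_bits_mul[unfolded list_all_iff, THEN bspec, OF xy(1), THEN bspec, OF xy(2)])
    then show ?thesis
      unfolding pc_group_mul[OF pc] by simp
  qed
  then have "?\<phi> (dihedral8_bits (x \<otimes>\<^bsub>dihedral_group 8\<^esub> y)) = ?\<phi> (dihedral8_bits x) \<otimes> ?\<phi> (dihedral8_bits y)"
    if "x \<in> carrier (dihedral_group 8)" "y \<in> carrier (dihedral_group 8)" for x y
    using that unfolding carrier by blast
  ultimately have "dihedral_group 8 \<cong> G"
    by (intro is_isoI[of "?\<phi> \<circ> dihedral8_bits"]) (simp_all only: o_apply)
  then show ?thesis
    using group.iso_sym[OF group_dihedral_group[of 8]] by simp
qed

section \<open>Order 24\<close>

context finite_group
begin

section \<open>Conjugates and double cosets of subgroups of order 3\<close>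

definition conj_set :: "'a \<Rightarrow> 'a set \<Rightarrow> 'a set" where
  "conj_set g H = (g <# H) #> inv g"

lemma mem_conj_set:
  assumes "g \<in> carrier G" "H \<subseteq> carrier G"
  shows "x \<in> conj_set g H \<longleftrightarrow> x \<in> carrier G \<and> inv g \<otimes> x \<otimes> g \<in> H"
proof
  assume "x \<in> conj_set g H"
  then obtain h where h: "h \<in> H" "x = g \<otimes> h \<otimes> inv g"
    by (auto simp: conj_set_def mem_r_coset mem_l_coset)
  then have "h \<in> carrier G"
    using assms by auto
  moreover have "inv g \<otimes> x \<otimes> g = h"
    using h(2) calculation assms(1) by (simp add: m_assoc) (simp add: m_assoc[symmetric])
  ultimately show "x \<in> carrier G \<and> inv g \<otimes> x \<otimes> g \<in> H"
    using h assms by simp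
next
  assume x: "x \<in> carrier G \<and> inv g \<otimes> x \<otimes> g \<in> H"
  define y where "y = inv g \<otimes> x \<otimes> g"
  have "x = g \<otimes> y \<otimes> inv g"
    using x assms(1) unfolding y_def by (simp add: m_assoc) (simp add: m_assoc[symmetric])
  moreover have "y \<in> H"
    using x by (simp add: y_def)
  then have "g \<otimes> y \<in> g <# H"
    unfolding mem_l_coset by blast
  ultimately show "x \<in> conj_set g H"
    unfolding conj_set_def mem_r_coset by blast
qed

lemma subgroup_conj_set:
  assumes "subgroup H G" "g \<in> carrier G"
  shows "subgroup (conj_set g H) G" "card (conj_set g H) = card H"
proof -
  show "subgroup (conj_set g H) G"
    unfolding conj_set_def using assms by (intro subgroup_conjugation_is_surj2)
  show "card (conj_set g H) = card H"
    using assms(2) subgroup.subset[OF assms(1)] l_coset_subset_G[of H g] by (simp add: conj_set_def)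
qed

lemma mem_double_coset: "x \<in> H <#> (g <# K) \<longleftrightarrow> (\<exists>h\<in>H. \<exists>k\<in>K. x = h \<otimes> (g \<otimes> k))"
  by (auto simp: set_mult_def l_coset_def)

lemma double_coset_disjoint:
  assumes "subgroup H G" "subgroup K G" "g \<in> carrier G" "g' \<in> carrier G"
    and meet: "(H <#> (g <# K)) \<inter> (H <#> (g' <# K)) \<noteq> {}"
  shows "H <#> (g <# K) = H <#> (g' <# K)"
proof -
  interpret H: subgroup H G by fact
  interpret K: subgroup K G by fact
  have incl: "H <#> (g <# K) \<subseteq> H <#> (g' <# K)"
    if g: "g \<in> carrier G" "g' \<in> carrier G" and x: "x \<in> H <#> (g <# K)" "x \<in> H <#> (g' <# K)" for g g' x
  proof
    obtain h k where hk: "h \<in> H" "k \<in> K" "x = h \<otimes> (g \<otimes> k)"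
      using x(1) unfolding mem_double_coset by blast
    obtain h' k' where hk': "h' \<in> H" "k' \<in> K" "x = h' \<otimes> (g' \<otimes> k')"
      using x(2) unfolding mem_double_coset by blast
    have c: "h \<in> carrier G" "k \<in> carrier G" "h' \<in> carrier G" "k' \<in> carrier G"
      using hk hk' by auto
    have "g = inv h \<otimes> (h \<otimes> (g \<otimes> k)) \<otimes> inv k"
      using c g by (simp add: m_assoc) (simp add: m_assoc[symmetric])
    also have "\<dots> = inv h \<otimes> (h' \<otimes> (g' \<otimes> k')) \<otimes> inv k"
      using hk(3) hk'(3) by simp
    finally have g_eq: "g = inv h \<otimes> (h' \<otimes> (g' \<otimes> k')) \<otimes> inv k" .
    fix y
    assume "y \<in> H <#> (g <# K)"
    then obtain u v where uv: "u \<in> H" "v \<in> K" "y = u \<otimes> (g \<otimes> v)"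
      unfolding mem_double_coset by blast
    have "y = (u \<otimes> inv h \<otimes> h') \<otimes> (g' \<otimes> (k' \<otimes> inv k \<otimes> v))"
      using c g uv(1,2) unfolding uv(3) g_eq by (simp add: m_assoc)
    moreover have "u \<otimes> inv h \<otimes> h' \<in> H" "k' \<otimes> inv k \<otimes> v \<in> K"
      using hk hk' uv by simp_all
    ultimately show "y \<in> H <#> (g' <# K)"
      unfolding mem_double_coset by blast
  qed
  obtain x where "x \<in> H <#> (g <# K)" "x \<in> H <#> (g' <# K)"
    using meet by blast
  then show ?thesis
    using incl assms(3,4) by blast
qed

text \<open>Two representations h g k of one element differ by an element of \<open>H\<close> that
  lies in g K g^-1, so a trivial intersection makes (h, k) \<mapsto> h g k injective.\<close>

lemma double_coset_card:
  assumes "subgroup H G" "subgroup K G" "g \<in> carrier G" and triv: "H \<inter> conj_set g K = {\<one>}"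
  shows "card (H <#> (g <# K)) = card H * card K"
proof -
  interpret H: subgroup H G by fact
  interpret K: subgroup K G by fact
  let ?f = "\<lambda>(x, y). x \<otimes> (g \<otimes> y)"
  have "H <#> (g <# K) = ?f ` (H \<times> K)"
    by (auto simp: set_mult_def l_coset_def)
  moreover have "inj_on ?f (H \<times> K)"
  proof (rule inj_onI, clarify)
    fix x y x' y'
    assume m: "x \<in> H" "y \<in> K" "x' \<in> H" "y' \<in> K" and eq: "x \<otimes> (g \<otimes> y) = x' \<otimes> (g \<otimes> y')"
    have c: "x \<in> carrier G" "y \<in> carrier G" "x' \<in> carrier G" "y' \<in> carrier G"
      using m by auto
    have "inv g \<otimes> (inv x' \<otimes> x) \<otimes> g = inv g \<otimes> inv x' \<otimes> (x \<otimes> (g \<otimes> y)) \<otimes> inv y"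
      using c assms(3) by (simp add: m_assoc)
    also have "\<dots> = inv g \<otimes> inv x' \<otimes> (x' \<otimes> (g \<otimes> y')) \<otimes> inv y"
      using eq by simp
    also have "\<dots> = y' \<otimes> inv y"
      using c assms(3) by (simp add: m_assoc) (simp add: m_assoc[symmetric])
    finally have "inv x' \<otimes> x \<in> conj_set g K"
      using m c assms(3) by (simp add: mem_conj_set K.subset)
    then have "inv x' \<otimes> x = \<one>"
      using m triv by blast
    then have xx: "x = x'"
      using c by (metis inv_closed inv_equality inv_inv)
    then have "y = y'"
      using eq c assms(3) by simp
    then show "x = x' \<and> y = y'"
      using xx by simp
  qed
  ultimately show ?thesis
    by (simp add: card_image card_cartesian_product)
qed

lemma order3_inter:
  assumes "subgroup H G" "card H = 3" "subgroup K G" "\<not> H \<subseteq> K"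
  shows "H \<inter> K = {\<one>}"
proof -
  interpret H: subgroup H G by fact
  interpret K: subgroup K G by fact
  interpret GH: finite_group "G\<lparr>carrier := H\<rparr>"
    by (rule subgroup_finite_group) fact
  have "subgroup (H \<inter> K) G"
    using assms by (intro subgroups_Inter_pair)
  then have "subgroup (H \<inter> K) (G\<lparr>carrier := H\<rparr>)"
    using assms by (intro subgroup_incl) auto
  then have "card (H \<inter> K) dvd 3"
    using GH.card_subgroup_dvd assms(2) by (simp add: order_def)
  moreover have "card (H \<inter> K) \<noteq> 3"
    using assms(2,4) finite_subset_carrier[OF H.subset] by (metis card_subset_eq inf.absorb_iff1 inf_le1)
  moreover have "\<one> \<in> H \<inter> K"
    by simp
  then have "card (H \<inter> K) \<noteq> 0"
    using finite_subset_carrier[OF H.subset] by (metis card_0_eq empty_iff finite_Int)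
  moreover have "Factorial_Ring.prime (3::nat)"
    by simp
  ultimately have "card (H \<inter> K) = 1"
    by (metis prime_nat_iff)
  then show ?thesis
    using H.one_closed K.one_closed by (metis Int_iff card_1_singletonE singletonD)
qed

text \<open>\<open>U\<close> splits into double cosets H g K, and the condition on g is constant on
  each. Where it holds, the prime order 3 forces \<open>H\<close> to meet g K g^-1 trivially, so the
  double coset has 9 elements.\<close>

lemma double_coset_count:
  assumes H: "subgroup H G" "card H = 3" and K: "subgroup K G" "card K = 3"
    and U: "U \<subseteq> carrier G" "H <#> U = U" "U <#> K = U"
  shows "9 dvd card {g \<in> U. \<not> H \<subseteq> conj_set g K}"
proof -
  interpret H: subgroup H G by fact
  interpret K: subgroup K G by fact
  define V where "V = {g \<in> U. \<not> H \<subseteq> conj_set g K}"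
  have V: "V \<subseteq> carrier G"
    using U(1) by (auto simp: V_def)
  let ?D = "\<lambda>g. H <#> (g <# K)"
  have self: "g \<in> ?D g" if "g \<in> carrier G" for g
    unfolding mem_double_coset using that by (intro bexI[of _ \<one>]) auto
  have conj: "H \<subseteq> conj_set (h \<otimes> (g \<otimes> k)) K \<longleftrightarrow> H \<subseteq> conj_set g K"
    if "g \<in> carrier G" "h \<in> H" "k \<in> K" for g h k
  proof -
    have c: "h \<in> carrier G" "k \<in> carrier G"
      using that by auto
    have step: "H \<subseteq> conj_set (h \<otimes> (g \<otimes> k)) K" if sub: "H \<subseteq> conj_set g K" and g: "g \<in> carrier G" and hk: "h \<in> H" "k \<in> K" for g h k
    proof
      fix x
      assume x: "x \<in> H"
      have c: "h \<in> carrier G" "k \<in> carrier G" "x \<in> carrier G"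
        using hk x by auto
      have "inv h \<otimes> x \<otimes> h \<in> H"
        using x hk by simp
      then have "inv g \<otimes> (inv h \<otimes> x \<otimes> h) \<otimes> g \<in> K"
        using sub g mem_conj_set[OF g K.subset] by blast
      then have "inv k \<otimes> (inv g \<otimes> (inv h \<otimes> x \<otimes> h) \<otimes> g) \<otimes> k \<in> K"
        using hk by simp
      then have "inv (h \<otimes> (g \<otimes> k)) \<otimes> x \<otimes> (h \<otimes> (g \<otimes> k)) \<in> K"
        using c g by (simp add: inv_mult_group m_assoc)
      then show "x \<in> conj_set (h \<otimes> (g \<otimes> k)) K"
        using c g by (simp add: mem_conj_set K.subset)
    qed
    show ?thesis
    proof
      assume "H \<subseteq> conj_set (h \<otimes> (g \<otimes> k)) K"
      then have "H \<subseteq> conj_set (inv h \<otimes> (h \<otimes> (g \<otimes> k) \<otimes> inv k)) K"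
        using step[of "h \<otimes> (g \<otimes> k)" "inv h" "inv k"] that c by simp
      moreover have "inv h \<otimes> (h \<otimes> (g \<otimes> k) \<otimes> inv k) = g"
        using that c by (simp add: m_assoc) (simp add: m_assoc[symmetric])
      ultimately show "H \<subseteq> conj_set g K"
        by simp
    qed (use step that in blast)
  qed
  have D_sub: "?D g \<subseteq> V" if g: "g \<in> V" for g
  proof
    fix x
    assume "x \<in> ?D g"
    then obtain h k where hk: "h \<in> H" "k \<in> K" "x = h \<otimes> (g \<otimes> k)"
      unfolding mem_double_coset by blast
    have "g \<otimes> k \<in> U"
      using g hk(2) U(3) unfolding V_def set_mult_def by blast
    then have "x \<in> U"
      using hk(1,3) U(2) unfolding set_mult_def by blast
    then show "x \<in> V"
      using conj[of g h k] g V hk unfolding V_def by blast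
  qed
  have union: "\<Union> (?D ` V) = V"
    using D_sub self V by blast
  have "9 * card (?D ` V) = card (\<Union> (?D ` V))"
  proof (rule card_partition)
    show "finite (?D ` V)" "finite (\<Union> (?D ` V))"
      using finite_subset_carrier[OF V] union by simp_all
    fix c
    assume "c \<in> ?D ` V"
    then obtain g where g: "g \<in> V" "c = ?D g"
      by blast
    then have gc: "g \<in> carrier G"
      using V by blast
    have "H \<inter> conj_set g K = {\<one>}"
      using order3_inter[OF H subgroup_conj_set(1)[OF K(1) gc]] g(1) by (simp add: V_def)
    then show "card c = 9"
      using double_coset_card[OF H(1) K(1) gc] g(2) H(2) K(2) by simp
    fix d
    assume "d \<in> ?D ` V" "c \<noteq> d"
    then show "c \<inter> d = {}"
      using double_coset_disjoint[OF H(1) K(1)] g gc V by blast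
  qed
  then show ?thesis
    unfolding union V_def[symmetric] by (metis dvd_triv_left)
qed

lemma set_mult_carrier:
  assumes "subgroup H G"
  shows "H <#> carrier G = carrier G" "carrier G <#> H = carrier G"
proof -
  have "\<one> \<in> H"
    using assms by (rule subgroup.one_closed)
  then have "x \<in> H <#> carrier G" "x \<in> carrier G <#> H" if "x \<in> carrier G" for x
    unfolding mem_set_mult using that by (metis l_one, metis r_one)
  moreover have "H <#> carrier G \<subseteq> carrier G" "carrier G <#> H \<subseteq> carrier G"
    using subgroup.subset[OF assms] by (simp_all add: set_mult_closed)
  ultimately show "H <#> carrier G = carrier G" "carrier G <#> H = carrier G"
    by blast+
qed

text \<open>As 9 does not divide 24, not every double coset has 9 elements, and an exceptional g
  conjugates \<open>K\<close> to \<open>H\<close>.\<close>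

lemma order24_conjugate:
  assumes n: "order G = 24" and H: "subgroup H G" "card H = 3" and K: "subgroup K G" "card K = 3"
  obtains g where "g \<in> carrier G" "H = conj_set g K"
proof -
  have "9 dvd card {g \<in> carrier G. \<not> H \<subseteq> conj_set g K}"
    using set_mult_carrier[OF H(1)] set_mult_carrier[OF K(1)] by (intro double_coset_count[OF H K]) simp_all
  moreover have "card (carrier G) = 24"
    using n by (simp add: order_def)
  ultimately have "{g \<in> carrier G. \<not> H \<subseteq> conj_set g K} \<noteq> carrier G"
    by auto
  then obtain g where g: "g \<in> carrier G" "H \<subseteq> conj_set g K"
    by blast
  note c = subgroup_conj_set[OF K(1) g(1)]
  have "H = conj_set g K"
    using g(2) c H(2) K(2) finite_subset_carrier[OF subgroup.subset[OF c(1)]]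
    by (intro card_subset_eq) auto
  then show thesis
    using that g(1) by blast
qed

text \<open>One subgroup of order 3 acts on the right of \<open>A\<close> and on the left of
  \<open>B\<close>, the two sides that face each other in the product A B.\<close>

definition share :: "'a set \<Rightarrow> 'a set \<Rightarrow> bool" where
  "share A B \<longleftrightarrow> (\<exists>H. subgroup H G \<and> card H = 3 \<and> A <#> H = A \<and> H <#> B = B)"

definition index_two_trio :: "'a set \<Rightarrow> 'a set \<Rightarrow> 'a set \<Rightarrow> bool" where
  "index_two_trio A B D \<longleftrightarrow> (\<exists>H p q. subgroup H G \<and> 2 * card H = order G \<and>
     (\<forall>a\<in>A. a \<in> H \<longleftrightarrow> p) \<and> (\<forall>b\<in>B. b \<in> H \<longleftrightarrow> q) \<and> (\<forall>d\<in>D. d \<in> H \<longleftrightarrow> (p \<longleftrightarrow> \<not> q)))"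

lemma index_two_trio_rotate: "index_two_trio B D A \<Longrightarrow> index_two_trio A B D"
  unfolding index_two_trio_def
proof (elim exE conjE)
  fix H q r
  assume a: "subgroup H G" "2 * card H = order G" "\<forall>b\<in>B. b \<in> H \<longleftrightarrow> q" "\<forall>d\<in>D. d \<in> H \<longleftrightarrow> r"
    "\<forall>a\<in>A. a \<in> H \<longleftrightarrow> (q \<longleftrightarrow> \<not> r)"
  have "\<forall>d\<in>D. d \<in> H \<longleftrightarrow> ((q \<longleftrightarrow> \<not> r) \<longleftrightarrow> \<not> q)"
    using a(4) by (cases q; cases r) simp_all
  then show "\<exists>H p q. subgroup H G \<and> 2 * card H = order G \<and>
     (\<forall>a\<in>A. a \<in> H \<longleftrightarrow> p) \<and> (\<forall>b\<in>B. b \<in> H \<longleftrightarrow> q) \<and> (\<forall>d\<in>D. d \<in> H \<longleftrightarrow> (p \<longleftrightarrow> \<not> q))"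
    using a(1,2,3,5)
    by (intro exI[of _ H] exI[of _ "q \<longleftrightarrow> \<not> r"] exI[of _ q] conjI) (assumption+)
qed

text \<open>For n = 24 and k = 9 the atom satisfies (m - 1)|H| \<le> 6 and m|H| \<ge> 9, which
  leaves |H| = 3, m = 3 and |H| = 6, m = 2, both with equality in the growth bound. Equality makes
  \<open>A\<close> or b D invariant, so |H| divides 9 and is 3. Then H B' has only 9 elements and
  equals B'.\<close>

lemma order24_share:
  assumes n: "order G = 24" and t: "trio 9 A B D" and ni: "\<not> index_two_trio A B D"
  shows "(share A B \<or> share B D) \<and> card (A <#> B) = 15"
proof -
  obtain b where b: "b \<in> B"
    using t unfolding trio_def by fastforce
  have sub: "A \<subseteq> carrier G" "B \<subseteq> carrier G" "D \<subseteq> carrier G" "card A = 9" "card B = 9" "card D = 9" "b \<in> carrier G"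
    using t b by (auto simp: trio_def)
  have lt: "order G < 3 * 9"
    using n by simp
  show ?thesis
  proof (rule trio_dichotomy[OF t lt b])
    fix H p q
    assume "subgroup H G" "2 * card H = order G"
      "\<forall>a\<in>A. a \<in> H \<longleftrightarrow> p" "\<forall>b\<in>B. b \<in> H \<longleftrightarrow> q" "\<forall>d\<in>D. d \<in> H \<longleftrightarrow> (p \<longleftrightarrow> \<not> q)"
    then show ?thesis
      using ni unfolding index_two_trio_def by blast
  next
    fix H B' m
    assume H: "subgroup H G" and B': "B' = B #> inv b \<or> B' = set_inv (B #> inv b)" "B' \<subseteq> H <#> B'" "card B' = 9"
      "card (H <#> B') = m * card H"
      and m: "2 \<le> m" "9 \<le> m * card H" "m * card H + 2 * 9 \<le> order G + card H" "card H dvd order G" "m * card H < order G"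
      and fix1: "m * card H + 2 * 9 = order G + card H \<Longrightarrow> B' = B #> inv b \<Longrightarrow> A <#> H = A"
      and fix2: "m * card H + 2 * 9 = order G + card H \<Longrightarrow> B' = set_inv (B #> inv b) \<Longrightarrow> H <#> (b <# D) = b <# D"
      and tight: "m * card H + 2 * 9 = order G + card H \<Longrightarrow> card (A <#> B) + 9 = order G"
    interpret H: subgroup H G by fact
    have le: "card H \<le> 6"
    proof -
      have "2 * card H \<le> m * card H"
        using m(1) by simp
      then show ?thesis
        using m(3) n by linarith
    qed
    have "card H \<in> {1, 2, 3, 4, 5, 6}"
    proof -
      have "card H \<noteq> 0"
        using m(2) by (intro notI) simp
      then show ?thesis
        using le by auto
    qed
    then have cases: "(card H = 3 \<or> card H = 6) \<and> m * card H + 18 = 24 + card H"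
      using m n by auto presburger+
    then have eq: "m * card H + 2 * 9 = order G + card H"
      using n by simp
    have B0: "B #> inv b \<subseteq> carrier G" "card (B #> inv b) = 9" "b <# D \<subseteq> carrier G" "card (b <# D) = 9"
      using sub by (simp_all add: r_coset_subset_G l_coset_subset_G)
    have "card H dvd 9"
    proof (cases "B' = B #> inv b")
      case True
      then have "A <#> H = A"
        using fix1 eq by blast
      then show ?thesis
        using card_dvd_right_invariant[OF H sub(1)] sub(4) by simp
    next
      case False
      then have "H <#> (b <# D) = b <# D"
        using fix2 eq B'(1) by blast
      then show ?thesis
        using card_dvd_left_invariant[OF H B0(3)] B0(4) by simp
    qed
    then have H3: "card H = 3"
      using cases by auto
    then have "card (H <#> B') = card B'"
      using cases B'(3,4) by simp
    moreover have "finite (H <#> B')"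
    proof (rule finite_subset_carrier)
      have "B' \<subseteq> carrier G"
        using B'(1) B0(1) set_inv_subset by metis
      then show "H <#> B' \<subseteq> carrier G"
        by (simp add: set_mult_closed H.subset)
    qed
    ultimately have HB': "H <#> B' = B'"
      using B'(2) by (metis card_subset_eq)
    have "share A B \<or> share B D"
    proof (cases "B' = B #> inv b")
      case True
      have "H <#> B = B"
      proof -
        have "H <#> (B #> inv b) = (H <#> B) #> inv b"
          using sub H.subset by (simp add: setmult_rcos_assoc)
        then have "((H <#> B) #> inv b) #> b = (B #> inv b) #> b"
          using HB' True by simp
        moreover have "H <#> B \<subseteq> carrier G"
          using sub H.subset by (simp add: set_mult_closed)
        ultimately show ?thesis
          using sub by (simp add: coset_mult_assoc)
      qed
      then have "share A B"
        unfolding share_def using H H3 fix1[OF eq True] by blast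
      then show ?thesis ..
    next
      case False
      then have B'_eq: "B' = set_inv (B #> inv b)"
        using B'(1) by blast
      then have HD: "H <#> (b <# D) = b <# D"
        using fix2 eq by blast
      have "set_inv (H <#> set_inv (B #> inv b)) = set_inv (set_inv (B #> inv b))"
        using HB' B'_eq by simp
      then have BH: "(B #> inv b) <#> H = B #> inv b"
        using B0(1) set_inv_set_mult[OF H.subset set_inv_subset[OF B0(1)]] set_inv_subgroup[OF H] by simp
      \<comment> \<open>Invariance of B b^-1 on the right and of b D on the left under
        \<open>H\<close> amounts to invariance of \<open>B\<close> and \<open>D\<close> under b^-1 H
        b.\<close>
      let ?K = "conj_set (inv b) H"
      have K: "subgroup ?K G" "card ?K = 3"
        using subgroup_conj_set[OF H, of "inv b"] sub H3 by simp_all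
      have memK: "x \<in> ?K \<longleftrightarrow> x \<in> carrier G \<and> b \<otimes> x \<otimes> inv b \<in> H" for x
        using mem_conj_set[of "inv b" H x] sub H.subset by simp
      have one_K: "\<one> \<in> ?K"
        using K(1) by (rule subgroup.one_closed)
      have "B <#> ?K = B"
      proof
        show "B \<subseteq> B <#> ?K"
          using one_K sub(2) by (force simp: mem_set_mult)
        show "B <#> ?K \<subseteq> B"
        proof
          fix y
          assume "y \<in> B <#> ?K"
          then obtain u x where ux: "u \<in> B" "x \<in> ?K" "y = u \<otimes> x"
            unfolding mem_set_mult by blast
          have c: "u \<in> carrier G" "x \<in> carrier G"
            using ux memK sub by auto
          have "u \<otimes> inv b \<in> B #> inv b"
            unfolding mem_r_coset using ux by blast
          moreover have "b \<otimes> x \<otimes> inv b \<in> H"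
            using ux memK by blast
          ultimately have "(u \<otimes> inv b) \<otimes> (b \<otimes> x \<otimes> inv b) \<in> (B #> inv b) <#> H"
            unfolding mem_set_mult by blast
          then obtain v where v: "v \<in> B" "(u \<otimes> inv b) \<otimes> (b \<otimes> x \<otimes> inv b) = v \<otimes> inv b"
            unfolding BH mem_r_coset by blast
          have "(u \<otimes> inv b) \<otimes> (b \<otimes> x \<otimes> inv b) = (u \<otimes> x) \<otimes> inv b"
            using c sub by (simp add: m_assoc) (simp add: m_assoc[symmetric])
          then have "u \<otimes> x = v"
            using v sub c by auto
          then show "y \<in> B"
            using v ux by simp
        qed
      qed
      moreover have "?K <#> D = D"
      proof
        show "D \<subseteq> ?K <#> D"
          using one_K sub(3) by (force simp: mem_set_mult)
        show "?K <#> D \<subseteq> D"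
        proof
          fix y
          assume "y \<in> ?K <#> D"
          then obtain u x where ux: "u \<in> D" "x \<in> ?K" "y = x \<otimes> u"
            unfolding mem_set_mult by blast
          have c: "u \<in> carrier G" "x \<in> carrier G"
            using ux memK sub by auto
          have "b \<otimes> u \<in> b <# D"
            unfolding mem_l_coset using ux by blast
          moreover have "b \<otimes> x \<otimes> inv b \<in> H"
            using ux memK by blast
          ultimately have "(b \<otimes> x \<otimes> inv b) \<otimes> (b \<otimes> u) \<in> H <#> (b <# D)"
            unfolding mem_set_mult by blast
          then obtain v where v: "v \<in> D" "(b \<otimes> x \<otimes> inv b) \<otimes> (b \<otimes> u) = b \<otimes> v"
            unfolding HD mem_l_coset by blast
          have "(b \<otimes> x \<otimes> inv b) \<otimes> (b \<otimes> u) = b \<otimes> (x \<otimes> u)"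
            using c sub by (simp add: m_assoc) (simp add: m_assoc[symmetric])
          then have "x \<otimes> u = v"
            using v sub c by auto
          then show "y \<in> D"
            using v ux by simp
        qed
      qed
      ultimately have "share B D"
        unfolding share_def using K by blast
      then show ?thesis ..
    qed
    then show ?thesis
      using tight[OF eq] n by simp
  qed
qed

end

lemma card_Un3:
  assumes "finite A" "finite B" "finite C"
  shows "card (A \<union> B \<union> C) + card (A \<inter> B) + card (A \<inter> C) + card (B \<inter> C) =
    card A + card B + card C + card (A \<inter> B \<inter> C)"
proof -
  have "card (A \<union> B \<union> C) + card ((A \<union> B) \<inter> C) = card (A \<union> B) + card C"
    "card (A \<union> B) + card (A \<inter> B) = card A + card B"
    using assms by (metis card_Un_Int finite_Un)+
  moreover have "card ((A \<union> B) \<inter> C) + card (A \<inter> B \<inter> C) = card (A \<inter> C) + card (B \<inter> C)"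
  proof -
    have "(A \<union> B) \<inter> C = (A \<inter> C) \<union> (B \<inter> C)" "A \<inter> B \<inter> C = (A \<inter> C) \<inter> (B \<inter> C)"
      by auto
    then show ?thesis
      using assms by (metis card_Un_Int finite_Int)
  qed
  ultimately show ?thesis
    by linarith
qed

context finite_group
begin

lemma subset_set_mult:
  assumes "\<one> \<in> H" "U \<subseteq> carrier G"
  shows "U \<subseteq> H <#> U" "U \<subseteq> U <#> H"
proof -
  have "x \<in> H <#> U" "x \<in> U <#> H" if "x \<in> U" for x
    unfolding mem_set_mult using that assms by (metis l_one subsetD, metis r_one subsetD)
  then show "U \<subseteq> H <#> U" "U \<subseteq> U <#> H"
    by blast+
qed

text \<open>The normaliser of \<open>H\<close>.\<close>

definition normalizing :: "'a set \<Rightarrow> 'a set" where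
  "normalizing H = {g \<in> carrier G. \<forall>x\<in>carrier G. x \<in> H \<longleftrightarrow> inv g \<otimes> x \<otimes> g \<in> H}"

lemma subgroup_normalizing: "subgroup (normalizing H) G"
proof (rule subgroupI)
  have "\<one> \<in> normalizing H"
    by (simp add: normalizing_def)
  then show "normalizing H \<noteq> {}"
    by blast
  fix g
  assume g: "g \<in> normalizing H"
  then have gc: "g \<in> carrier G"
    by (simp add: normalizing_def)
  have "x \<in> H \<longleftrightarrow> inv (inv g) \<otimes> x \<otimes> inv g \<in> H" if x: "x \<in> carrier G" for x
  proof -
    have "g \<otimes> x \<otimes> inv g \<in> H \<longleftrightarrow> inv g \<otimes> (g \<otimes> x \<otimes> inv g) \<otimes> g \<in> H"
      using g x gc unfolding normalizing_def by blast
    moreover have "inv g \<otimes> (g \<otimes> x \<otimes> inv g) \<otimes> g = x"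
      using x gc by (simp add: m_assoc) (simp add: m_assoc[symmetric])
    ultimately show ?thesis
      using gc by simp
  qed
  then show "inv g \<in> normalizing H"
    using gc by (simp add: normalizing_def)
  fix k
  assume k: "k \<in> normalizing H"
  then have kc: "k \<in> carrier G"
    by (simp add: normalizing_def)
  have "x \<in> H \<longleftrightarrow> inv (g \<otimes> k) \<otimes> x \<otimes> (g \<otimes> k) \<in> H" if x: "x \<in> carrier G" for x
  proof -
    have "x \<in> H \<longleftrightarrow> inv g \<otimes> x \<otimes> g \<in> H"
      using g x unfolding normalizing_def by blast
    also have "\<dots> \<longleftrightarrow> inv k \<otimes> (inv g \<otimes> x \<otimes> g) \<otimes> k \<in> H"
      using k x gc unfolding normalizing_def by blast
    finally show ?thesis
      using x gc kc by (simp add: inv_mult_group m_assoc)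
  qed
  then show "g \<otimes> k \<in> normalizing H"
    using gc kc by (simp add: normalizing_def)
qed (auto simp: normalizing_def)

lemma normalizing_iff:
  assumes H: "subgroup H G" and g: "g \<in> carrier G"
  shows "H \<subseteq> conj_set g H \<longleftrightarrow> g \<in> normalizing H"
proof
  assume sub: "H \<subseteq> conj_set g H"
  have "conj_set g H = H"
    using subgroup_conj_set[OF H g] sub finite_subset_carrier[OF subgroup.subset]
    by (metis card_subset_eq)
  then show "g \<in> normalizing H"
    using mem_conj_set[OF g subgroup.subset[OF H]] g unfolding normalizing_def by blast
next
  assume "g \<in> normalizing H"
  then show "H \<subseteq> conj_set g H"
    using mem_conj_set[OF g subgroup.subset[OF H]] subgroup.subset[OF H] unfolding normalizing_def by blast
qed

lemma subgroup_le_normalizing: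
  assumes H: "subgroup H G"
  shows "H \<subseteq> normalizing H"
proof
  interpret H: subgroup H G by fact
  fix h
  assume h: "h \<in> H"
  have "x \<in> H" if x: "x \<in> carrier G" "inv h \<otimes> x \<otimes> h \<in> H" for x
  proof -
    have "h \<otimes> (inv h \<otimes> x \<otimes> h) \<otimes> inv h \<in> H"
      using h x by simp
    moreover have "h \<otimes> (inv h \<otimes> x \<otimes> h) \<otimes> inv h = x"
      using h x by (simp add: m_assoc) (simp add: m_assoc[symmetric])
    ultimately show ?thesis
      by simp
  qed
  moreover have "h \<in> carrier G" "inv h \<otimes> x \<otimes> h \<in> H" if "x \<in> H" for x
    using h that by simp_all
  ultimately show "h \<in> normalizing H"
    using h H.mem_carrier unfolding normalizing_def by blast
qed

text \<open>The elements outside the normaliser form double cosets of 9 elements, so its order is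
  24, 15 or 6, and 15 does not divide 24.\<close>

lemma order24_card_normalizing:
  assumes n: "order G = 24" and H: "subgroup H G" "card H = 3"
  shows "card (normalizing H) = 6 \<or> normalizing H = carrier G"
proof -
  let ?N = "normalizing H"
  have "9 dvd card {g \<in> carrier G. \<not> H \<subseteq> conj_set g H}"
  proof (rule double_coset_count[OF H H])
    show "H <#> carrier G = carrier G" "carrier G <#> H = carrier G"
      using set_mult_carrier[OF H(1)] by simp_all
  qed simp
  moreover have "{g \<in> carrier G. \<not> H \<subseteq> conj_set g H} = carrier G - ?N"
    using normalizing_iff[OF H(1)] by blast
  moreover have sub: "?N \<subseteq> carrier G"
    by (auto simp: normalizing_def)
  moreover have "card (carrier G - ?N) + card ?N = 24"
    using n card_mono[OF finite_carrier sub] sub by (simp add: card_Diff_subset finite_subset_carrier order_def)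
  moreover have "card ?N dvd 24"
    using card_subgroup_dvd[OF subgroup_normalizing] n by simp
  moreover have "card (carrier G - ?N) = 24 - card ?N" "card ?N \<le> 24"
    using calculation(4) by linarith+
  ultimately have "9 dvd 24 - card ?N" "card ?N dvd 24" "card ?N \<le> 24"
    by argo+
  then have "card ?N = 6 \<or> card ?N = 24"
  proof -
    assume a: "9 dvd 24 - card ?N" "card ?N dvd 24" "card ?N \<le> 24"
    then obtain q where q: "24 - card ?N = 9 * q"
      by (elim dvdE)
    then have "9 * q \<le> 24"
      by linarith
    then have "q = 0 \<or> q = 1 \<or> q = 2"
      by linarith
    moreover have "card ?N = 24 - 9 * q"
      using q a(3) by linarith
    ultimately have "card ?N = 24 \<or> card ?N = 15 \<or> card ?N = 6"
      by (elim disjE) simp_all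
    moreover have "\<not> (15::nat) dvd 24"
      by simp
    ultimately show ?thesis
      using a(2) by auto
  qed
  moreover have "?N = carrier G" if "card ?N = 24"
    using that sub n by (intro card_subset_eq) (auto simp: order_def)
  ultimately show ?thesis
    by blast
qed

text \<open>\<open>A\<close> consists of three left cosets of \<open>H\<close>, so A B is a union of
  three translates of \<open>B\<close>. Because \<open>B\<close> turns out to be one double coset,
  the overlaps of its translates can take very few sizes, and none of them is compatible with a
  union of 15 elements.\<close>

lemma order24_nonnormal:
  assumes n: "order G = 24" and H: "subgroup H G" "card H = 3"
    and A: "A \<subseteq> carrier G" "card A = 9" "A <#> H = A"
    and B: "B \<subseteq> carrier G" "card B = 9" "H <#> B = B" "B <#> H = B"
    and AB: "card (A <#> B) = 15" and N6: "card (normalizing H) = 6"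
  shows False
proof -
  interpret H: subgroup H G by fact
  define N where "N = normalizing H"
  have N: "subgroup N G"
    unfolding N_def by (rule subgroup_normalizing)
  interpret N: subgroup N G by fact
  have fin: "finite U" if "U \<subseteq> carrier G" for U
    using that by (rule finite_subset_carrier)
  have HN: "H \<subseteq> N"
    unfolding N_def by (rule subgroup_le_normalizing) fact
  have conj1: "inv g \<otimes> x \<otimes> g \<in> H" if "g \<in> N" "x \<in> H" for g x
    using that H.mem_carrier unfolding N_def normalizing_def by blast
  have conj2: "g \<otimes> x \<otimes> inv g \<in> H" if "g \<in> N" "x \<in> H" for g x
    using conj1[of "inv g" x] that N.mem_carrier by simp
  have hB: "h \<otimes> b \<in> B" "b \<otimes> h \<in> B" if "h \<in> H" "b \<in> B" for h b
    using that B(3,4) unfolding set_mult_def by blast+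
  have V: "{g \<in> B. \<not> H \<subseteq> conj_set g H} = B - N"
    using normalizing_iff[OF H(1)] B(1) unfolding N_def by blast
  \<comment> \<open>\<open>B\<close> has 9 elements and does not fit into the normaliser, which has
    6. So it avoids the normaliser entirely and is a single double coset of
    \<open>H\<close>.\<close>
  have "9 dvd card (B - N)"
    using double_coset_count[OF H H B(1,3,4)] unfolding V .
  moreover have "card (B - N) \<le> 9"
    using B(1,2) fin by (metis Diff_subset card_mono)
  moreover have "card (B - N) \<noteq> 0"
  proof
    assume "card (B - N) = 0"
    then have "B \<subseteq> N"
      using fin[of B] B(1) by simp
    then show False
      using card_mono[OF fin[OF N.subset], of B] B(2) N6 by (simp add: N_def)
  qed
  ultimately have "card (B - N) = 9"
    by auto
  then have "B - N = B"
    using B(1,2) fin by (metis Diff_subset card_subset_eq)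
  then have BN: "B \<inter> N = {}"
    by blast
  have B_double: "B = H <#> (b <# H)" if b: "b \<in> B" for b
  proof -
    have bc: "b \<in> carrier G"
      using b B(1) by blast
    have "\<not> H \<subseteq> conj_set b H"
      using b BN normalizing_iff[OF H(1) bc] unfolding N_def by blast
    then have "card (H <#> (b <# H)) = 9"
      using double_coset_card[OF H(1) H(1) bc] order3_inter[OF H subgroup_conj_set(1)[OF H(1) bc]] H(2) by simp
    moreover have "H <#> (b <# H) \<subseteq> B"
      using hB b by (auto simp: mem_double_coset)
    ultimately show ?thesis
      using B(1,2) fin by (metis card_subset_eq)
  qed
  have B_mem: "\<exists>h\<in>H. \<exists>k\<in>H. x = h \<otimes> (b \<otimes> k)" if b: "b \<in> B" and x: "x \<in> B" for b x
  proof -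
    have "x \<in> H <#> (b <# H)"
      by (subst B_double[OF b, symmetric]) (rule x)
    then show ?thesis
      unfolding mem_double_coset .
  qed
  have "\<not> N \<subseteq> H"
    using card_mono[OF fin[OF H.subset], of N] N6 H(2) by (auto simp: N_def)
  then obtain z where z: "z \<in> N" "z \<notin> H"
    by blast
  have zc: "z \<in> carrier G"
    using z N.mem_carrier by blast
  have zH: "N = H \<union> (z <# H)" "N = H \<union> (H #> z)"
  proof -
    have l: "H \<inter> (z <# H) = {}"
    proof (rule ccontr)
      assume "H \<inter> (z <# H) \<noteq> {}"
      then obtain h where "h \<in> H" "z \<otimes> h \<in> H"
        by (auto simp: mem_l_coset)
      then have "z \<otimes> h \<otimes> inv h \<in> H"
        by simp
      then show False
        using z zc \<open>h \<in> H\<close> by (simp add: m_assoc)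
    qed
    have r: "H \<inter> (H #> z) = {}"
    proof (rule ccontr)
      assume "H \<inter> (H #> z) \<noteq> {}"
      then obtain h where "h \<in> H" "h \<otimes> z \<in> H"
        by (auto simp: mem_r_coset)
      then have "inv h \<otimes> (h \<otimes> z) \<in> H"
        by simp
      then show False
        using z zc \<open>h \<in> H\<close> by (simp add: m_assoc[symmetric])
    qed
    have sub: "H \<union> (z <# H) \<subseteq> N" "H \<union> (H #> z) \<subseteq> N"
      using HN z(1) by (auto simp: mem_l_coset mem_r_coset subset_iff)
    have "card (H \<union> (z <# H)) = 6" "card (H \<union> (H #> z)) = 6"
      using l r H(2) zc fin[OF H.subset] fin[OF l_coset_subset_G[OF H.subset zc]] fin[OF r_coset_subset_G[OF H.subset zc]]
      by (simp_all add: card_Un_disjoint H.subset)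
    then show "N = H \<union> (z <# H)" "N = H \<union> (H #> z)"
      using sub N6 fin[OF N.subset] unfolding N_def by (metis card_subset_eq)+
  qed
  \<comment> \<open>If z moved one element of \<open>B\<close> into \<open>B\<close>, it would move
    all of them, and \<open>B\<close> would be a union of cosets of the normaliser; but 6 does not
    divide 9. The same argument works on the right.\<close>
  have zB: "z \<otimes> u \<notin> B" if u: "u \<in> B" for u
  proof
    assume zu: "z \<otimes> u \<in> B"
    have zx: "z \<otimes> x \<in> B" if x: "x \<in> B" for x
    proof -
      obtain h k where hk: "h \<in> H" "k \<in> H" "x = h \<otimes> (u \<otimes> k)"
        using B_mem[OF u x] by blast
      have c: "h \<in> carrier G" "k \<in> carrier G" "u \<in> carrier G"
        using hk u B(1) by auto
      have "z \<otimes> x = (z \<otimes> h \<otimes> inv z) \<otimes> ((z \<otimes> u) \<otimes> k)"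
        using c zc hk(3) by (simp add: m_assoc) (simp add: m_assoc[symmetric])
      then show ?thesis
        using hB conj2[OF z(1) hk(1)] hk(2) zu by simp
    qed
    have "N <#> B = B"
    proof
      show "N <#> B \<subseteq> B"
      proof
        fix y
        assume "y \<in> N <#> B"
        then obtain g b where gb: "g \<in> N" "b \<in> B" "y = g \<otimes> b"
          by (auto simp: mem_set_mult)
        have bc: "b \<in> carrier G"
          using gb B(1) by blast
        from gb(1) show "y \<in> B"
          unfolding zH(1)
        proof
          assume "g \<in> z <# H"
          then obtain h where h: "h \<in> H" "g = z \<otimes> h"
            by (auto simp: mem_l_coset)
          then have "y = z \<otimes> (h \<otimes> b)"
            using gb zc bc by (simp add: m_assoc)
          then show ?thesis
            using zx hB h gb by simp
        qed (use hB gb in blast)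
      qed
      show "B \<subseteq> N <#> B"
        using N.one_closed B(1) by (rule subset_set_mult)
    qed
    then show False
      using card_dvd_left_invariant[OF N B(1)] B(2) N6 unfolding N_def by simp
  qed
  have Bz: "u \<otimes> z \<notin> B" if u: "u \<in> B" for u
  proof
    assume uz: "u \<otimes> z \<in> B"
    have xz: "x \<otimes> z \<in> B" if x: "x \<in> B" for x
    proof -
      obtain h k where hk: "h \<in> H" "k \<in> H" "x = h \<otimes> (u \<otimes> k)"
        using B_mem[OF u x] by blast
      have c: "h \<in> carrier G" "k \<in> carrier G" "u \<in> carrier G"
        using hk u B(1) by auto
      have "x \<otimes> z = h \<otimes> ((u \<otimes> z) \<otimes> (inv z \<otimes> k \<otimes> z))"
        using c zc hk(3) by (simp add: m_assoc) (simp add: m_assoc[symmetric])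
      then show ?thesis
        using hB conj1[OF z(1) hk(2)] hk(1) uz by simp
    qed
    have "B <#> N = B"
    proof
      show "B <#> N \<subseteq> B"
      proof
        fix y
        assume "y \<in> B <#> N"
        then obtain g b where gb: "g \<in> N" "b \<in> B" "y = b \<otimes> g"
          by (auto simp: mem_set_mult)
        have bc: "b \<in> carrier G"
          using gb B(1) by blast
        from gb(1) show "y \<in> B"
          unfolding zH(2)
        proof
          assume "g \<in> H #> z"
          then obtain h where h: "h \<in> H" "g = h \<otimes> z"
            by (auto simp: mem_r_coset)
          then have "y = (b \<otimes> h) \<otimes> z"
            using gb zc bc by (simp add: m_assoc)
          then show ?thesis
            using xz hB h gb by simp
        qed (use hB gb in blast)
      qed
      show "B \<subseteq> B <#> N"
        using N.one_closed B(1) by (rule subset_set_mult)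
    qed
    then show False
      using card_dvd_right_invariant[OF N B(1)] B(2) N6 unfolding N_def by simp
  qed
  define Z where "Z = z <# B"
  have Z: "Z \<subseteq> carrier G" "card Z = 9" "Z \<inter> B = {}" "Z \<inter> N = {}"
  proof -
    show "Z \<subseteq> carrier G" "card Z = 9"
      using zc B by (simp_all add: Z_def l_coset_subset_G)
    show "Z \<inter> B = {}"
      using zB by (auto simp: Z_def mem_l_coset)
    have zb: "b \<in> N" if "z \<otimes> b \<in> N" "b \<in> B" for b
    proof -
      have "inv z \<otimes> (z \<otimes> b) \<in> N"
        using that z(1) by simp
      moreover have "inv z \<otimes> (z \<otimes> b) = b"
        using zc that(2) B(1) by (simp add: m_assoc[symmetric] subset_iff)
      ultimately show ?thesis
        by simp
    qed
    show "Z \<inter> N = {}"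
    proof (rule ccontr)
      assume "Z \<inter> N \<noteq> {}"
      then obtain b where "b \<in> B" "z \<otimes> b \<in> N"
        unfolding Z_def l_coset_def by blast
      then show False
        using zb BN by blast
    qed
  qed
  have carrier: "carrier G = N \<union> B \<union> Z"
  proof -
    have "card (N \<union> B \<union> Z) = 24"
      using Z BN B(1,2) N6 fin[OF N.subset] fin[OF B(1)] fin[OF Z(1)] unfolding N_def[symmetric]
      by (subst card_Un_disjoint; (subst card_Un_disjoint)?) auto
    then show ?thesis
      using N.subset B(1) Z(1) n by (intro card_subset_eq[symmetric]) (auto simp: order_def)
  qed
  \<comment> \<open>The overlap function is constant on double cosets of \<open>H\<close>. It is 9
    on \<open>H\<close>, 0 on the rest of \<open>N\<close>, and constant on each of \<open>B\<close>
    and \<open>Z\<close>, which together with \<open>N\<close> exhaust the group.\<close>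
  define C where "C x = card (B \<inter> (x <# B))" for x
  have hB_eq: "h <# B = B" if h: "h \<in> H" for h
    using hB h H.mem_carrier[OF h] B(1) fin[OF B(1)] by (intro card_subset_eq) (auto simp: mem_l_coset)
  have assoc: "(x \<otimes> y) <# B = x <# (y <# B)" if "x \<in> carrier G" "y \<in> carrier G" for x y
    using that B(1) by (simp add: lcos_m_assoc)
  have C_right: "C (x \<otimes> h) = C x" if "x \<in> carrier G" "h \<in> H" for x h
    using that assoc hB_eq by (simp add: C_def)
  have int: "(g <# U) \<inter> (g <# V) = g <# (U \<inter> V)" if "g \<in> carrier G" "U \<subseteq> carrier G" "V \<subseteq> carrier G" for g U V
    using that by (auto simp: mem_l_coset subset_iff)
  have C_left: "C (h \<otimes> x) = C x" if x: "x \<in> carrier G" and h: "h \<in> H" for x h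
  proof -
    have "B \<inter> ((h \<otimes> x) <# B) = (h <# B) \<inter> (h <# (x <# B))"
      using x h hB_eq assoc by simp
    also have "\<dots> = h <# (B \<inter> (x <# B))"
      using x h B(1) by (intro int) (auto simp: l_coset_subset_G)
    finally show ?thesis
      using h B(1) by (simp add: C_def le_infI1)
  qed
  have C_H: "C x = 9" if "x \<in> H" for x
    using hB_eq[OF that] B(2) by (simp add: C_def)
  have C_N: "C x = 0" if x: "x \<in> N" "x \<notin> H" for x
  proof -
    obtain h where h: "h \<in> H" "x = z \<otimes> h"
      using x zH(1) by (auto simp: mem_l_coset)
    then have "C x = C z"
      using C_right zc by simp
    also have "\<dots> = 0"
      using Z(3) by (simp add: C_def Z_def Int_commute)
    finally show ?thesis .
  qed
  have "B \<noteq> {}"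
    using B(2) by auto
  then obtain b0 where b0: "b0 \<in> B"
    by blast
  have b0c: "b0 \<in> carrier G"
    using b0 B(1) by blast
  have C_B: "C x = C b0" if xB: "x \<in> B" for x
  proof -
    obtain h k where hk: "h \<in> H" "k \<in> H" "x = h \<otimes> (b0 \<otimes> k)"
      using B_mem[OF b0 xB] by blast
    then show ?thesis
      using C_left[of "b0 \<otimes> k" h] C_right[of b0 k] b0c by simp
  qed
  have C_Z: "C x = C (z \<otimes> b0)" if xZ: "x \<in> Z" for x
  proof -
    obtain b where b: "b \<in> B" "x = z \<otimes> b"
      using xZ by (auto simp: Z_def mem_l_coset)
    then obtain h k where hk: "h \<in> H" "k \<in> H" "x = z \<otimes> (h \<otimes> (b0 \<otimes> k))"
      using B_mem[OF b0 b(1)] by blast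
    have c: "h \<in> carrier G" "k \<in> carrier G"
      using hk by auto
    have "x = (z \<otimes> h \<otimes> inv z) \<otimes> ((z \<otimes> b0) \<otimes> k)"
      using c zc b0c hk(3) by (simp add: m_assoc) (simp add: m_assoc[symmetric])
    then show ?thesis
      using C_left[of "(z \<otimes> b0) \<otimes> k"] C_right[of "z \<otimes> b0" k] conj2[OF z(1) hk(1)] hk(2) c zc b0c by simp
  qed
  \<comment> \<open>Double counting: each b in \<open>B\<close> lies in x B for exactly nine x,
    namely those of the form b u^-1 with u in \<open>B\<close>.\<close>
  have C_sum: "(\<Sum>x\<in>carrier G. C x) = 81"
  proof -
    have "C x = (\<Sum>b\<in>B. of_bool (b \<in> x <# B))" for x
      using fin[OF B(1)] by (simp add: C_def of_bool_def sum.If_cases Int_def)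
    then have "(\<Sum>x\<in>carrier G. C x) = (\<Sum>x\<in>carrier G. \<Sum>b\<in>B. of_bool (b \<in> x <# B))"
      by simp
    also have "\<dots> = (\<Sum>b\<in>B. \<Sum>x\<in>carrier G. of_bool (b \<in> x <# B))"
      by (rule sum.swap)
    also have "\<dots> = (\<Sum>b\<in>B. 9)"
    proof (rule sum.cong)
      fix b
      assume b: "b \<in> B"
      then have bc: "b \<in> carrier G"
        using B(1) by blast
      have eq: "b \<in> x <# B \<longleftrightarrow> x \<in> (\<lambda>u. b \<otimes> inv u) ` B" if x: "x \<in> carrier G" for x
      proof -
        have "b = x \<otimes> u \<longleftrightarrow> x = b \<otimes> inv u" if "u \<in> B" for u
          using that x bc B(1) by (metis inv_solve_right subsetD)
        then show ?thesis
          by (auto simp: mem_l_coset)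
      qed
      have "(\<Sum>x\<in>carrier G. of_bool (b \<in> x <# B) :: nat) = card ((\<lambda>u. b \<otimes> inv u) ` B)"
      proof -
        have "(\<Sum>x\<in>carrier G. of_bool (b \<in> x <# B) :: nat) = (\<Sum>x\<in>(\<lambda>u. b \<otimes> inv u) ` B. 1)"
          using eq bc B(1) by (intro sum.mono_neutral_cong_right) auto
        then show ?thesis
          by simp
      qed
      also have "\<dots> = 9"
      proof -
        have "inj_on (\<lambda>u. b \<otimes> inv u) B"
          using bc B(1) by (intro inj_onI) (metis inv_closed inv_inv l_cancel subsetD)
        then show ?thesis
          using B(2) by (simp add: card_image)
      qed
      finally show "(\<Sum>x\<in>carrier G. of_bool (b \<in> x <# B) :: nat) = 9" .
    qed simp
    finally show ?thesis
      using B(2) by simp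
  qed
  define c1 c2 where "c1 = C b0" and "c2 = C (z \<otimes> b0)"
  have "(\<Sum>x\<in>carrier G. C x) = (\<Sum>x\<in>N. C x) + (\<Sum>x\<in>B. C x) + (\<Sum>x\<in>Z. C x)"
    unfolding carrier using Z BN fin[OF N.subset] fin[OF B(1)] fin[OF Z(1)]
    by (subst sum.union_disjoint; (subst sum.union_disjoint)?) auto
  moreover have "(\<Sum>x\<in>N. C x) = 27"
  proof -
    have "(\<Sum>x\<in>N. C x) = (\<Sum>x\<in>H. C x)"
      using HN C_N fin[OF N.subset] by (intro sum.mono_neutral_right) auto
    then show ?thesis
      using C_H H(2) by simp
  qed
  moreover have "(\<Sum>x\<in>B. C x) = 9 * c1" "(\<Sum>x\<in>Z. C x) = 9 * c2"
    using C_B C_Z B(2) Z(2) by (simp_all add: c1_def c2_def)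
  ultimately have c_sum: "c1 + c2 = 6"
    using C_sum by linarith
  have C_dvd: "3 dvd C x" if x: "x \<in> carrier G" for x
  proof -
    let ?U = "B \<inter> (x <# B)"
    have "?U <#> H = ?U"
    proof
      show "?U \<subseteq> ?U <#> H"
        using H.one_closed B(1) by (intro subset_set_mult) auto
      show "?U <#> H \<subseteq> ?U"
      proof
        fix y
        assume "y \<in> ?U <#> H"
        then obtain b u h where u: "b \<in> B" "u \<in> B" "b = x \<otimes> u" "h \<in> H" "y = b \<otimes> h"
          by (auto simp: mem_set_mult mem_l_coset)
        then have "y = x \<otimes> (u \<otimes> h)"
          using x B(1) H.mem_carrier by (auto simp: m_assoc)
        then have "y \<in> x <# B"
          unfolding mem_l_coset using hB(2)[OF u(4,2)] by blast
        moreover have "y \<in> B"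
          using hB(2)[OF u(4,1)] u(5) by simp
        ultimately show "y \<in> ?U"
          by blast
      qed
    qed
    then show ?thesis
      using card_dvd_right_invariant[OF H(1), of ?U] B(1) H(2) by (auto simp: C_def)
  qed
  have pair: "card ((a <# B) \<inter> (a' <# B)) = C (inv a \<otimes> a')" if a: "a \<in> carrier G" "a' \<in> carrier G" for a a'
  proof -
    have "a' <# B = a <# ((inv a \<otimes> a') <# B)"
      using a assoc[of a "inv a \<otimes> a'"] by (simp add: m_assoc[symmetric])
    then have "(a <# B) \<inter> (a' <# B) = a <# (B \<inter> ((inv a \<otimes> a') <# B))"
      using a B(1) int[of a B "(inv a \<otimes> a') <# B"] by (simp add: l_coset_subset_G)
    then show ?thesis
      using a B(1) by (simp add: C_def le_infI1)
  qed
  have fin_AB: "finite (A <#> B)"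
    using A(1) B(1) by (intro fin set_mult_closed)
  have aB: "a <# B \<subseteq> A <#> B" if "a \<in> A" for a
    using that unfolding l_coset_def set_mult_def by blast
  have card_aB: "card (a <# B) = 9" if "a \<in> A" for a
    using that A(1) B by auto
  \<comment> \<open>Two translates of size 9 inside the 15 elements of A B overlap in at least 3.
    Overlaps vanish on \<open>N\<close> outside \<open>H\<close>, so the difference of two coset
    representatives is not in \<open>N\<close>.\<close>
  have C_pair: "C (inv a \<otimes> a') = c1 \<or> C (inv a \<otimes> a') = c2" "3 \<le> C (inv a \<otimes> a')" "inv a \<otimes> a' \<notin> N"
    if a: "a \<in> A" "a' \<in> A" "a' \<notin> a <# H" for a a'
  proof -
    have ac: "a \<in> carrier G" "a' \<in> carrier G"
      using a A(1) by auto
    have "card ((a <# B) \<union> (a' <# B)) \<le> 15"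
      using aB a fin_AB AB by (metis Un_least card_mono)
    moreover have "card ((a <# B) \<union> (a' <# B)) + card ((a <# B) \<inter> (a' <# B)) = 9 + 9"
      using card_aB a ac B(1) by (metis card_Un_Int fin l_coset_subset_G)
    ultimately show ge: "3 \<le> C (inv a \<otimes> a')"
      using pair[OF ac] by linarith
    have "inv a \<otimes> a' \<notin> H"
    proof
      assume "inv a \<otimes> a' \<in> H"
      moreover have "a' = a \<otimes> (inv a \<otimes> a')"
        using ac by (simp add: m_assoc[symmetric])
      ultimately show False
        using a(3) unfolding mem_l_coset by blast
    qed
    then show nN: "inv a \<otimes> a' \<notin> N"
      using C_N ge by force
    have "inv a \<otimes> a' \<in> B \<union> Z"
      using carrier nN ac by (metis UnE UnI1 UnI2 inv_closed m_closed)
    then show "C (inv a \<otimes> a') = c1 \<or> C (inv a \<otimes> a') = c2"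
      using C_B C_Z by (auto simp: c1_def c2_def)
  qed
  have coset_A: "a <# H \<subseteq> A" "card (a <# H) = 3" if "a \<in> A" for a
  proof -
    have "a <# H \<subseteq> A <#> H"
      using that unfolding l_coset_def set_mult_def by blast
    then show "a <# H \<subseteq> A"
      using A(3) by simp
    show "card (a <# H) = 3"
      using that A(1) H(2) H.subset by (simp add: subset_iff)
  qed
  have ne: "A - U \<noteq> {}" if "card U < 9" "finite U" for U
    using that A(2) card_mono[of U A] by auto
  have "A \<noteq> {}"
    using A(2) by auto
  then obtain a1 where a1: "a1 \<in> A"
    by blast
  obtain a2 where a2: "a2 \<in> A" "a2 \<notin> a1 <# H"
  proof -
    have "finite (a1 <# H)"
      using coset_A(1)[OF a1] A(1) fin by (meson subset_trans)
    then have "A - (a1 <# H) \<noteq> {}"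
      using coset_A(2)[OF a1] by (intro ne) auto
    then show thesis
      using that by blast
  qed
  obtain a3 where a3: "a3 \<in> A" "a3 \<notin> a1 <# H" "a3 \<notin> a2 <# H"
  proof -
    have "card ((a1 <# H) \<union> (a2 <# H)) \<le> 6"
      using card_Un_le[of "a1 <# H" "a2 <# H"] coset_A a1 a2 by simp
    moreover have "finite ((a1 <# H) \<union> (a2 <# H))"
      using coset_A a1 a2 A(1) fin by (meson finite_Un subset_trans)
    ultimately have "A - ((a1 <# H) \<union> (a2 <# H)) \<noteq> {}"
      by (intro ne) auto
    then show thesis
      using that by blast
  qed
  have ac: "a1 \<in> carrier G" "a2 \<in> carrier G" "a3 \<in> carrier G"
    using a1 a2 a3 A(1) by auto
  note p12 = C_pair[OF a1 a2] and p13 = C_pair[OF a1 a3(1,2)] and p23 = C_pair[OF a2(1) a3(1,3)]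
  have disj: "(a <# K) \<inter> (a' <# K) = {}"
    if K: "subgroup K G" and a: "a \<in> carrier G" "a' \<in> carrier G" "inv a \<otimes> a' \<notin> K" for a a' K
  proof (rule ccontr)
    interpret K: subgroup K G by fact
    assume "(a <# K) \<inter> (a' <# K) \<noteq> {}"
    then obtain h k where hk: "h \<in> K" "k \<in> K" "a \<otimes> h = a' \<otimes> k"
      by (auto simp: mem_l_coset)
    then have "a' = a \<otimes> h \<otimes> inv k"
      using a(1,2) K.mem_carrier by (metis inv_solve_right m_closed)
    then have "inv a \<otimes> a' = h \<otimes> inv k"
      using a(1,2) hk(1,2) K.mem_carrier by (simp add: m_assoc) (simp add: m_assoc[symmetric])
    then show False
      using a(3) hk(1,2) by simp
  qed
  define X1 X2 X3 where "X1 = a1 <# B" and "X2 = a2 <# B" and "X3 = a3 <# B"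
  have X_carrier: "X1 \<subseteq> carrier G" "X2 \<subseteq> carrier G" "X3 \<subseteq> carrier G"
    using ac B(1) by (simp_all add: X1_def X2_def X3_def l_coset_subset_G)
  have X_card: "card X1 = 9" "card X2 = 9" "card X3 = 9"
    using card_aB a1 a2 a3 by (simp_all add: X1_def X2_def X3_def)
  have "X1 \<union> X2 \<union> X3 = A <#> B"
  proof
    show "X1 \<union> X2 \<union> X3 \<subseteq> A <#> B"
      using aB a1 a2 a3 by (simp add: X1_def X2_def X3_def)
    have notH: "inv a \<otimes> a' \<notin> H" if "inv a \<otimes> a' \<notin> N" for a a'
      using that HN by blast
    have d: "(a1 <# H) \<inter> (a2 <# H) = {}" "((a1 <# H) \<union> (a2 <# H)) \<inter> (a3 <# H) = {}"
      using disj[OF H(1) ac(1,2)] disj[OF H(1) ac(1,3)] disj[OF H(1) ac(2,3)] notH p12(3) p13(3) p23(3) by blast+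
    have f: "finite (a1 <# H)" "finite (a2 <# H)" "finite (a3 <# H)"
      using coset_A a1 a2 a3 A(1) fin by (meson subset_trans)+
    have "card ((a1 <# H) \<union> (a2 <# H) \<union> (a3 <# H)) = 9"
      using d f coset_A(2) a1 a2 a3 by (simp add: card_Un_disjoint)
    then have A_eq: "(a1 <# H) \<union> (a2 <# H) \<union> (a3 <# H) = A"
      using coset_A(1) a1 a2 a3 A(1,2) fin by (intro card_subset_eq) auto
    have "a <# B \<subseteq> a' <# B" if a: "a \<in> a' <# H" "a' \<in> carrier G" for a a'
    proof -
      obtain h where "h \<in> H" "a = a' \<otimes> h"
        using a(1) by (auto simp: mem_l_coset)
      then show ?thesis
        using assoc[OF a(2), of h] hB_eq by simp
    qed
    then have "a <# B \<subseteq> X1 \<union> X2 \<union> X3" if "a \<in> A" for a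
      using that ac unfolding A_eq[symmetric] X1_def X2_def X3_def by blast
    then show "A <#> B \<subseteq> X1 \<union> X2 \<union> X3"
      by (fastforce simp: mem_set_mult mem_l_coset)
  qed
  then have union: "card (X1 \<union> X2 \<union> X3) = 15"
    using AB by simp
  define W where "W = X1 \<inter> X2 \<inter> X3"
  \<comment> \<open>\<open>W\<close> and its right translate by z are disjoint, since no element of
    \<open>B\<close> stays in \<open>B\<close> under z. Both avoid the three cosets of
    \<open>N\<close> through a1, a2, a3, which leaves 24 - 18 = 6 elements for them.\<close>
  have "card W \<le> 3"
  proof -
    define Y where "Y = carrier G - ((a1 <# N) \<union> (a2 <# N) \<union> (a3 <# N))"
    have cN: "a <# N \<subseteq> carrier G" "card (a <# N) = 6" if "a \<in> carrier G" for a
      using that N.subset N6 by (simp_all add: l_coset_subset_G N_def)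
    have "card ((a1 <# N) \<union> (a2 <# N) \<union> (a3 <# N)) = 18"
    proof -
      have "(a1 <# N) \<inter> (a2 <# N) = {}" "((a1 <# N) \<union> (a2 <# N)) \<inter> (a3 <# N) = {}"
        using disj[OF N ac(1,2)] disj[OF N ac(1,3)] disj[OF N ac(2,3)] p12(3) p13(3) p23(3) by blast+
      then show ?thesis
        using cN ac fin by (simp add: card_Un_disjoint)
    qed
    then have Y6: "card Y = 6"
      using cN ac n fin unfolding Y_def order_def by (subst card_Diff_subset) auto
    have out: "x \<notin> a <# N" if x: "x \<in> a <# B" "a \<in> carrier G" for a x
    proof
      assume "x \<in> a <# N"
      then obtain b g where bg: "b \<in> B" "g \<in> N" "a \<otimes> b = a \<otimes> g"
        using x(1) by (auto simp: mem_l_coset)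
      then have "b = g"
        using x(2) B(1) N.mem_carrier by (meson l_cancel subsetD)
      then show False
        using bg BN by blast
    qed
    have WY: "W \<subseteq> Y"
      using out ac X_carrier unfolding W_def Y_def X1_def X2_def X3_def by blast
    have W_carrier: "W \<subseteq> carrier G"
      using WY by (auto simp: Y_def)
    have "W #> z \<subseteq> Y"
    proof
      fix y
      assume "y \<in> W #> z"
      then obtain w where w: "w \<in> W" "y = w \<otimes> z"
        by (auto simp: mem_r_coset)
      have wc: "w \<in> carrier G"
        using w(1) W_carrier by blast
      have "w \<in> a <# N" if a: "a \<in> carrier G" "y \<in> a <# N" for a
      proof -
        obtain g where g: "g \<in> N" "w \<otimes> z = a \<otimes> g"
          using a(2) w(2) by (auto simp: mem_l_coset)
        have "w = (w \<otimes> z) \<otimes> inv z"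
          using wc zc by (simp add: m_assoc)
        then have "w = a \<otimes> (g \<otimes> inv z)"
          using g a(1) zc N.mem_carrier by (simp add: m_assoc)
        then show ?thesis
          using g(1) z(1) unfolding mem_l_coset by (metis N.m_closed N.m_inv_closed)
      qed
      moreover have "y \<in> carrier G"
        using w wc zc by simp
      ultimately show "y \<in> Y"
        using w(1) WY ac unfolding Y_def by blast
    qed
    moreover have "W \<inter> (W #> z) = {}"
    proof (rule ccontr)
      assume "W \<inter> (W #> z) \<noteq> {}"
      then obtain w where w: "w \<in> W" "w \<otimes> z \<in> W"
        by (auto simp: mem_r_coset)
      then obtain b b' where b: "b \<in> B" "w = a1 \<otimes> b" "b' \<in> B" "w \<otimes> z = a1 \<otimes> b'"
        unfolding W_def X1_def by (auto simp: mem_l_coset)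
      then have c: "b \<in> carrier G" "b' \<in> carrier G"
        using B(1) by auto
      have "a1 \<otimes> (b \<otimes> z) = a1 \<otimes> b'"
        using b c ac zc by (simp add: m_assoc)
      then have "b \<otimes> z = b'"
        using c ac zc by simp
      then show False
        using Bz b by blast
    qed
    moreover have "finite W" "finite (W #> z)" "finite Y" "card (W #> z) = card W"
      using W_carrier zc fin r_coset_subset_G[OF W_carrier zc] by (auto simp: Y_def)
    ultimately have "card W + card W \<le> card Y"
      using WY by (metis Un_least card_Un_disjoint card_mono)
    then show ?thesis
      using Y6 by simp
  qed
  moreover have "card (X1 \<union> X2 \<union> X3) + card (X1 \<inter> X2) + card (X1 \<inter> X3) + card (X2 \<inter> X3) = 9 + 9 + 9 + card W"
    using card_Un3[of X1 X2 X3] X_carrier fin X_card unfolding W_def by simp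
  moreover have "card (X1 \<inter> X2) = C (inv a1 \<otimes> a2)" "card (X1 \<inter> X3) = C (inv a1 \<otimes> a3)" "card (X2 \<inter> X3) = C (inv a2 \<otimes> a3)"
    unfolding X1_def X2_def X3_def using pair ac by blast+
  moreover have "3 dvd c1" "3 dvd c2"
    using C_dvd b0c zc by (simp_all add: c1_def c2_def)
  then obtain d1 d2 where d: "c1 = 3 * d1" "c2 = 3 * d2"
    by (auto elim!: dvdE)
  then have d_sum: "d1 + d2 = 2"
    using c_sum by simp
  then have "(d1 = 0 \<and> d2 = 2) \<or> (d1 = 1 \<and> d2 = 1) \<or> (d1 = 2 \<and> d2 = 0)"
    by linarith
  then have c_cases: "(c1 = 0 \<and> c2 = 6) \<or> (c1 = 3 \<and> c2 = 3) \<or> (c1 = 6 \<and> c2 = 0)"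
    using d by auto
  \<comment> \<open>From c1 + c2 = 6, divisibility by 3 and the lower bound 3, all three overlaps
    are equal. By inclusion-exclusion 15 plus their sum equals 27 + |W|: overlaps 6 give |W| = 6,
    too large, and overlaps 3 make |W| negative.\<close>
  have "(C (inv a1 \<otimes> a2) = 6 \<and> C (inv a1 \<otimes> a3) = 6 \<and> C (inv a2 \<otimes> a3) = 6) \<or>
      (C (inv a1 \<otimes> a2) = 3 \<and> C (inv a1 \<otimes> a3) = 3 \<and> C (inv a2 \<otimes> a3) = 3)"
    using c_cases p12(1,2) p13(1,2) p23(1,2) by linarith
  ultimately show False
    using union by linarith
qed

end

context finite_group
begin

text \<open>With H = g K g^-1, the translate B g^-1 is invariant under \<open>H\<close> on both
  sides, while the size of the product with \<open>A\<close> is unchanged. The previous lemma then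
  excludes a normaliser of order 6.\<close>

lemma order24_two_shares:
  assumes n: "order G = 24" and t: "trio 9 A B D" and shares: "share A B" "share B D" and AB: "card (A <#> B) = 15"
  shows "\<exists>H. subgroup H G \<and> card H = 3 \<and> normalizing H = carrier G"
proof -
  obtain H K where H: "subgroup H G" "card H = 3" "A <#> H = A" "H <#> B = B"
    and K: "subgroup K G" "card K = 3" "B <#> K = B"
    using shares unfolding share_def by blast
  have sub: "A \<subseteq> carrier G" "B \<subseteq> carrier G" "card A = 9" "card B = 9"
    using t by (auto simp: trio_def)
  obtain g where g: "g \<in> carrier G" "H = conj_set g K"
    using order24_conjugate[OF n H(1,2) K(1,2)] by blast
  interpret H: subgroup H G
    by fact
  let ?B = "B #> inv g"
  have B: "?B \<subseteq> carrier G" "card ?B = 9"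
    using sub g by (simp_all add: r_coset_subset_G)
  have HB: "H <#> ?B = ?B"
    using setmult_rcos_assoc[OF H.subset sub(2), of "inv g"] g(1) H(4) by simp
  have BH: "?B <#> H = ?B"
  proof
    show "?B <#> H \<subseteq> ?B"
    proof
      fix y
      assume "y \<in> ?B <#> H"
      then obtain b h where bh: "b \<in> B" "h \<in> H" "y = b \<otimes> inv g \<otimes> h"
        by (auto simp: mem_set_mult mem_r_coset)
      then have k: "inv g \<otimes> h \<otimes> g \<in> K" "h \<in> carrier G"
        using g mem_conj_set[OF g(1) subgroup.subset[OF K(1)]] by blast+
      have bc: "b \<in> carrier G"
        using bh sub by blast
      have "b \<otimes> (inv g \<otimes> h \<otimes> g) \<in> B"
        using k bh(1) K(3) unfolding set_mult_def by blast
      moreover have "y = b \<otimes> (inv g \<otimes> h \<otimes> g) \<otimes> inv g"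
        using bh(3) bc k(2) g(1) by (simp add: m_assoc)
      ultimately show "y \<in> ?B"
        unfolding mem_r_coset by blast
    qed
    show "?B \<subseteq> ?B <#> H"
      using H.one_closed B(1) by (rule subset_set_mult)
  qed
  have "A <#> ?B = (A <#> B) #> inv g"
    using sub g by (simp add: setmult_rcos_assoc)
  then have "card (A <#> ?B) = 15"
    using AB sub g by (simp add: set_mult_closed)
  then have "card (normalizing H) \<noteq> 6"
    using order24_nonnormal[OF n H(1,2) sub(1,3) H(3) B HB BH] by blast
  then show ?thesis
    using order24_card_normalizing[OF n H(1,2)] H(1,2) by blast
qed

lemma normal_quotient:
  assumes "H \<lhd> G"
  shows "finite_group (G Mod H)" and "order (G Mod H) * card H = order G"
proof -
  interpret H: normal H G
    by fact
  have "finite (carrier (G Mod H))"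
    by (simp add: carrier_FactGroup)
  then show "finite_group (G Mod H)"
    using H.factorgroup_is_group by (simp add: finite_group_def finite_group_axioms_def)
  show "order (G Mod H) * card H = order G"
    using lagrange[OF H.is_subgroup] by (simp add: order_def FactGroup_def)
qed

lemma sum_over_cosets:
  fixes f :: "'a set \<Rightarrow> int"
  assumes H: "subgroup H G" and U: "U \<subseteq> carrier G" "H <#> U = U"
  shows "(\<Sum>u\<in>U. f (H #> u)) = int (card H) * sum f ((\<lambda>u. H #> u) ` U)"
proof -
  interpret H: subgroup H G
    by fact
  have "(\<Sum>u\<in>U. f (H #> u)) = (\<Sum>c\<in>(\<lambda>u. H #> u) ` U. \<Sum>u\<in>{u \<in> U. H #> u = c}. f (H #> u))"
    using finite_subset_carrier[OF U(1)] by (rule sum.image_gen)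
  also have "\<dots> = (\<Sum>c\<in>(\<lambda>u. H #> u) ` U. int (card H) * f c)"
  proof (rule sum.cong)
    fix c
    assume "c \<in> (\<lambda>u. H #> u) ` U"
    then obtain u where u: "u \<in> U" "c = H #> u" "u \<in> carrier G"
      using U(1) by blast
    have "{v \<in> U. H #> v = c} = c"
    proof
      show "{v \<in> U. H #> v = c} \<subseteq> c"
        using U(1) rcos_self[OF _ H] by blast
      show "c \<subseteq> {v \<in> U. H #> v = c}"
      proof
        fix v
        assume v: "v \<in> c"
        then have "v \<in> H <#> U"
          using u unfolding set_mult_def r_coset_def by blast
        moreover have "H #> v = c"
          using v u repr_independence[OF _ u(3) H] by simp
        ultimately show "v \<in> {v \<in> U. H #> v = c}"
          using U(2) by simp
      qed
    qed
    then have "(\<Sum>u\<in>{u \<in> U. H #> u = c}. f (H #> u)) = (\<Sum>u\<in>c. f c)"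
      by (intro sum.cong) auto
    then show "(\<Sum>u\<in>{u \<in> U. H #> u = c}. f (H #> u)) = int (card H) * f c"
      using u H.subset by simp
  qed simp
  also have "\<dots> = int (card H) * sum f ((\<lambda>u. H #> u) ` U)"
    by (simp add: sum_distrib_left)
  finally show ?thesis .
qed

lemma normal_set_mult_commute:
  assumes "H \<lhd> G" "U \<subseteq> carrier G"
  shows "U <#> H = H <#> U"
proof -
  interpret H: normal H G
    by fact
  have "u <# H = H #> u" if "u \<in> U" for u
    using H.coset_eq that assms(2) by blast
  then have "(\<Union>u\<in>U. u <# H) = (\<Union>u\<in>U. H #> u)"
    by simp
  moreover have "U <#> H = (\<Union>u\<in>U. u <# H)"
    by (simp add: set_mult_def l_coset_def)
  moreover have "H <#> U = (\<Union>u\<in>U. H #> u)"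
    unfolding set_mult_def r_coset_def by blast
  ultimately show ?thesis
    by simp
qed

text \<open>If length 15 occurs, the three rotations force a normal subgroup \<open>H\<close> of
  order 3 for which \<open>R\<close>, \<open>C\<close>, \<open>S\<close> are unions of cosets.
  Modulo \<open>H\<close> they form a disjointness pattern of three-element sets in a group of order
  8, to which the finite check applies.\<close>

lemma order24_missing:
  assumes n: "order G = 24"
  shows "\<not> has_maximal_of_length (cayley_table G) 15 \<or> \<not> has_maximal_of_length (cayley_table G) 24"
proof (rule ccontr)
  assume "\<not> ?thesis"
  then have has: "has_maximal_of_length (cayley_table G) 15" "has_maximal_of_length (cayley_table G) 24"
    by auto
  obtain R C S where gap: "transversal_gap R C S" and t: "trio (order G - 15) R C (set_inv S)"
    and S: "S \<subseteq> carrier G" "card S = order G - 15"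
    using has(1) by (elim has_maximal_of_lengthE) blast
  define D where "D = set_inv S"
  have t1: "trio 9 R C D"
    using t n by (simp add: D_def)
  then have t2: "trio 9 C D R" and t3: "trio 9 D R C"
    by (blast intro: trio_rotate)+
  have sub: "R \<subseteq> carrier G" "C \<subseteq> carrier G" "D \<subseteq> carrier G" "card R = 9" "card C = 9" "card D = 9"
    using t1 by (auto simp: trio_def)
  have S_D: "S = set_inv D"
    using S(1) by (simp add: D_def)
  have ni1: "\<not> index_two_trio R C D"
  proof
    assume "index_two_trio R C D"
    then obtain H p q where H: "subgroup H G" "2 * card H = order G"
      "\<forall>a\<in>R. a \<in> H \<longleftrightarrow> p" "\<forall>b\<in>C. b \<in> H \<longleftrightarrow> q" "\<forall>d\<in>set_inv S. d \<in> H \<longleftrightarrow> (p \<longleftrightarrow> \<not> q)"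
      unfolding index_two_trio_def D_def by blast
    have "even (card H + 9)"
      using index_two_parity[OF gap t1[unfolded D_def] S(1) H] .
    then show False
      using H(2) n by simp
  qed
  then have ni2: "\<not> index_two_trio C D R" and ni3: "\<not> index_two_trio D R C"
    using index_two_trio_rotate by blast+
  note s1 = order24_share[OF n t1 ni1] and s2 = order24_share[OF n t2 ni2] and s3 = order24_share[OF n t3 ni3]
  \<comment> \<open>Each rotation yields a shared subgroup at one of two neighbouring places of the
    cycle \<open>R\<close>, \<open>C\<close>, \<open>D\<close>, so at least two of the three places
    are occupied.\<close>
  have two: "(share R C \<and> share C D) \<or> (share C D \<and> share D R) \<or> (share D R \<and> share R C)"
    using s1 s2 s3 by blast
  obtain H where H: "subgroup H G" "card H = 3" "normalizing H = carrier G"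
  proof -
    have "\<exists>H. subgroup H G \<and> card H = 3 \<and> normalizing H = carrier G"
      using two order24_two_shares[OF n t1] order24_two_shares[OF n t2] order24_two_shares[OF n t3] s1 s2 s3
      by blast
    then show thesis
      using that by blast
  qed
  interpret H: subgroup H G
    by fact
  have conj: "g \<otimes> x \<otimes> inv g \<in> H" if "g \<in> carrier G" "x \<in> H" for g x
  proof -
    have "inv g \<in> normalizing H"
      using that H(3) by simp
    then have "inv (inv g) \<otimes> x \<otimes> inv g \<in> H"
      using that(2) H.mem_carrier unfolding normalizing_def by blast
    then show ?thesis
      using that(1) by simp
  qed
  then have normal: "H \<lhd> G"
    using H(1) by (simp add: normal_inv_iff)
  have unique: "K = H" if K: "subgroup K G" "card K = 3" for K
  proof -
    obtain g where g: "g \<in> carrier G" "K = conj_set g H"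
      using order24_conjugate[OF n K H(1,2)] by blast
    then have "K \<subseteq> H"
      using conj by (auto simp: conj_set_def mem_r_coset mem_l_coset)
    then show ?thesis
      using K H(2) finite_subset_carrier[OF H.subset] by (intro card_subset_eq) auto
  qed
  have inv: "H <#> A = A \<and> H <#> B = B" if "share A B" "A \<subseteq> carrier G" for A B
    using that unique normal_set_mult_commute[OF normal that(2)] unfolding share_def by metis
  have HR: "H <#> R = R" and HC: "H <#> C = C" and HD: "H <#> D = D"
    using two inv sub(1-3) by blast+
  have HS: "H <#> S = S"
  proof -
    have "set_inv (D <#> H) = H <#> S"
      using set_inv_set_mult[OF sub(3) H.subset] set_inv_subgroup[OF H(1)] S_D by simp
    moreover have "D <#> H = D"
      using HD normal_set_mult_commute[OF normal sub(3)] by simp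
    ultimately show ?thesis
      using S_D by simp
  qed
  interpret N: normal H G
    by (rule normal)
  let ?Q = "G Mod H" and ?\<pi> = "\<lambda>x. H #> x"
  interpret Q: finite_group ?Q
    by (rule normal_quotient(1)) (rule normal)
  have Q8: "order ?Q = 8"
    using normal_quotient(2)[OF normal] n H(2) by simp
  have carrier_Q: "carrier ?Q = ?\<pi> ` carrier G"
    by (rule carrier_FactGroup)
  have \<pi>_mult: "?\<pi> (x \<otimes> y) = ?\<pi> x \<otimes>\<^bsub>?Q\<^esub> ?\<pi> y" if "x \<in> carrier G" "y \<in> carrier G" for x y
    using that by (simp add: N.rcos_sum)
  have lift: "character m (\<lambda>x. f (?\<pi> x))" if f: "Q.character m f" for m f
    unfolding character_def
  proof (intro ballI)
    fix x y
    assume xy: "x \<in> carrier G" "y \<in> carrier G"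
    then have "?\<pi> x \<in> carrier ?Q" "?\<pi> y \<in> carrier ?Q"
      by (auto simp: carrier_Q)
    then show "m dvd f (?\<pi> (x \<otimes> y)) - f (?\<pi> x) - f (?\<pi> y)"
      using f unfolding Q.character_def \<pi>_mult[OF xy] by blast
  qed
  have sum: "(\<Sum>u\<in>U. f (?\<pi> u)) = 3 * sum f (?\<pi> ` U)" if "U \<subseteq> carrier G" "H <#> U = U" for U and f :: "'a set \<Rightarrow> int"
    using sum_over_cosets[OF H(1) that, of f] H(2) by simp
  have sum_G: "(\<Sum>u\<in>carrier G. f (?\<pi> u)) = 3 * sum f (carrier ?Q)" for f :: "'a set \<Rightarrow> int"
    unfolding carrier_Q using set_mult_carrier(1)[OF H(1)] by (intro sum) auto
  obtain k g1 g2 g3 where k: "k \<in> set groups8" and pc: "Q.pc_group (set even_bits) (pres8 (bits_of k)) g1 g2 g3 \<one>\<^bsub>?Q\<^esub>"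
    using pc_group_groups8[OF Q.finite_group_axioms Q8] by blast
  show False
  proof (cases "k = HA")
    case True
    then obtain f where f: "Q.character 8 f" "sum f (carrier ?Q) = 28"
      using Q.order8_cyclic_character pc by blast
    have "transversal_gap {} {} {}"
      using has(2) n by (intro transversal_gap_full) simp
    then have "8 dvd (\<Sum>u\<in>carrier G. f (?\<pi> u))"
      using gap_character_sum[OF _ lift[OF f(1)]] by fastforce
    then show False
      unfolding sum_G f(2) by simp
  next
    case False
    have card3: "card (?\<pi> ` U) = 3" if "U \<subseteq> carrier G" "H <#> U = U" "card U = 9" for U
      using sum[OF that(1,2), of "\<lambda>_. 1"] that(3) by simp
    have sub_Q: "?\<pi> ` U \<subseteq> carrier ?Q" if "U \<subseteq> carrier G" for U
      using that by (auto simp: carrier_Q)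
    have S9: "card S = 9"
      using S(2) n by simp
    have disj: "a \<otimes>\<^bsub>?Q\<^esub> b \<notin> ?\<pi> ` S" if ab: "a \<in> ?\<pi> ` R" "b \<in> ?\<pi> ` C" for a b
    proof
      assume "a \<otimes>\<^bsub>?Q\<^esub> b \<in> ?\<pi> ` S"
      then obtain s where s: "s \<in> S" "a \<otimes>\<^bsub>?Q\<^esub> b = ?\<pi> s"
        by blast
      obtain r c where rc: "r \<in> R" "c \<in> C" "a = ?\<pi> r" "b = ?\<pi> c"
        using ab by blast
      have c: "r \<in> carrier G" "c \<in> carrier G" "s \<in> carrier G"
        using rc s sub S(1) by auto
      have "?\<pi> (r \<otimes> c) = ?\<pi> s"
        using \<pi>_mult[OF c(1,2)] s(2) rc(3,4) by simp
      then have "r \<otimes> c \<in> ?\<pi> s"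
        using rcos_self[OF m_closed[OF c(1,2)] H(1)] by simp
      then have "r \<otimes> c \<in> S"
        using HS s(1) unfolding set_mult_def r_coset_def by blast
      then have "inv (r \<otimes> c) \<in> D"
        by (auto simp: D_def mem_set_inv)
      then have "r \<otimes> c \<otimes> inv (r \<otimes> c) \<noteq> \<one>"
        using t1 rc unfolding trio_def by blast
      then show False
        using c by simp
    qed
    have "k \<in> {H0, H4, H1, H7}"
      using k False by (auto simp: groups8_eq)
    then obtain f where f: "Q.character 4 f"
      "\<not> 4 dvd sum f (carrier ?Q) + sum f (?\<pi> ` S) - sum f (?\<pi> ` R) - sum f (?\<pi> ` C)"
      using Q.order8_obstruction[OF pc _ sub_Q[OF sub(1)] card3[OF sub(1) HR sub(4)]
          sub_Q[OF sub(2)] card3[OF sub(2) HC sub(5)] sub_Q[OF S(1)] card3[OF S(1) HS S9] disj]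
      by blast
    have "4 dvd 3 * sum f (carrier ?Q) + 3 * sum f (?\<pi> ` S) - 3 * sum f (?\<pi> ` R) - 3 * sum f (?\<pi> ` C)"
      using gap_character_sum[OF gap lift[OF f(1)]]
      unfolding sum_G sum[OF sub(1) HR] sum[OF sub(2) HC] sum[OF S(1) HS] .
    \<comment> \<open>The factor |H| = 3 picked up by each sum is invertible modulo 4.\<close>
    moreover have "4 dvd x + y - z - w" if "4 dvd 3 * x + 3 * y - 3 * z - 3 * w" for x y z w :: int
      using that by presburger
    ultimately show False
      using f(2) by blast
  qed
qed

end

section \<open>Groups of small order\<close>

context finite_group
begin

text \<open>For n = 10 and k = 4 the bound gives |H| \<le> 2, while |H| = 1 would need m \<ge> 4 and
  m \<le> 3. So |H| = 2 and m = 2, hence H B' has 4 elements and equals B'. The involution of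
  \<open>H\<close> acts on \<open>B\<close> from the left, or a conjugate of it from the right,
  according to the connection set of the atom.\<close>

lemma order10_involution:
  assumes n: "order G = 10" and t: "trio 4 A B D" and ni: "\<not> index_two_trio A B D"
  shows "\<exists>h\<in>carrier G. h \<noteq> \<one> \<and> h \<otimes> h = \<one> \<and> ((\<forall>u\<in>B. h \<otimes> u \<in> B) \<or> (\<forall>u\<in>B. u \<otimes> h \<in> B))"
proof -
  have sub: "A \<subseteq> carrier G" "B \<subseteq> carrier G" "D \<subseteq> carrier G" "card B = 4"
    using t by (auto simp: trio_def)
  then have "B \<noteq> {}"
    by auto
  then obtain b where b: "b \<in> B" "b \<in> carrier G"
    using sub(2) by blast
  have lt: "order G < 3 * 4"
    using n by simp
  show ?thesis
  proof (rule trio_dichotomy[OF t lt b(1)])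
    fix H p q
    assume "subgroup H G" "2 * card H = order G"
      "\<forall>a\<in>A. a \<in> H \<longleftrightarrow> p" "\<forall>b\<in>B. b \<in> H \<longleftrightarrow> q" "\<forall>d\<in>D. d \<in> H \<longleftrightarrow> (p \<longleftrightarrow> \<not> q)"
    then show ?thesis
      using ni unfolding index_two_trio_def by blast
  next
    fix H B' m
    assume H: "subgroup H G" and B': "B' = B #> inv b \<or> B' = set_inv (B #> inv b)" "B' \<subseteq> H <#> B'" "card B' = 4"
      "card (H <#> B') = m * card H"
      and m: "2 \<le> m" "4 \<le> m * card H" "m * card H + 2 * 4 \<le> order G + card H" "card H dvd order G" "m * card H < order G"
    interpret H: subgroup H G by fact
    have "2 * card H \<le> m * card H"
      using m(1) by simp
    then have "card H \<le> 2"
      using m(3) n by linarith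
    moreover have "card H \<noteq> 0"
      using m(2) by (intro notI) simp
    moreover have "card H \<noteq> 1"
      using m(2,3) n by (intro notI) simp
    ultimately have H2: "card H = 2"
      by linarith
    then have "card (H <#> B') = card B'"
      using B'(3,4) m(2,3) n by simp
    moreover have B'_sub: "B' \<subseteq> carrier G"
      using B'(1) set_inv_subset[of "B #> inv b"] r_coset_subset_G[OF sub(2), of "inv b"] b(2) by (metis inv_closed)
    ultimately have HB': "H <#> B' = B'"
      using B'(2) finite_subset_carrier[OF set_mult_closed[OF H.subset B'_sub]] by (metis card_subset_eq)
    have "\<not> H \<subseteq> {\<one>}"
      using H2 card_mono[of "{\<one>}" H] by auto
    then obtain h where h: "h \<in> H" "h \<noteq> \<one>"
      by blast
    have H_eq: "H = {\<one>, h}"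
      using h H2 finite_subset_carrier[OF H.subset] by (intro card_subset_eq[symmetric]) auto
    have hc: "h \<in> carrier G"
      using h by auto
    have "h \<otimes> h \<in> H"
      using h by simp
    then have hh: "h \<otimes> h = \<one>"
      using h hc unfolding H_eq by auto
    show ?thesis
    proof (cases "B' = B #> inv b")
      case True
      have "h \<otimes> u \<in> B" if u: "u \<in> B" for u
      proof -
        have uc: "u \<in> carrier G"
          using u sub by blast
        have "u \<otimes> inv b \<in> B'"
          unfolding True mem_r_coset using u by blast
        then have "h \<otimes> (u \<otimes> inv b) \<in> H <#> B'"
          using h(1) unfolding mem_set_mult by blast
        then have "h \<otimes> (u \<otimes> inv b) \<in> B #> inv b"
          using HB' True by simp
        then obtain v where v: "v \<in> B" "h \<otimes> (u \<otimes> inv b) = v \<otimes> inv b"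
          unfolding mem_r_coset by blast
        then have "(h \<otimes> u) \<otimes> inv b = v \<otimes> inv b" "v \<in> carrier G"
          using uc hc b(2) sub(2) by (auto simp: m_assoc)
        then show ?thesis
          using v(1) uc hc b(2) by simp
      qed
      then show ?thesis
        using h(2) hc hh by blast
    next
      case False
      then have B'_eq: "B' = set_inv (B #> inv b)"
        using B'(1) by blast
      let ?h = "inv b \<otimes> h \<otimes> b"
      have "u \<otimes> ?h \<in> B" if u: "u \<in> B" for u
      proof -
        have uc: "u \<in> carrier G"
          using u sub by blast
        have "u \<otimes> inv b \<in> B #> inv b"
          unfolding mem_r_coset using u by blast
        then have "inv (u \<otimes> inv b) \<in> B'"
          unfolding B'_eq mem_set_inv by blast
        then have "inv h \<otimes> inv (u \<otimes> inv b) \<in> H <#> B'"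
          using h(1) unfolding mem_set_mult by blast
        then have "inv h \<otimes> inv (u \<otimes> inv b) \<in> set_inv (B #> inv b)"
          using HB' B'_eq by simp
        then obtain w where w: "w \<in> B #> inv b" "inv h \<otimes> inv (u \<otimes> inv b) = inv w"
          unfolding mem_set_inv by blast
        obtain v where "v \<in> B" "w = v \<otimes> inv b"
          using w(1) unfolding mem_r_coset by blast
        with w(2) have v: "v \<in> B" "inv h \<otimes> inv (u \<otimes> inv b) = inv (v \<otimes> inv b)"
          by simp_all
        then have vc: "v \<in> carrier G"
          using sub(2) by blast
        have "inv ((u \<otimes> inv b) \<otimes> h) = inv (v \<otimes> inv b)"
          using v(2) uc hc b(2) by (simp add: inv_mult_group)
        then have "(u \<otimes> inv b) \<otimes> h = v \<otimes> inv b"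
          using uc hc vc b(2) by (metis inv_closed inv_inv m_closed)
        then have "(u \<otimes> inv b) \<otimes> h \<otimes> b = v"
          using vc b(2) by (simp add: m_assoc)
        then show ?thesis
          using v(1) uc hc b(2) by (simp add: m_assoc)
      qed
      moreover have "?h \<otimes> ?h = \<one>"
      proof -
        have "?h \<otimes> ?h = inv b \<otimes> (h \<otimes> h) \<otimes> b"
          using hc b(2) by (simp add: m_assoc) (simp add: m_assoc[symmetric])
        then show ?thesis
          using hh b(2) by simp
      qed
      moreover have "?h \<noteq> \<one>"
      proof
        assume "?h = \<one>"
        then have "b \<otimes> ?h \<otimes> inv b = \<one>"
          using b(2) by simp
        moreover have "b \<otimes> ?h \<otimes> inv b = h"
          using hc b(2) by (simp add: m_assoc) (simp add: m_assoc[symmetric])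
        ultimately show False
          using h(2) by simp
      qed
      moreover have "?h \<in> carrier G"
        using hc b(2) by simp
      ultimately show ?thesis
        by blast
    qed
  qed
qed

text \<open>Each of \<open>R\<close>, \<open>C\<close>, \<open>S\<close> is invariant under some
  involution, possibly a different one each time, so two of its four elements are odd for the sign
  character. The total over the group is odd because half of the ten elements are, which contradicts
  the parity identity.\<close>

lemma order10_missing:
  assumes n: "order G = 10"
  shows "\<not> has_maximal_of_length (cayley_table G) 6"
proof
  assume "has_maximal_of_length (cayley_table G) 6"
  then obtain R C S where gap: "transversal_gap R C S" and t: "trio (order G - 6) R C (set_inv S)"
    and S: "S \<subseteq> carrier G" "card S = order G - 6"
    by (elim has_maximal_of_lengthE) blast
  define D where "D = set_inv S"
  have t1: "trio 4 R C D"
    using t n by (simp add: D_def)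
  then have t2: "trio 4 C D R" and t3: "trio 4 D R C"
    by (blast intro: trio_rotate)+
  have sub: "R \<subseteq> carrier G" "C \<subseteq> carrier G" "card R = 4" "card C = 4" "card S = 4"
    using t1 S n by (auto simp: trio_def)
  have ni1: "\<not> index_two_trio R C D"
  proof
    assume "index_two_trio R C D"
    then obtain H p q where H: "subgroup H G" "2 * card H = order G"
      "\<forall>a\<in>R. a \<in> H \<longleftrightarrow> p" "\<forall>b\<in>C. b \<in> H \<longleftrightarrow> q" "\<forall>d\<in>set_inv S. d \<in> H \<longleftrightarrow> (p \<longleftrightarrow> \<not> q)"
      unfolding index_two_trio_def D_def by blast
    have "even (card H + 4)"
      using index_two_parity[OF gap t1[unfolded D_def] S(1) H] .
    then show False
      using H(2) n by simp
  qed
  then have ni2: "\<not> index_two_trio C D R" and ni3: "\<not> index_two_trio D R C"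
    using index_two_trio_rotate by blast+
  have "order G mod 4 = 2"
    using n by simp
  then obtain f :: "'a \<Rightarrow> int" where
    hom: "\<And>x y. x \<in> carrier G \<Longrightarrow> y \<in> carrier G \<Longrightarrow> 2 dvd f (x \<otimes> y) - f x - f y" and
    odd: "\<And>h. h \<in> carrier G \<Longrightarrow> h \<noteq> \<one> \<Longrightarrow> h \<otimes> h = \<one> \<Longrightarrow> odd (f h)"
    using parity_character by blast
  have even: "even (sum f U)" if U: "U \<subseteq> carrier G" "card U = 4"
    and h: "\<exists>h\<in>carrier G. h \<noteq> \<one> \<and> h \<otimes> h = \<one> \<and> ((\<forall>u\<in>U. h \<otimes> u \<in> U) \<or> (\<forall>u\<in>U. u \<otimes> h \<in> U))" for U
  proof -
    obtain h where h: "h \<in> carrier G" "h \<noteq> \<one>" "h \<otimes> h = \<one>" "(\<forall>u\<in>U. h \<otimes> u \<in> U) \<or> (\<forall>u\<in>U. u \<otimes> h \<in> U)"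
      using h by blast
    show ?thesis
      using involution_sum(2)[OF finite_subset_carrier[OF U(1)] U(1) h(1-3) odd[OF h(1-3)] hom h(4)] U(2) by simp
  qed
  have "even (sum f C)" "even (sum f R)"
    using even[OF sub(2,4) order10_involution[OF n t1 ni1]] even[OF sub(1,3) order10_involution[OF n t3 ni3]] by blast+
  moreover have "even (sum f S)"
  proof (rule even[OF S(1) sub(5)])
    obtain h where h: "h \<in> carrier G" "h \<noteq> \<one>" "h \<otimes> h = \<one>" "(\<forall>u\<in>D. h \<otimes> u \<in> D) \<or> (\<forall>u\<in>D. u \<otimes> h \<in> D)"
      using order10_involution[OF n t2 ni2] by blast
    have inv_h: "inv h = h"
      using h(1,3) by (intro inv_equality) auto
    have mem: "u \<in> S \<longleftrightarrow> inv u \<in> D" if "u \<in> carrier G" for u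
      using that S(1) unfolding D_def mem_set_inv by (metis inv_inv subsetD)
    have Sc: "u \<in> carrier G" if "u \<in> S" for u
      using that S(1) by blast
    from h(4) show "\<exists>h\<in>carrier G. h \<noteq> \<one> \<and> h \<otimes> h = \<one> \<and> ((\<forall>u\<in>S. h \<otimes> u \<in> S) \<or> (\<forall>u\<in>S. u \<otimes> h \<in> S))"
    proof
      assume l: "\<forall>u\<in>D. h \<otimes> u \<in> D"
      have "u \<otimes> h \<in> S" if u: "u \<in> S" for u
        using l mem[of "u \<otimes> h"] mem[OF Sc[OF u]] u Sc[OF u] h(1) inv_h by (simp add: inv_mult_group)
      then show ?thesis
        using h(1-3) by blast
    next
      assume l: "\<forall>u\<in>D. u \<otimes> h \<in> D"
      have "h \<otimes> u \<in> S" if u: "u \<in> S" for u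
        using l mem[of "h \<otimes> u"] mem[OF Sc[OF u]] u Sc[OF u] h(1) inv_h by (simp add: inv_mult_group)
      then show ?thesis
        using h(1-3) by blast
    qed
  qed
  moreover have "odd (sum f (carrier G))"
  proof -
    have "2 dvd order G"
      using n by simp
    then obtain h where h: "h \<in> carrier G" "ord h = 2"
      using exists_prime_order[OF two_is_prime_nat] by blast
    have h2: "h \<noteq> \<one>" "h \<otimes> h = \<one>"
      using h ord_id pow_ord_eq_1[OF h(1)] by (auto simp: numeral_2_eq_2)
    have "even (sum f (carrier G)) \<longleftrightarrow> even (card (carrier G) div 2)"
      by (rule involution_sum(2)[of _ h]) (use h h2 odd hom in auto)
    then show ?thesis
      using n by (simp add: order_def)
  qed
  moreover have "2 dvd sum f (carrier G) + sum f S - sum f R - sum f C"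
    by (rule transversal_gap_sum[OF gap hom])
  ultimately show False
    by simp
qed

text \<open>\<open>H\<close>, generated by an element a of order p, is normal: otherwise some H g H
  has p^2 elements, which forces p = q and H g H = G, and \<one> in H g H puts g into
  \<open>H\<close>. Now g a g^-1 = a^j, and g^(pq) = \<one> gives the congruence in
  \<open>pow\<close>, so j = 1 and \<open>H\<close> is central. The centraliser of an element
  outside \<open>H\<close> properly contains \<open>H\<close> and, q being prime, is
  everything.\<close>

lemma order_prime_product_abelian:
  assumes n: "order G = p * q" and p: "Factorial_Ring.prime (p :: nat)" and q: "Factorial_Ring.prime (q :: nat)" "q \<le> p"
    and pow: "\<And>j :: nat. p dvd j ^ (p * q) - 1 \<Longrightarrow> 0 < j \<Longrightarrow> j < p \<Longrightarrow> j = 1"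
  shows "comm_group G"
proof -
  obtain a where a: "a \<in> carrier G" "ord a = p"
    using exists_prime_order[OF p] n by auto
  define H where "H = generate G {a}"
  have H: "subgroup H G"
    unfolding H_def using a(1) by (intro generate_is_subgroup) simp
  interpret H: subgroup H G
    by fact
  have card_H: "card H = p"
    unfolding H_def using a generate_pow_card by simp
  have p1: "1 < p"
    using p prime_gt_1_nat by blast
  have a_H: "a \<in> H"
    unfolding H_def by (rule generate.incl) simp
  have H_pow: "\<exists>j < p. x = a [^] j" if "x \<in> H" for x
  proof -
    have "x \<in> {a [^] k |k. k \<in> {0..ord a - 1}}"
      using that a p1 ord_elems[OF finite_carrier a(1)] generate_pow_nat[OF a(1)] unfolding H_def by auto
    then obtain k where "k \<le> ord a - 1" "x = a [^] k"
      by auto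
    moreover have "k < p"
      using calculation(1) a(2) p1 by linarith
    ultimately show ?thesis
      by blast
  qed
  have inter: "H \<inter> K = {\<one>}" if K: "subgroup K G" "\<not> H \<subseteq> K" for K
  proof -
    interpret K: subgroup K G
      by fact
    interpret GH: finite_group "G\<lparr>carrier := H\<rparr>"
      by (rule subgroup_finite_group) fact
    have "subgroup (H \<inter> K) (G\<lparr>carrier := H\<rparr>)"
      using H K by (intro subgroup_incl subgroups_Inter_pair) auto
    then have "card (H \<inter> K) dvd p"
      using GH.card_subgroup_dvd card_H by (simp add: order_def)
    moreover have "card (H \<inter> K) \<noteq> p"
      using K(2) card_H finite_subset_carrier[OF H.subset] by (metis card_subset_eq inf.absorb_iff1 inf_le1)
    ultimately have "card (H \<inter> K) = 1"
      using p by (metis prime_nat_iff)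
    then show ?thesis
      using H.one_closed K.one_closed by (metis Int_iff card_1_singletonE singletonD)
  qed
  have normal: "H \<subseteq> conj_set g H" if g: "g \<in> carrier G" for g
  proof (rule ccontr)
    assume notsub: "\<not> H \<subseteq> conj_set g H"
    then have "card (H <#> (g <# H)) = p * p"
      using double_coset_card[OF H H g inter[OF subgroup_conj_set(1)[OF H g]]] card_H by simp
    moreover have sub: "H <#> (g <# H) \<subseteq> carrier G"
      using g by (intro set_mult_closed l_coset_subset_G) auto
    ultimately have "p * p \<le> p * q"
      using card_mono[OF finite_carrier sub] n by (simp add: order_def)
    then have "p = q"
      using q(2) p1 by simp
    then have "H <#> (g <# H) = carrier G"
      using \<open>card _ = p * p\<close> sub n by (intro card_subset_eq) (simp_all add: order_def)
    then have "\<one> \<in> H <#> (g <# H)"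
      by simp
    then obtain h k where hk: "h \<in> H" "k \<in> H" "\<one> = h \<otimes> (g \<otimes> k)"
      unfolding mem_double_coset by blast
    have hkc: "h \<in> carrier G" "k \<in> carrier G"
      using hk(1,2) subgroup.subset[OF H] by blast+
    then have "inv h \<otimes> (h \<otimes> (g \<otimes> k)) \<otimes> inv k = g"
      using g by (simp add: m_assoc) (simp add: m_assoc[symmetric])
    then have "inv h \<otimes> \<one> \<otimes> inv k = g"
      unfolding hk(3)[symmetric] .
    then have "inv h \<otimes> inv k = g"
      using hkc by simp
    then have "g \<in> H"
      using subgroup.m_closed[OF H] subgroup.m_inv_closed[OF H] hk(1,2) by blast
    then have "g \<in> normalizing H"
      using subgroup_le_normalizing[OF H] by blast
    then show False
      using notsub normalizing_iff[OF H g] by blast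
  qed
  have central_a: "g \<otimes> a = a \<otimes> g" if g: "g \<in> carrier G" for g
  proof -
    have "g \<in> normalizing H"
      using normal[OF g] normalizing_iff[OF H g] by blast
    then have "inv g \<in> normalizing H"
      using subgroup_normalizing by (rule subgroup.m_inv_closed[rotated])
    then have "inv (inv g) \<otimes> a \<otimes> inv g \<in> H"
      using a_H a(1) unfolding normalizing_def by blast
    then obtain j where j: "j < p" "g \<otimes> a \<otimes> inv g = a [^] j"
      using H_pow g by auto
    have ga: "g \<otimes> a = a [^] j \<otimes> g"
      using j(2) g a(1) by (metis inv_solve_right m_closed nat_pow_closed)
    have gai: "g \<otimes> a [^] i = a [^] (i * j) \<otimes> g" for i :: nat
    proof (induction i)
      case (Suc i)
      have "g \<otimes> a [^] Suc i = (g \<otimes> a [^] i) \<otimes> a"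
        using g a(1) by (simp add: m_assoc)
      also have "\<dots> = a [^] (i * j) \<otimes> (g \<otimes> a)"
        using Suc g a(1) by (simp add: m_assoc)
      also have "\<dots> = a [^] (i * j + j) \<otimes> g"
        using ga g a(1) by (simp add: m_assoc[symmetric] nat_pow_mult)
      finally show ?case
        by (simp add: add.commute)
    qed (use g in simp)
    have gm: "g [^] m \<otimes> a = a [^] (j ^ m) \<otimes> g [^] m" for m :: nat
    proof (induction m)
      case (Suc m)
      have "g [^] Suc m \<otimes> a = g \<otimes> (g [^] m \<otimes> a)"
        unfolding nat_pow_Suc2[OF g] using g a(1) by (simp add: m_assoc)
      also have "\<dots> = (g \<otimes> a [^] (j ^ m)) \<otimes> g [^] m"
        using Suc g a(1) by (simp add: m_assoc)
      also have "\<dots> = a [^] (j ^ m * j) \<otimes> (g \<otimes> g [^] m)"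
        using gai g a(1) by (simp add: m_assoc)
      finally show ?case
        unfolding nat_pow_Suc2[OF g] by (simp add: mult.commute)
    qed (use a(1) in simp)
    have "g [^] (p * q) = \<one>"
      using pow_order_eq_1[OF g] n by simp
    then have "a [^] (1::nat) = a [^] (j ^ (p * q))"
      using gm[of "p * q"] a(1) by simp
    moreover have j0: "0 < j"
    proof (rule ccontr)
      assume "\<not> 0 < j"
      then have "g \<otimes> a \<otimes> inv g = \<one>"
        using j(2) by simp
      then have "g \<otimes> a = g"
        using g a(1) by (metis inv_solve_right l_one m_closed one_closed)
      then have "a = \<one>"
        using g a(1) by simp
      then show False
        using a(2) p1 by simp
    qed
    ultimately have "p dvd j ^ (p * q) - 1"
    proof -
      assume e: "a [^] (1::nat) = a [^] (j ^ (p * q))"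
      have "1 \<le> j ^ (p * q)"
        using j0 by simp
      then have "a [^] (j ^ (p * q)) = a [^] (j ^ (p * q) - 1) \<otimes> a"
        using nat_pow_Suc[of a "j ^ (p * q) - 1"] by (metis Suc_diff_1 less_le_trans zero_less_one)
      then have "a [^] (j ^ (p * q) - 1) = \<one>"
        using e a(1) by (metis l_cancel_one' nat_pow_closed nat_pow_eone r_cancel_one')
      then show ?thesis
        using pow_eq_id[OF a(1)] a(2) by simp
    qed
    then have "j = 1"
      using pow j0 j(1) by blast
    then show ?thesis
      using ga a(1) by simp
  qed
  have H_central: "x \<otimes> g = g \<otimes> x" if x: "x \<in> H" and g: "g \<in> carrier G" for x g
  proof -
    obtain j :: nat where j: "x = a [^] j"
      using H_pow[OF x] by blast
    have "a [^] i \<otimes> g = g \<otimes> a [^] i" for i :: nat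
    proof (induction i)
      case (Suc i)
      have "a [^] Suc i \<otimes> g = a [^] i \<otimes> (g \<otimes> a)"
        using g a(1) central_a[OF g] by (simp add: m_assoc)
      also have "\<dots> = g \<otimes> a [^] Suc i"
        using Suc g a(1) by (simp add: m_assoc[symmetric])
      finally show ?case .
    qed (use g in simp)
    then show ?thesis
      using j by simp
  qed
  have "x \<otimes> b = b \<otimes> x" if x: "x \<in> carrier G" and b: "b \<in> carrier G" for x b
  proof (cases "b \<in> H")
    case False
    define Z where "Z = {x \<in> carrier G. x \<otimes> b = b \<otimes> x}"
    have Z: "subgroup Z G"
    proof (rule subgroupI)
      show "inv x \<in> Z" if "x \<in> Z" for x
        using that b unfolding Z_def by (auto simp: inv_solve_left inv_solve_right m_assoc)
      show "x \<otimes> y \<in> Z" if "x \<in> Z" "y \<in> Z" for x y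
        using that b unfolding Z_def by (auto simp: m_assoc) (metis m_assoc)
    qed (use b in \<open>auto simp: Z_def\<close>)
    have HZ: "H \<subseteq> Z" "b \<in> Z"
      using H_central b H.mem_carrier by (auto simp: Z_def)
    have "H <#> Z = Z"
    proof
      show "H <#> Z \<subseteq> Z"
      proof
        fix z
        assume "z \<in> H <#> Z"
        then obtain x y where "x \<in> H" "y \<in> Z" "z = x \<otimes> y"
          unfolding mem_set_mult by blast
        then show "z \<in> Z"
          using HZ(1) subgroup.m_closed[OF Z] by blast
      qed
      show "Z \<subseteq> H <#> Z"
        using H.one_closed subgroup.subset[OF Z] by (rule subset_set_mult)
    qed
    then have "p dvd card Z"
      using card_dvd_left_invariant[OF H subgroup.subset[OF Z]] card_H by simp
    then obtain r where r: "card Z = p * r"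
      by (elim dvdE)
    have "r dvd q"
      using card_subgroup_dvd[OF Z] n r p1 by simp
    moreover have "card H < card Z"
      using HZ False finite_subset_carrier[OF subgroup.subset[OF Z]] by (intro psubset_card_mono) auto
    then have "r \<noteq> 1"
      using r card_H by auto
    ultimately have "r = q"
      using q(1) by (metis prime_nat_iff)
    then have "Z = carrier G"
      using r n subgroup.subset[OF Z] by (intro card_subset_eq) (simp_all add: order_def)
    then show ?thesis
      using x by (auto simp: Z_def)
  qed (use H_central[OF _ x] in simp)
  then show ?thesis
    by (intro group_comm_groupI) 
qed

lemma generator_cyclic:
  assumes a: "a \<in> carrier G" "ord a = order G"
  shows "comm_group G" "integer_mod_group (order G) \<cong> G"
proof -
  have n: "0 < order G"
    by (simp add: order_gt_0_iff_finite)
  have carrier_n: "carrier (integer_mod_group (order G)) = {0..<int (order G)}"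
    using n by (simp add: carrier_integer_mod_group)
  have eq: "a [^] i = a [^] j \<longleftrightarrow> int (order G) dvd j - i" for i j :: int
    using int_pow_eq[OF a(1)] a(2) by simp
  have inj: "inj_on (\<lambda>i::int. a [^] i) {0..<int (order G)}"
  proof (rule inj_onI)
    fix i j
    assume ij: "i \<in> {0..<int (order G)}" "j \<in> {0..<int (order G)}" "a [^] i = a [^] j"
    then have "int (order G) dvd j - i"
      using eq by simp
    then have "i mod int (order G) = j mod int (order G)"
      by (simp add: mod_eq_dvd_iff dvd_diff_commute)
    then show "i = j"
      using ij by simp
  qed
  have im: "(\<lambda>i::int. a [^] i) ` {0..<int (order G)} = carrier G"
    using a(1) card_image[OF inj] by (intro card_subset_eq) (auto simp: order_def)
  show "integer_mod_group (order G) \<cong> G"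
  proof (rule is_isoI[of "\<lambda>i::int. a [^] i"])
    show "bij_betw (\<lambda>i::int. a [^] i) (carrier (integer_mod_group (order G))) (carrier G)"
      using inj im by (simp add: bij_betw_def carrier_n)
    fix i j :: int
    have "a [^] ((i + j) mod int (order G)) = a [^] (i + j)"
      unfolding eq by (simp add: mod_eq_dvd_iff[symmetric])
    then show "a [^] (i \<otimes>\<^bsub>integer_mod_group (order G)\<^esub> j) = a [^] i \<otimes> a [^] j"
      using a(1) by (simp add: int_pow_mult)
  qed
  show "comm_group G"
  proof (rule group_comm_groupI)
    fix x y
    assume "x \<in> carrier G" "y \<in> carrier G"
    then obtain i j :: int where "x = a [^] i" "y = a [^] j"
      using im by (metis imageE)
    then show "x \<otimes> y = y \<otimes> x"
      using a(1) by (simp add: int_pow_mult[symmetric] add.commute)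
  qed
qed

lemma prime_order_cyclic:
  assumes "Factorial_Ring.prime (order G)"
  shows "comm_group G" "integer_mod_group (order G) \<cong> G"
proof -
  obtain a where "a \<in> carrier G" "ord a = order G"
    using exists_prime_order[OF assms] by auto
  then show "comm_group G" "integer_mod_group (order G) \<cong> G"
    by (rule generator_cyclic)+
qed

lemma atLeastLessThan_int_3: "{0..<3 :: int} = {0, 1, 2}"
  by auto

text \<open>The subgroup of order 3 has index two and so contains b a b. If this is a, the product a
  b has order 6; if it is a^2, the dihedral relation holds.\<close>

lemma order6_cases:
  assumes n: "order G = 6"
  shows "integer_mod_group 6 \<cong> G \<or> dihedral_group 6 \<cong> G"
proof -
  obtain a where a: "a \<in> carrier G" "ord a = 3"
    using exists_prime_order[of 3] n by auto
  obtain b where b: "b \<in> carrier G" "ord b = 2"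
    using exists_prime_order[of 2] n by auto
  have bb: "b \<otimes> b = \<one>"
    using pow_ord_eq_1[OF b(1)] b by (simp add: numeral_2_eq_2)
  have b1: "b \<noteq> \<one>"
    using b ord_id by auto
  have aaa: "a \<otimes> (a \<otimes> a) = \<one>"
    using pow_ord_eq_1[OF a(1)] a by (simp add: numeral_3_eq_3 m_assoc)
  have a1: "a \<noteq> \<one>"
    using a ord_id by auto
  have aa1: "a \<otimes> a \<noteq> \<one>"
    using aaa a a1 by auto
  have aaa': "a \<otimes> a \<noteq> a"
    using a a1 by simp
  define H where "H = {\<one>, a, a \<otimes> a}"
  have inv_a: "inv a = a \<otimes> a"
    using aaa a(1) by (intro inv_equality) (simp_all add: m_assoc)
  have H: "subgroup H G"
  proof (rule subgroupI)
    have "inv (a \<otimes> a) = a"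
      using inv_a a(1) by (metis inv_inv)
    then show "inv x \<in> H" if "x \<in> H" for x
      using that inv_a by (auto simp: H_def)
    have "a \<otimes> a \<otimes> (a \<otimes> a) = a"
      using aaa a(1) by (simp add: m_assoc)
    then show "x \<otimes> y \<in> H" if "x \<in> H" "y \<in> H" for x y
      using that aaa a(1) by (auto simp: H_def m_assoc)
  qed (use a in \<open>auto simp: H_def\<close>)
  have card_H: "card H = 3"
    using a1 aa1 aaa' by (auto simp: H_def)
  have index: "2 * card H = order G"
    using card_H n by simp
  have bH: "b \<notin> H"
  proof
    assume "b \<in> H"
    then have "b = a \<or> b = a \<otimes> a"
      using b1 by (auto simp: H_def)
    then show False
    proof
      assume "b = a"
      then show False
        using bb aa1 by simp
    next
      assume e: "b = a \<otimes> a"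
      have "a \<otimes> a \<otimes> (a \<otimes> a) = a"
        using aaa a(1) by (simp add: m_assoc)
      then show False
        using e bb a1 by simp
    qed
  qed
  have inv_b: "inv b = b"
    using bb b(1) by (intro inv_equality)
  have "b \<otimes> a \<otimes> b \<in> H"
    using index_two_mult[OF H index, of "b \<otimes> a" b] index_two_mult[OF H index, of b a] a(1) b(1) bH
    by (simp add: H_def)
  then have "b \<otimes> a \<otimes> b = \<one> \<or> b \<otimes> a \<otimes> b = a \<or> b \<otimes> a \<otimes> b = a \<otimes> a"
    by (simp add: H_def)
  moreover have ba: "b \<otimes> a = (b \<otimes> a \<otimes> b) \<otimes> b"
    using a(1) b(1) bb by (simp add: m_assoc)
  moreover have "b \<otimes> a \<otimes> b \<noteq> \<one>"
  proof
    assume "b \<otimes> a \<otimes> b = \<one>"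
    then have "b \<otimes> a = b"
      using ba b(1) by simp
    then show False
      using a(1) b(1) a1 by simp
  qed
  ultimately consider (comm) "b \<otimes> a = a \<otimes> b" | (dih) "b \<otimes> a = a \<otimes> (a \<otimes> b)"
    using a(1) b(1) by (metis m_assoc)
  then show ?thesis
  proof cases
    case comm
    have c: "a \<otimes> b \<in> carrier G"
      using a b by simp
    have "(a \<otimes> b) \<otimes> (a \<otimes> b) = a \<otimes> (b \<otimes> a) \<otimes> b"
      using a b by (simp add: m_assoc)
    also have "\<dots> = (a \<otimes> a) \<otimes> (b \<otimes> b)"
      unfolding comm using a b by (simp add: m_assoc)
    finally have c2: "(a \<otimes> b) [^] (2::nat) = a \<otimes> a"
      using bb a b by (simp add: numeral_2_eq_2)
    have "(a \<otimes> b) [^] (3::nat) = (a \<otimes> b) [^] (2::nat) \<otimes> (a \<otimes> b)"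
      by (simp add: numeral_3_eq_3 numeral_2_eq_2)
    also have "\<dots> = (a \<otimes> (a \<otimes> a)) \<otimes> b"
      unfolding c2 using a b by (simp add: m_assoc)
    finally have c3: "(a \<otimes> b) [^] (3::nat) = b"
      using aaa b by simp
    have "ord (a \<otimes> b) dvd 6"
      using ord_dvd_group_order[OF c] n by simp
    then have "ord (a \<otimes> b) \<in> {1, 2, 3, 6}"
    proof -
      assume d: "ord (a \<otimes> b) dvd 6"
      then have "ord (a \<otimes> b) \<le> 6"
        by (rule dvd_imp_le) simp
      then have "ord (a \<otimes> b) = 0 \<or> ord (a \<otimes> b) = 1 \<or> ord (a \<otimes> b) = 2 \<or> ord (a \<otimes> b) = 3 \<or>
          ord (a \<otimes> b) = 4 \<or> ord (a \<otimes> b) = 5 \<or> ord (a \<otimes> b) = 6"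
        by linarith
      then show ?thesis
        using d by (elim disjE) simp_all
    qed
    moreover have "ord (a \<otimes> b) \<noteq> 2" "ord (a \<otimes> b) \<noteq> 3"
      using pow_ord_eq_1[OF c] c2 c3 aa1 b1 by auto
    moreover have "ord (a \<otimes> b) \<noteq> 1"
    proof
      assume "ord (a \<otimes> b) = 1"
      then have "a \<otimes> b = \<one>"
        using c ord_eq_1 by blast
      then show False
        using c2 aa1 by simp
    qed
    ultimately have "ord (a \<otimes> b) = order G"
      using n by auto
    then show ?thesis
      using generator_cyclic(2)[OF c] n by simp
  next
    case dih
    have rules: "a \<otimes> (a \<otimes> (a \<otimes> h)) = h" "b \<otimes> (b \<otimes> h) = h" "b \<otimes> (a \<otimes> h) = a \<otimes> (a \<otimes> (b \<otimes> h))" if "h \<in> carrier G" for h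
    proof -
      have "a \<otimes> (a \<otimes> (a \<otimes> h)) = (a \<otimes> (a \<otimes> a)) \<otimes> h" "b \<otimes> (b \<otimes> h) = (b \<otimes> b) \<otimes> h" "b \<otimes> (a \<otimes> h) = (b \<otimes> a) \<otimes> h"
        using that a b by (simp_all add: m_assoc)
      then show "a \<otimes> (a \<otimes> (a \<otimes> h)) = h" "b \<otimes> (b \<otimes> h) = h" "b \<otimes> (a \<otimes> h) = a \<otimes> (a \<otimes> (b \<otimes> h))"
        unfolding aaa bb dih using that a b by (simp_all add: m_assoc)
    qed
    define f :: "int \<times> bool \<Rightarrow> 'a" where
      "f = (\<lambda>(i, e). (if i = 0 then \<one> else if i = 1 then a else a \<otimes> a) \<otimes> pw \<one> b e)"
    have carrier: "carrier (dihedral_group 6) = {0, 1, 2} \<times> UNIV"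
      by (simp add: dihedral_group_def atLeastLessThan_int_3)
    have f_closed: "f x \<in> carrier G" for x
      using a b by (auto simp: f_def case_prod_unfold)
    have "dihedral_group 6 \<cong> G"
    proof (rule is_isoI)
      show hom: "f (x \<otimes>\<^bsub>dihedral_group 6\<^esub> y) = f x \<otimes> f y" if "x \<in> carrier (dihedral_group 6)" "y \<in> carrier (dihedral_group 6)" for x y
        using that unfolding carrier
        by (auto simp: dihedral_group_def f_def pw_def a b m_assoc aaa bb dih rules)
      have "inj_on f (carrier (dihedral_group 6))"
      proof (rule inj_onI)
        fix x y
        assume x: "x \<in> carrier (dihedral_group 6)" and y: "y \<in> carrier (dihedral_group 6)" and eq: "f x = f y"
        obtain i d j e where xy: "x = (i, d)" "y = (j, e)"
          by (metis surj_pair)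
        have par: "f (i, d) \<in> H \<longleftrightarrow> \<not> d" if "i \<in> {0, 1, 2}" for i d
        proof -
          let ?h = "if i = 0 then \<one> else if i = 1 then a else a \<otimes> a"
          have "?h \<in> H" "?h \<in> carrier G"
            using that a by (auto simp: H_def)
          moreover have "pw \<one> b d \<in> H \<longleftrightarrow> \<not> d"
            using bH by (simp add: pw_def H_def)
          ultimately show ?thesis
            using index_two_mult[OF H index, of ?h "pw \<one> b d"] b by (simp add: f_def)
        qed
        have ij: "i \<in> {0, 1, 2}" "j \<in> {0, 1, 2}"
          using x y unfolding carrier xy by auto
        then have de: "d = e"
          using par eq unfolding xy by metis
        have "(if i = 0 then \<one> else if i = 1 then a else a \<otimes> a) = (if j = 0 then \<one> else if j = 1 then a else a \<otimes> a)"
        proof (rule right_cancel[of "pw \<one> b e", THEN iffD1])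
          show "(if i = 0 then \<one> else if i = 1 then a else a \<otimes> a) \<otimes> pw \<one> b e =
              (if j = 0 then \<one> else if j = 1 then a else a \<otimes> a) \<otimes> pw \<one> b e"
            using eq unfolding xy de f_def prod.case .
        qed (use a b in \<open>simp_all add: pw_def\<close>)
        then have "i = j"
          using ij a1 aa1 aaa' by (auto split: if_splits)
        then show "x = y"
          by (simp add: xy de)
      qed
      moreover have "f ` carrier (dihedral_group 6) = carrier G"
        using f_closed card_image[OF calculation] order_dihedral_group[of 6] n
        by (intro card_subset_eq) (auto simp: order_def)
      ultimately show "bij_betw f (carrier (dihedral_group 6)) (carrier G)"
        by (simp add: bij_betw_def)
    qed
    then show ?thesis ..
  qed
qed

end

section \<open>Missing lengths\<close>

lemma ceiling_half: "nat \<lceil>real n / 2\<rceil> = (n + 1) div 2"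
proof -
  have "\<lceil>real n / 2\<rceil> = int ((n + 1) div 2)"
  proof (cases "even n")
    case True
    then show ?thesis
      by (auto elim!: evenE)
  next
    case False
    then obtain m where "n = 2 * m + 1"
      by (auto elim: oddE)
    then show ?thesis
      by (intro ceiling_unique) (auto simp: field_simps)
  qed
  then show ?thesis
    by simp
qed

section \<open>Explicit witnesses for the cyclic and dihedral groups of the list\<close>

lemma (in finite_group) has_maximal_of_iso:
  assumes H: "H \<cong> G" and es: "set es = carrier H"
    and m: "\<And>x y. x \<in> carrier H \<Longrightarrow> y \<in> carrier H \<Longrightarrow> m x y = x \<otimes>\<^bsub>H\<^esub> y" and "group H"
    and T: "maximal_witness es m T"
  shows "has_maximal_of_length (cayley_table G) (length T)"
proof -
  interpret H: group H
    by fact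
  obtain h where h: "h \<in> hom H G" "bij_betw h (carrier H) (carrier G)"
    using H by (auto simp: is_iso_def iso_def)
  show ?thesis
  proof (rule has_maximal_of_witness[OF _ _ T])
    show "bij_betw h (set es) (carrier G)"
      using h(2) by (simp add: es)
    show "m x y \<in> set es \<and> h x \<otimes> h y = h (m x y)" if "x \<in> set es" "y \<in> set es" for x y
      using that h(1) m by (simp add: es hom_mult)
  qed
qed

definition cyclic_witness :: "int \<Rightarrow> (int \<times> int) list \<Rightarrow> bool" where
  "cyclic_witness n T \<longleftrightarrow> maximal_witness [0..n - 1] (\<lambda>x y. (x + y) mod n) T"

definition dihedral_witness :: "int \<Rightarrow> ((int \<times> bool) \<times> (int \<times> bool)) list \<Rightarrow> bool" where
  "dihedral_witness m T \<longleftrightarrow> maximal_witness (List.product [0..m - 1] [False, True])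
     (\<lambda>x y. ((if snd x then fst x - fst y else fst x + fst y) mod m, snd x \<noteq> snd y)) T"

lemma (in finite_group) has_maximal_cyclic:
  assumes "integer_mod_group n \<cong> G" "0 < n" "cyclic_witness (int n) T"
  shows "has_maximal_of_length (cayley_table G) (length T)"
proof (rule has_maximal_of_iso[OF assms(1)])
  show "set [0..int n - 1] = carrier (integer_mod_group n)"
    using assms(2) by (auto simp: carrier_integer_mod_group)
qed (use assms(3) in \<open>auto simp: cyclic_witness_def\<close>)

lemma (in finite_group) has_maximal_dihedral:
  assumes "dihedral_group (2 * n) \<cong> G" "0 < n" "dihedral_witness (int n) T"
  shows "has_maximal_of_length (cayley_table G) (length T)"
proof (rule has_maximal_of_iso[OF assms(1)])
  show "set (List.product [0..int n - 1] [False, True]) = carrier (dihedral_group (2 * n))"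
    by (auto simp: dihedral_group_def)
  show "group (dihedral_group (2 * n))"
    using assms(2) by (intro group_dihedral_group) auto
qed (use assms(3) in \<open>auto simp: dihedral_witness_def dihedral_group_def\<close>)

text \<open>The lengths realised are 1 for order 2, 3 for order 3, 3 and 5 for order 5, and 3, 4 and
  5 for order 6. The one length left in each range is 2, 2, 4 and 6, respectively.\<close>

lemma cyclic_witnesses:
  "cyclic_witness 2 [(1, 0)]"
  "cyclic_witness 3 [(0, 1), (1, 2), (2, 0)]"
  "cyclic_witness 5 [(1, 0), (2, 1), (3, 4)]"
  "cyclic_witness 5 [(0, 1), (1, 4), (2, 2), (3, 0), (4, 3)]"
  "cyclic_witness 6 [(0, 4), (2, 0), (4, 2)]"
  "cyclic_witness 6 [(0, 1), (1, 4), (3, 3), (4, 0)]"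
  "cyclic_witness 6 [(1, 1), (2, 5), (3, 3), (4, 0), (5, 4)]"
  by code_simp+

text \<open>Order 6 gets the lengths 3, 4 and 5, order 8 the lengths 4, 6, 7 and 8; what remains is
  6 and 5.\<close>

lemma dihedral_witnesses:
  "dihedral_witness 3 [((0, False), (1, False)), ((1, False), (2, False)), ((2, False), (0, False))]"
  "dihedral_witness 3 [((0, False), (2, False)), ((0, True), (1, False)), ((2, False), (2, True)),
     ((2, True), (1, True))]"
  "dihedral_witness 3 [((0, True), (0, True)), ((1, False), (1, True)), ((1, True), (2, True)),
     ((2, False), (2, False)), ((2, True), (1, False))]"
  "dihedral_witness 4 [((0, False), (3, False)), ((0, True), (3, True)), ((2, False), (1, True)),
     ((2, True), (1, False))]"
  "dihedral_witness 4 [((0, False), (0, False)), ((1, False), (1, True)), ((1, True), (3, True)),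
     ((2, False), (2, True)), ((2, True), (1, False)), ((3, False), (0, True))]"
  "dihedral_witness 4 [((0, False), (0, False)), ((0, True), (1, True)), ((1, False), (1, False)),
     ((1, True), (3, False)), ((2, False), (2, True)), ((3, False), (0, True)), ((3, True), (2, False))]"
  "dihedral_witness 4 [((0, False), (2, True)), ((0, True), (0, True)), ((1, False), (1, False)),
     ((1, True), (0, False)), ((2, False), (1, True)), ((2, True), (3, True)), ((3, False), (2, False)),
     ((3, True), (3, False))]"
  by code_simp+

lemma near_omniversalI:
  assumes "(n + 1) div 2 \<le> l" "l \<le> n" "\<not> has_maximal_of_length L l"
    and "\<forall>l' \<in> set [(n + 1) div 2..<n + 1]. l' \<noteq> l \<longrightarrow> has_maximal_of_length L l'"
  shows "near_omniversal n L"
  unfolding near_omniversal_def ceiling_half using assms by (intro ex1I[of _ l]) auto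

context finite_group
begin

definition exceptional :: bool where
  "exceptional \<longleftrightarrow> G \<cong> integer_mod_group 2 \<or> G \<cong> integer_mod_group 3 \<or>
     G \<cong> integer_mod_group 5 \<or> G \<cong> integer_mod_group 6 \<or>
     G \<cong> dihedral_group 6 \<or> G \<cong> dihedral_group 8 \<or> (order G = 16 \<and> \<not> comm_group G)"

lemma order_of_iso: "H \<cong> G \<Longrightarrow> order H = order G"
  using iso_same_order by (auto simp: is_iso_def)

lemma cyclic_iso:
  assumes "integer_mod_group n \<cong> G" "0 < n"
  shows "order G = n" "comm_group G"
proof -
  show n: "order G = n"
    using order_of_iso[OF assms(1)] assms(2) by (simp add: order_def carrier_integer_mod_group)
  obtain h where h: "h \<in> hom (integer_mod_group n) G" "bij_betw h (carrier (integer_mod_group n)) (carrier G)"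
    using assms(1) by (auto simp: is_iso_def iso_def)
  show "comm_group G"
  proof (rule group_comm_groupI)
    fix x y
    assume "x \<in> carrier G" "y \<in> carrier G"
    then have "x \<in> h ` carrier (integer_mod_group n)" "y \<in> h ` carrier (integer_mod_group n)"
      using h(2) by (simp_all add: bij_betw_def)
    then obtain i j where ij: "i \<in> carrier (integer_mod_group n)" "j \<in> carrier (integer_mod_group n)" "x = h i" "y = h j"
      by (elim imageE)
    show "x \<otimes> y = y \<otimes> x"
      unfolding ij(3,4) hom_mult[OF h(1) ij(1,2), symmetric] hom_mult[OF h(1) ij(2,1), symmetric]
      by (simp add: add.commute)
  qed
qed

lemma near_omniversal_cyclic:
  assumes "integer_mod_group n \<cong> G" "n \<in> {2, 3, 5, 6}"
  shows "near_omniversal (order G) (cayley_table G)"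
proof -
  have n: "0 < n"
    using assms(2) by auto
  note iso = cyclic_iso[OF assms(1) n]
  note has = has_maximal_cyclic[OF assms(1) n]
  consider "n = 2" | "n = 3" | "n = 5" | "n = 6"
    using assms(2) by auto
  then show ?thesis
  proof cases
    case 1
    have "\<not> has_maximal_of_length (cayley_table G) 2"
      using full_missing_singly_even iso(1) 1 by simp
    moreover have "has_maximal_of_length (cayley_table G) 1"
      using has[of "[(1, 0)]"] cyclic_witnesses 1 by simp
    ultimately show ?thesis
      unfolding iso(1) 1 by (intro near_omniversalI[of _ 2]) (simp_all add: upt_conv_Cons)
  next
    case 2
    have "has_maximal_of_length (cayley_table G) 3"
      using has[of "[(0, 1), (1, 2), (2, 0)]"] cyclic_witnesses 2 by (simp add: numeral_eq_Suc)
    moreover have "\<not> has_maximal_of_length (cayley_table G) 2"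
      using abelian_missing[OF iso(2)] iso(1) 2 calculation by simp
    ultimately show ?thesis
      unfolding iso(1) 2 by (intro near_omniversalI[of _ 2]) (simp_all add: upt_conv_Cons)
  next
    case 3
    have "has_maximal_of_length (cayley_table G) 5"
      using has[of "[(0, 1), (1, 4), (2, 2), (3, 0), (4, 3)]"] cyclic_witnesses 3 by (simp add: numeral_eq_Suc)
    moreover have "\<not> has_maximal_of_length (cayley_table G) 4"
      using abelian_missing[OF iso(2)] iso(1) 3 calculation by simp
    moreover have "has_maximal_of_length (cayley_table G) 3"
      using has[of "[(1, 0), (2, 1), (3, 4)]"] cyclic_witnesses 3 by (simp add: numeral_eq_Suc)
    ultimately show ?thesis
      unfolding iso(1) 3 by (intro near_omniversalI[of _ 4]) (simp_all add: upt_conv_Cons)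
  next
    case 4
    have "\<not> has_maximal_of_length (cayley_table G) 6"
      using full_missing_singly_even iso(1) 4 by simp
    moreover have "has_maximal_of_length (cayley_table G) 3"
      using has[of "[(0, 4), (2, 0), (4, 2)]"] cyclic_witnesses 4 by (simp add: numeral_eq_Suc)
    moreover have "has_maximal_of_length (cayley_table G) 4"
      using has[of "[(0, 1), (1, 4), (3, 3), (4, 0)]"] cyclic_witnesses 4 by (simp add: numeral_eq_Suc)
    moreover have "has_maximal_of_length (cayley_table G) 5"
      using has[of "[(1, 1), (2, 5), (3, 3), (4, 0), (5, 4)]"] cyclic_witnesses 4 by (simp add: numeral_eq_Suc)
    ultimately show ?thesis
      unfolding iso(1) 4 by (intro near_omniversalI[of _ 6]) (simp_all add: upt_conv_Cons)
  qed
qed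

lemma dihedral_iso:
  assumes "dihedral_group (2 * n) \<cong> G" "2 < n"
  shows "order G = 2 * n" "\<not> comm_group G"
proof -
  show "order G = 2 * n"
    using order_of_iso[OF assms(1)] by (simp add: order_dihedral_group)
  obtain h where h: "h \<in> hom (dihedral_group (2 * n)) G" "bij_betw h (carrier (dihedral_group (2 * n))) (carrier G)"
    using assms(1) by (auto simp: is_iso_def iso_def)
  let ?r = "(1 :: int, False)" and ?s = "(0 :: int, True)"
  have c: "?r \<in> carrier (dihedral_group (2 * n))" "?s \<in> carrier (dihedral_group (2 * n))"
    "(1, True) \<in> carrier (dihedral_group (2 * n))" "(int n - 1, True) \<in> carrier (dihedral_group (2 * n))"
    using assms(2) by (auto simp: dihedral_group_def)
  have m: "?r \<otimes>\<^bsub>dihedral_group (2 * n)\<^esub> ?s = (1, True)" "?s \<otimes>\<^bsub>dihedral_group (2 * n)\<^esub> ?r = (int n - 1, True)"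
    using assms(2) by (auto simp: dihedral_group_def zmod_minus1)
  show "\<not> comm_group G"
  proof
    assume "comm_group G"
    then interpret comm_group G .
    have "h ?r \<otimes> h ?s = h ?s \<otimes> h ?r"
      using c h(2) by (intro m_comm) (auto simp: bij_betw_def)
    then have "h (1, True) = h (int n - 1, True)"
      unfolding hom_mult[OF h(1) c(1,2), symmetric] hom_mult[OF h(1) c(2,1), symmetric] m .
    then have "(1, True) = (int n - 1, True)"
      using c h(2) by (meson bij_betw_def inj_onD)
    then show False
      using assms(2) by simp
  qed
qed

lemma near_omniversal_dihedral:
  assumes "dihedral_group (2 * n) \<cong> G" "n \<in> {3, 4}"
  shows "near_omniversal (order G) (cayley_table G)"
proof -
  have n: "0 < n" "2 < n"
    using assms(2) by auto
  note iso = dihedral_iso[OF assms(1) n(2)]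
  note has = has_maximal_dihedral[OF assms(1) n(1)]
  consider "n = 3" | "n = 4"
    using assms(2) by auto
  then show ?thesis
  proof cases
    case 1
    have "\<not> has_maximal_of_length (cayley_table G) 6"
      using full_missing_singly_even iso(1) 1 by simp
    moreover have has': "has_maximal_of_length (cayley_table G) (length T)" if "dihedral_witness 3 T" for T
      using has[of T] that 1 by simp
    have "has_maximal_of_length (cayley_table G) 3" "has_maximal_of_length (cayley_table G) 4"
      "has_maximal_of_length (cayley_table G) 5"
      using dihedral_witnesses(1-3)[THEN has'] by (simp_all add: numeral_eq_Suc)
    ultimately show ?thesis
      unfolding iso(1) 1 by (intro near_omniversalI[of _ 6]) (simp_all add: upt_conv_Cons)
  next
    case 2
    have n8: "order G = 8"
      using iso(1) 2 by simp
    obtain k g1 g2 g3 where k: "k \<in> set groups8" and pc: "pc_group (set even_bits) (pres8 (bits_of k)) g1 g2 g3 \<one>"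
      using pc_group_groups8[OF finite_group_axioms n8] by blast
    have "k \<notin> {H0, H4, HA}"
      using order8_abelian[OF pc] iso(2) by blast
    then have "\<not> has_maximal_of_length (cayley_table G) 5"
      using k by (intro order8_missing5[OF n8 pc]) (auto simp: groups8_eq)
    moreover have has': "has_maximal_of_length (cayley_table G) (length T)" if "dihedral_witness 4 T" for T
      using has[of T] that 2 by simp
    have "has_maximal_of_length (cayley_table G) 4" "has_maximal_of_length (cayley_table G) 6"
      "has_maximal_of_length (cayley_table G) 7" "has_maximal_of_length (cayley_table G) 8"
      using dihedral_witnesses(4-7)[THEN has'] by (simp_all add: numeral_eq_Suc)
    ultimately show ?thesis
      unfolding iso(1) 2 by (intro near_omniversalI[of _ 5]) (simp_all add: upt_conv_Cons)
  qed
qed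

lemma near_omniversal_order16:
  assumes "order G = 16" "\<not> comm_group G"
  shows "near_omniversal (order G) (cayley_table G)"
  unfolding assms(1)
proof (rule near_omniversalI[of _ 9])
  show "\<not> has_maximal_of_length (cayley_table G) 9"
    using missing_of_large_gap[of 7] assms(1) by simp
qed (use has_maximal_order16[OF finite_group_axioms assms] in simp_all)

lemma iso_symI: "G \<cong> H \<Longrightarrow> H \<cong> G"
  using iso_sym by blast

lemma exceptional_near_omniversal:
  assumes exceptional
  shows "near_omniversal (order G) (cayley_table G)"
  using assms near_omniversal_cyclic near_omniversal_dihedral[of 3] near_omniversal_dihedral[of 4]
    near_omniversal_order16 unfolding exceptional_def by (auto dest!: iso_symI)

section \<open>Two missing lengths for every group outside the list\<close>

definition missing :: "nat \<Rightarrow> bool" where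
  "missing l \<longleftrightarrow> (order G + 1) div 2 \<le> l \<and> l \<le> order G \<and> \<not> has_maximal_of_length (cayley_table G) l"

lemma missingI:
  "\<not> has_maximal_of_length (cayley_table G) l \<Longrightarrow> (order G + 1) div 2 \<le> l \<Longrightarrow> l \<le> order G \<Longrightarrow> missing l"
  by (simp add: missing_def)

lemma missing_gap:
  assumes "2 * order G < 5 * k" "2 * k \<le> order G" "odd (order G) \<or> odd (order G div 2 + k)"
  shows "missing (order G - k)"
  using missing_of_large_gap[of k] assms by (intro missingI) auto

lemma missing_abelian:
  assumes "comm_group G" "2 \<le> order G"
  shows "missing (order G) \<or> missing (order G - 1)"
  using abelian_missing[OF assms(1)] assms(2) by (auto simp: missing_def)

text \<open>One of the two greatest lengths is always missing for an abelian group, so a missing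
  length below them is a second one.\<close>

lemma two_missing_abelian:
  assumes "comm_group G" "missing l" "l < order G - 1"
  shows "\<exists>l l'. l \<noteq> l' \<and> missing l \<and> missing l'"
proof -
  have "2 \<le> order G"
    using assms(3) by linarith
  then show ?thesis
    using missing_abelian[OF assms(1)] assms(2,3) by (metis diff_le_self less_irrefl order_less_le_trans)
qed

lemma two_missing:
  assumes n1: "1 < order G" and ne: "\<not> exceptional"
  shows "\<exists>l l'. l \<noteq> l' \<and> missing l \<and> missing l'"
proof -
  let ?n = "order G"
  \<comment> \<open>The bounds 17, 14, 12 and 32 are the first orders in their classes at which the
    uniform gaps chosen below satisfy 5k > 2n. Smaller orders are listed individually.\<close>
  have "n \<in> {2, 3, 5} \<or> n = 4 \<or> n = 6 \<or> n \<in> {7, 11, 13} \<or> n \<in> {9, 15} \<or> (odd n \<and> 17 \<le> n) \<or>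
      n = 8 \<or> n = 10 \<or> (n mod 4 = 2 \<and> 14 \<le> n) \<or> (n mod 8 = 4 \<and> 12 \<le> n) \<or> n = 16 \<or> n = 24 \<or>
      (n mod 8 = 0 \<and> 32 \<le> n)" if "1 < n" for n :: nat
  proof (cases "n < 32")
    case True
    then have "n \<in> set [2..<32]"
      using that unfolding set_upt by auto
    then show ?thesis
      by auto
  next
    case False
    moreover have "odd n \<or> n mod 4 = 2 \<or> n mod 8 = 4 \<or> n mod 8 = 0"
      by presburger
    ultimately show ?thesis
      by auto
  qed
  from this[OF n1] consider (prime_small) "?n \<in> {2, 3, 5}" | (four) "?n = 4" | (six) "?n = 6" | (odd_prime) "?n \<in> {7, 11, 13}"
    | (pq) "?n \<in> {9, 15}" | (odd_large) "odd ?n" "17 \<le> ?n" | (eight) "?n = 8" | (ten) "?n = 10"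
    | (m2) "?n mod 4 = 2" "14 \<le> ?n" | (m4) "?n mod 8 = 4" "12 \<le> ?n" | (sixteen) "?n = 16"
    | (n24) "?n = 24" | (m8) "?n mod 8 = 0" "32 \<le> ?n"
    by argo
  then show ?thesis
  proof cases
    case prime_small
    then have "Factorial_Ring.prime ?n"
      by auto
    then have "integer_mod_group ?n \<cong> G"
      by (rule prime_order_cyclic)
    then have "G \<cong> integer_mod_group ?n"
      using group.iso_sym[OF group_integer_mod_group] by blast
    then show ?thesis
      using ne prime_small unfolding exceptional_def by auto
  next
    case four
    have "comm_group G"
      by (rule order_prime_product_abelian[of 2 2]) (use four in auto)
    moreover have "missing 2"
      using half_missing_doubly_even four by (intro missingI) simp_all
    ultimately show ?thesis
      using four by (intro two_missing_abelian[of 2]) auto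
  next
    case six
    then show ?thesis
      using order6_cases group.iso_sym[OF group_integer_mod_group, of 6 G] group.iso_sym[OF group_dihedral_group[of 6], of G]
        ne unfolding exceptional_def by auto
  next
    case odd_prime
    then have "Factorial_Ring.prime ?n"
      by auto
    then have "comm_group G"
      by (rule prime_order_cyclic)
    moreover have "missing (?n - (?n - 1) div 2)"
      using odd_prime by (intro missing_gap) auto
    ultimately show ?thesis
      using odd_prime by (elim two_missing_abelian) auto
  next
    case pq
    have "comm_group G"
    proof (cases "?n = 9")
      case True
      show ?thesis
      proof (rule order_prime_product_abelian[of 3 3])
        fix j :: nat
        assume "3 dvd j ^ (3 * 3) - 1" "0 < j" "j < 3"
        moreover from this have "j = 1 \<or> j = 2"
          by linarith
        ultimately show "j = 1"
          by auto
      qed (use True in simp_all)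
    next
      case False
      show ?thesis
      proof (rule order_prime_product_abelian[of 5 3])
        fix j :: nat
        assume "5 dvd j ^ (5 * 3) - 1" "0 < j" "j < 5"
        moreover from this have "j = 1 \<or> j = 2 \<or> j = 3 \<or> j = 4"
          by linarith
        ultimately show "j = 1"
          by auto
      qed (use False pq in simp_all)
    qed
    moreover have "missing (?n - (?n - 1) div 2)"
      using pq by (intro missing_gap) auto
    ultimately show ?thesis
      using pq by (elim two_missing_abelian) auto
  next
    case odd_large
    obtain m where m: "?n = 2 * m + 1"
      using odd_large(1) by (elim oddE)
    \<comment> \<open>For odd order every gap above the threshold is excluded; 5(m - 1) > 2(2m + 1)
      amounts to m \<ge> 8.\<close>
    have "missing (?n - m)" "missing (?n - (m - 1))"
      by (rule missing_gap; use odd_large m in linarith)+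
    moreover have "?n - m \<noteq> ?n - (m - 1)"
      using odd_large m by auto
    ultimately show ?thesis
      by blast
  next
    case eight
    obtain k g1 g2 g3 where k: "k \<in> set groups8" and pc: "pc_group (set even_bits) (pres8 (bits_of k)) g1 g2 g3 \<one>"
      using pc_group_groups8[OF finite_group_axioms eight] by blast
    have 5: "missing 5" if "k \<in> {H0, H4, H1, H7}"
      using order8_missing5[OF eight pc that] eight by (intro missingI) simp_all
    have 4: "missing 4" if "k \<in> {HA, H7}"
      using order8_missing4[OF eight pc that] eight by (intro missingI) simp_all
    have "k \<noteq> H1"
      using order8_dihedral pc ne unfolding exceptional_def by blast
    then consider "k = H7" | "k = HA" | "k \<in> {H0, H4}"
      using k by (auto simp: groups8_eq)
    then show ?thesis
    proof cases
      case 1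
      then have "missing 4" "missing 5"
        using 4 5 by simp_all
      then show ?thesis
        by (intro exI[of _ 4] exI[of _ 5]) simp
    next
      case 2
      then show ?thesis
        using 4 order8_abelian[OF pc] eight by (intro two_missing_abelian[of 4]) auto
    next
      case 3
      then show ?thesis
        using 5 order8_abelian[OF pc] eight by (intro two_missing_abelian[of 5]) auto
    qed
  next
    case ten
    have "missing 10" "missing 6"
      using full_missing_singly_even order10_missing[OF ten] ten by (auto intro!: missingI)
    then show ?thesis
      by (intro exI[of _ 10] exI[of _ 6]) simp
  next
    case m2
    define m where "m = ?n div 4"
    have m: "?n = 4 * m + 2"
      using div_mult_mod_eq[of ?n 4] m2(1) unfolding m_def by linarith
    have "missing ?n"
      using full_missing_singly_even[OF m2(1)] by (intro missingI) auto
    \<comment> \<open>Here n/2 + 2m = 4m + 1 is odd, and 10m > 8m + 4 amounts to m \<ge> 3.\<close>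
    moreover have "missing (?n - 2 * m)"
      using m2(2) unfolding m by (intro missing_gap[of "2 * m", unfolded m]) simp_all
    moreover have "?n \<noteq> ?n - 2 * m"
      using m2(2) m by simp
    ultimately show ?thesis
      by blast
  next
    case m4
    define m where "m = ?n div 8"
    have m: "?n = 8 * m + 4"
      using div_mult_mod_eq[of ?n 8] m4(1) unfolding m_def by linarith
    have "missing (?n div 2)"
      using half_missing_doubly_even[OF m4(1)] m by (intro missingI) simp_all
    \<comment> \<open>The gap is n/2 - 1, so its sum with n/2 is odd, and 5(4m + 1) > 2n holds as
      soon as m \<ge> 1.\<close>
    moreover have "missing (?n - (4 * m + 1))"
      using m4(2) unfolding m by (intro missing_gap[of "4 * m + 1", unfolded m]) simp_all
    moreover have "?n div 2 \<noteq> ?n - (4 * m + 1)"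
      using m by simp
    ultimately show ?thesis
      by blast
  next
    case sixteen
    have "missing (?n - 7)"
      using sixteen by (intro missing_gap) auto
    moreover have "comm_group G"
      using sixteen ne by (simp add: exceptional_def)
    ultimately show ?thesis
      using sixteen by (elim two_missing_abelian[rotated]) auto
  next
    case n24
    have "missing (?n - 11)"
      using n24 by (intro missing_gap) auto
    then have "missing 13"
      using n24 by simp
    moreover have "missing 15 \<or> missing 24"
      using order24_missing[OF n24] n24 by (auto simp: missing_def)
    moreover have "(13::nat) \<noteq> 15" "(13::nat) \<noteq> 24"
      by simp_all
    ultimately show ?thesis
      by blast
  next
    case m8
    \<comment> \<open>With n = 8m + 32 the gaps n/2 - 1 and n/2 - 3 are 4m + 15 and 4m + 13. The
      smaller one satisfies 5(4m + 13) > 16m + 64 for every m, by a margin of only 1 when m =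
      0.\<close>
    define m where "m = ?n div 8 - 4"
    have m: "?n = 8 * m + 32"
      using div_mult_mod_eq[of ?n 8] m8 unfolding m_def by linarith
    have "missing (?n - (4 * m + 15))"
      unfolding m by (intro missing_gap[of "4 * m + 15", unfolded m]) simp_all
    moreover have "missing (?n - (4 * m + 13))"
      unfolding m by (intro missing_gap[of "4 * m + 13", unfolded m]) simp_all
    moreover have "?n - (4 * m + 15) \<noteq> ?n - (4 * m + 13)"
      using m by simp
    ultimately show ?thesis
      by blast
  qed
qed

end

theorem theorem1p5:
  fixes G :: "('a, 'b) monoid_scheme"
  assumes "group G" and "finite (carrier G)"
  shows "(order G > 1 \<longrightarrow> \<not> omniversal (order G) (cayley_table G)) \<and>
    (near_omniversal (order G) (cayley_table G) \<longleftrightarrow>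
       G \<cong> integer_mod_group 2 \<or> G \<cong> integer_mod_group 3 \<or>
       G \<cong> integer_mod_group 5 \<or> G \<cong> integer_mod_group 6 \<or>
       G \<cong> dihedral_group 6 \<or> G \<cong> dihedral_group 8 \<or>
       (order G = 16 \<and> \<not> comm_group G))"
proof -
  interpret finite_group G
    using assms by (simp add: finite_group_def finite_group_axioms_def)
  have near_iff: "near_omniversal (order G) (cayley_table G) \<longleftrightarrow> (\<exists>!l. missing l)"
    by (simp add: near_omniversal_def ceiling_half missing_def conj_assoc)
  have omni_iff: "omniversal (order G) (cayley_table G) \<longleftrightarrow> (\<nexists>l. missing l)"
    by (auto simp: omniversal_def ceiling_half missing_def)
  \<comment> \<open>For order 1 the range consists of the length 1, which occurs. So the trivial
    group is omniversal rather than near-omniversal and must be kept apart in both claims.\<close>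
  have trivial: "\<nexists>l. missing l" if "order G = 1"
  proof -
    have "carrier G = {\<one>\<^bsub>G\<^esub>}"
      using that by (metis card_1_singletonE one_closed order_def singletonD)
    then have "has_maximal_of_length (cayley_table G) (length [(\<one>\<^bsub>G\<^esub>, \<one>\<^bsub>G\<^esub>)])"
      by (intro has_maximal_of_witness[of "\<lambda>x. x" "[\<one>\<^bsub>G\<^esub>]" "\<lambda>_ _. \<one>\<^bsub>G\<^esub>"]) (auto simp: maximal_witness_def bij_betw_def)
    then show ?thesis
      using that by (auto simp: missing_def le_Suc_eq)
  qed
  have pos: "0 < order G"
    by (simp add: order_gt_0_iff_finite)
  have "\<not> omniversal (order G) (cayley_table G)" if "1 < order G"
  proof (cases exceptional)
    case True
    then show ?thesis
      using exceptional_near_omniversal unfolding omni_iff near_iff by blast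
  next
    case False
    then show ?thesis
      using two_missing[OF that] unfolding omni_iff by blast
  qed
  moreover have "near_omniversal (order G) (cayley_table G) \<longleftrightarrow> exceptional"
  proof
    assume near: "near_omniversal (order G) (cayley_table G)"
    show exceptional
    proof (rule ccontr)
      assume ne: "\<not> exceptional"
      have "order G \<noteq> 1"
        using near trivial unfolding near_iff by blast
      then show False
        using two_missing[OF _ ne] near pos unfolding near_iff by force
    qed
  qed (rule exceptional_near_omniversal)
  ultimately show ?thesis
    unfolding exceptional_def by blast
qed

end
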